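(* Let $(M,d_M,0_M)$ and $(N,d_N,0_N)$ be infinite pointed metric spaces, and let $f: M \to N$ and $\omega: M \to \mathbb{C}$ be maps such that $\omega C_f: \mathrm{Lip}_0(N)\to \mathrm{Lip}_0(M)$, $g\mapsto \big(x\mapsto \omega(x)\,g(f(x))\big)$, is a (well-defined) bounded linear operator. Then the following properties are equivalent: (i) $\omega C_f$ is compact; (ii) $\omega C_f$ is weakly compact; (iii) $\omega C_f$ is super strictly singular; (iv) $\omega C_f$ is super strictly cosingular; (v) $\omega C_f$ is strictly singular; (vi) $\omega C_f$ is strictly cosingular; (vii) $\omega C_f$ does not fix any copy of $\ell^\infty$; (viii) $\omega C_f$ does not fix any complemented copy of $\ell^\infty$.
   Context: All vector spaces are over $\mathbb{C}$. A pointed metric space is a metric space $(M,d)$ with a distinguished point $0_M\in M$. $\mathrm{Lip}_0(M)$ is the Banach space of Lipschitz functions $g:M\to\mathbb{C}$ with $g(0_M)=0$, normed by $\|g\|_L=\sup_{x\neq y}\frac{|g(x)-g(y)|}{d(x,y)}$. Let $X,Y$ be Banach spaces and $T:X\to Y$ a bounded linear operator; $S_E$ denotes the unit sphere and $B_X$ the closed unit ball; subspaces by which one takes quotients are closed. - $T$ is strictly singular if there is no infinite-dimensional (closed) subspace $E\subset X$ such that $T|_E$ is an isomorphism onto its range. - $T$ is strictly cosingular if for every closed subspace $Z\subset Y$ with $\dim(Y/Z)=\infty$, the map $Q\circ T:X\to Y/Z$ is not surjective, where $Q:Y\to Y/Z$ is the canonical quotient map. - $T$ is super strictly singular if for every $\varepsilon>0$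 there is $N_\varepsilon\in\mathbb{N}$, $N_\varepsilon\ge 1$, such that for every subspace $E\subset X$ with $\dim(E)\ge N_\varepsilon$ there is $x\in S_E$ with $\|T(x)\|\le\varepsilon$; that is, $b_n(T):=\sup_{E\subset X,\ \dim E=n}\ \inf\{\|T(x)\|:x\in S_E\}\to 0$ as $n\to\infty$. - $T$ is super strictly cosingular if $a_n(T):=\sup\{\alpha_E(T): E\subset Y \text{ closed subspace},\ \dim(Y/E)=n\}\to 0$ as $n\to\infty$, where $\alpha_E(T):=\sup\{\alpha\ge 0:\alpha B_{Y/E}\subset Q\circ T(B_X)\}$ and $Q:Y\to Y/E$ is the canonical quotient map. - $T$ fixes a copy of $\ell^\infty$ if there are closed subspaces $E\subset X$ and $F\subset Y$, both isomorphic to $\ell^\infty$, such that $T|_E:E\to F$ is an isomorphism. $T$ fixes a complemented copy of $\ell^\infty$ if, in addition, $E$ and $F$ can be chosen so that $E$ is complemented in $X$ and $F$ is complemented in $Y$. *)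

theory Defs
  imports "HOL-Analysis.Analysis"
begin

section \<open>Complex normed spaces\<close>

class complex_normed_vector = real_normed_vector +
  fixes scaleC :: "complex \<Rightarrow> 'a \<Rightarrow> 'a" (infixr "*\<^sub>C" 75)
  assumes scaleC_add_right: "c *\<^sub>C (x + y) = c *\<^sub>C x + c *\<^sub>C y"
    and scaleC_add_left: "(b + c) *\<^sub>C x = b *\<^sub>C x + c *\<^sub>C x"
    and scaleC_scaleC: "b *\<^sub>C (c *\<^sub>C x) = (b * c) *\<^sub>C x"
    and scaleC_of_real: "complex_of_real r *\<^sub>C x = r *\<^sub>R x"
    and norm_scaleC: "norm (c *\<^sub>C x) = cmod c * norm x"

lemma scaleC_one: "1 *\<^sub>C x = (x :: 'a :: complex_normed_vector)"
  using scaleC_of_real[of 1 x] by simp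

global_interpretation complex_vector:
  vector_space "scaleC :: complex \<Rightarrow> 'a \<Rightarrow> 'a :: complex_normed_vector"
  defines cspan = complex_vector.span
    and csubspace = complex_vector.subspace
    and cdependent = complex_vector.dependent
    and cdim = complex_vector.dim
  by unfold_locales (simp_all add: scaleC_add_right scaleC_add_left scaleC_scaleC scaleC_one)

definition bounded_clinear :: "('a::complex_normed_vector \<Rightarrow> 'b::complex_normed_vector) \<Rightarrow> bool"
  where "bounded_clinear T \<longleftrightarrow> bounded_linear T \<and> (\<forall>c x. T (c *\<^sub>C x) = c *\<^sub>C T x)"

instantiation complex :: complex_normed_vector
begin

definition scaleC_complex :: "complex \<Rightarrow> complex \<Rightarrow> complex"
  where "scaleC_complex c x = c * x"

instance
  by standard (simp_all add: scaleC_complex_def algebra_simps norm_mult scaleR_conv_of_real)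

end

lemma bounded_linear_scaleC: "bounded_linear (\<lambda>x :: 'c::complex_normed_vector. c *\<^sub>C x)"
proof (rule bounded_linear_intro[where K = "cmod c"])
  fix r :: real and x :: 'c
  show "c *\<^sub>C (r *\<^sub>R x) = r *\<^sub>R (c *\<^sub>C x)"
    by (simp add: scaleC_of_real[symmetric] scaleC_scaleC mult.commute)
qed (simp_all add: scaleC_add_right norm_scaleC mult.commute)

instantiation bcontfun :: (topological_space, complex_normed_vector) complex_normed_vector
begin

definition scaleC_bcontfun :: "complex \<Rightarrow> ('a \<Rightarrow>\<^sub>C 'b) \<Rightarrow> 'a \<Rightarrow>\<^sub>C 'b"
  where "scaleC_bcontfun c g = Bcontfun (\<lambda>x. c *\<^sub>C apply_bcontfun g x)"

lemma scaleC_bcontfun_rep_eq: "apply_bcontfun (c *\<^sub>C g) x = c *\<^sub>C apply_bcontfun g x"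
proof -
  have "(\<lambda>x. c *\<^sub>C apply_bcontfun g x) \<in> bcontfun"
  proof (rule bcontfun_normI)
    show "continuous_on UNIV (\<lambda>x. c *\<^sub>C apply_bcontfun g x)"
      by (intro bounded_linear.continuous_on[OF bounded_linear_scaleC] continuous_on_apply_bcontfun)
    show "norm (c *\<^sub>C apply_bcontfun g x) \<le> cmod c * norm g" for x
      by (simp add: norm_scaleC norm_bounded mult_left_mono)
  qed
  then show ?thesis by (simp add: scaleC_bcontfun_def Bcontfun_inverse)
qed

instance
proof
  fix b c :: complex and r :: real and x y :: "'a \<Rightarrow>\<^sub>C 'b"
  show "c *\<^sub>C (x + y) = c *\<^sub>C x + c *\<^sub>C y"
    by (rule bcontfun_eqI) (simp add: scaleC_bcontfun_rep_eq scaleC_add_right)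
  show "(b + c) *\<^sub>C x = b *\<^sub>C x + c *\<^sub>C x"
    by (rule bcontfun_eqI) (simp add: scaleC_bcontfun_rep_eq scaleC_add_left)
  show assoc: "b *\<^sub>C (c *\<^sub>C x) = (b * c) *\<^sub>C x" for b c :: complex and x :: "'a \<Rightarrow>\<^sub>C 'b"
    by (rule bcontfun_eqI) (simp add: scaleC_bcontfun_rep_eq scaleC_scaleC)
  show "complex_of_real r *\<^sub>C x = r *\<^sub>R x"
    by (rule bcontfun_eqI) (simp add: scaleC_bcontfun_rep_eq scaleC_of_real)
  have le: "norm (c *\<^sub>C x) \<le> cmod c * norm x" for c :: complex and x :: "'a \<Rightarrow>\<^sub>C 'b"
    by (rule norm_bound)
      (simp add: scaleC_bcontfun_rep_eq norm_scaleC norm_bounded mult_left_mono)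
  show "norm (c *\<^sub>C x) = cmod c * norm x"
  proof (cases "c = 0")
    case True
    then show ?thesis using le[of c x] by simp
  next
    case False
    have "x = inverse c *\<^sub>C (c *\<^sub>C x)"
      using False by (intro bcontfun_eqI) (simp add: scaleC_bcontfun_rep_eq scaleC_scaleC scaleC_one)
    then have "norm x \<le> inverse (cmod c) * norm (c *\<^sub>C x)"
      using le[of "inverse c" "c *\<^sub>C x"] by (simp add: norm_inverse)
    then have "cmod c * norm x \<le> norm (c *\<^sub>C x)"
      using False by (simp add: field_simps)
    then show ?thesis using le[of c x] by simp
  qed
qed

end

text \<open>The discrete topology on \<^typ>\<open>nat\<close> makes this the space of all bounded complex
  sequences, with the supremum norm.\<close>

type_synonym linf = "nat \<Rightarrow>\<^sub>C complex"


section \<open>The space of Lipschitz functions vanishing at the base point\<close>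

text \<open>A pointed metric space is a type of sort \<open>{metric_space, zero}\<close>, the distinguished
  point being \<open>0\<close>; no relation between \<open>0\<close> and the metric is imposed.\<close>

typedef (overloaded) ('a::"{metric_space, zero}") lip0 =
  "{g :: 'a \<Rightarrow> complex. (\<exists>L. L-lipschitz_on UNIV g) \<and> g 0 = 0}"
  morphisms lip0_apply Lip0
proof
  show "(\<lambda>_. 0) \<in> {g :: 'a \<Rightarrow> complex. (\<exists>L. L-lipschitz_on UNIV g) \<and> g 0 = 0}"
    by (auto simp: lipschitz_on_def)
qed

setup_lifting type_definition_lip0

lemma lip0_eqI: "(\<And>x. lip0_apply g x = lip0_apply h x) \<Longrightarrow> g = h"
  by (simp add: lip0_apply_inject[symmetric] fun_eq_iff)

lemma lip0_apply_0 [simp]: "lip0_apply g 0 = 0"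
  using lip0_apply[of g] by simp

text \<open>Pairs with \<open>x = y\<close> contribute \<open>0 / 0 = 0\<close>. They do not affect the supremum over
  distinct points, and give the value \<open>0\<close> on a one-point space.\<close>

definition lip_seminorm :: "('a::metric_space \<Rightarrow> complex) \<Rightarrow> real"
  where "lip_seminorm g = (SUP (x, y). cmod (g x - g y) / dist x y)"

lemma lip_seminorm_bdd:
  assumes "L-lipschitz_on UNIV g"
  shows "bdd_above (range (\<lambda>(x, y). cmod (g x - g y) / dist x y))"
proof (rule bdd_aboveI2[where M = L])
  fix p :: "'a \<times> 'a"
  obtain x y where p: "p = (x, y)" by (cases p)
  have L: "L \<ge> 0" "dist (g x) (g y) \<le> L * dist x y"
    using assms by (auto simp: lipschitz_on_def)
  show "(case p of (x, y) \<Rightarrow> cmod (g x - g y) / dist x y) \<le> L"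
    using L by (cases "x = y") (auto simp: p dist_norm[symmetric] divide_le_eq)
qed

lemma lip_seminorm_le:
  assumes "\<And>x y. cmod (g x - g y) \<le> L * dist x y" "L \<ge> 0"
  shows "lip_seminorm g \<le> L"
  unfolding lip_seminorm_def
proof (rule cSUP_least)
  fix p :: "'a \<times> 'a"
  show "(case p of (x, y) \<Rightarrow> cmod (g x - g y) / dist x y) \<le> L"
    using assms by (cases p; cases "fst p = snd p") (auto simp: divide_le_eq)
qed simp

lemma lip_seminorm_bound:
  assumes "L-lipschitz_on UNIV g"
  shows "cmod (g x - g y) \<le> lip_seminorm g * dist x y"
proof (cases "x = y")
  case False
  have "cmod (g x - g y) / dist x y \<le> lip_seminorm g"
    unfolding lip_seminorm_def
    using cSUP_upper[OF _ lip_seminorm_bdd[OF assms], of "(x, y)"] by simp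
  then show ?thesis using False by (simp add: divide_le_eq)
qed simp

lemma lip_seminorm_nonneg:
  assumes "L-lipschitz_on UNIV (g :: 'a::metric_space \<Rightarrow> complex)"
  shows "lip_seminorm g \<ge> 0"
  unfolding lip_seminorm_def
  using cSUP_upper[OF _ lip_seminorm_bdd[OF assms], of "(undefined, undefined)"] by simp

instantiation lip0 :: ("{metric_space, zero}") complex_normed_vector
begin

lift_definition zero_lip0 :: "'a lip0" is "\<lambda>_. 0"
  by (auto simp: lipschitz_on_def)

lift_definition plus_lip0 :: "'a lip0 \<Rightarrow> 'a lip0 \<Rightarrow> 'a lip0" is "\<lambda>g h x. g x + h x"
  using lipschitz_on_add by fastforce

lift_definition uminus_lip0 :: "'a lip0 \<Rightarrow> 'a lip0" is "\<lambda>g x. - g x"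
  using lipschitz_on_minus by fastforce

lift_definition minus_lip0 :: "'a lip0 \<Rightarrow> 'a lip0 \<Rightarrow> 'a lip0" is "\<lambda>g h x. g x - h x"
  using lipschitz_on_diff by fastforce

lift_definition scaleC_lip0 :: "complex \<Rightarrow> 'a lip0 \<Rightarrow> 'a lip0" is "\<lambda>c g x. c * g x"
proof -
  fix c :: complex and g :: "'a \<Rightarrow> complex"
  assume "(\<exists>L. L-lipschitz_on UNIV g) \<and> g 0 = 0"
  then obtain L where "L-lipschitz_on UNIV g" "g 0 = 0" by auto
  then have "(cmod c * L)-lipschitz_on UNIV (\<lambda>x. c * g x)"
    by (auto simp: lipschitz_on_def dist_norm right_diff_distrib[symmetric] norm_mult
        mult.assoc mult_left_mono)
  then show "(\<exists>L. L-lipschitz_on UNIV (\<lambda>x. c * g x)) \<and> c * g 0 = 0"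
    using \<open>g 0 = 0\<close> by auto
qed

definition scaleR_lip0 :: "real \<Rightarrow> 'a lip0 \<Rightarrow> 'a lip0"
  where "scaleR_lip0 r g = complex_of_real r *\<^sub>C g"

lift_definition norm_lip0 :: "'a lip0 \<Rightarrow> real" is lip_seminorm .

definition sgn_lip0 :: "'a lip0 \<Rightarrow> 'a lip0"
  where "sgn_lip0 g = inverse (norm g) *\<^sub>R g"

definition dist_lip0 :: "'a lip0 \<Rightarrow> 'a lip0 \<Rightarrow> real"
  where "dist_lip0 g h = norm (g - h)"

definition uniformity_lip0 :: "('a lip0 \<times> 'a lip0) filter"
  where "uniformity_lip0 = (INF e\<in>{0 <..}. principal {(x, y). dist x y < e})"

definition open_lip0 :: "'a lip0 set \<Rightarrow> bool"
  where "open_lip0 S = (\<forall>x\<in>S. \<forall>\<^sub>F (x', y) in uniformity. x' = x \<longrightarrow> y \<in> S)"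

lemmas lip0_rep_eq [simp] = zero_lip0.rep_eq plus_lip0.rep_eq uminus_lip0.rep_eq
  minus_lip0.rep_eq scaleC_lip0.rep_eq

lemma norm_lip0_bound: "cmod (lip0_apply g x - lip0_apply g y) \<le> norm g * dist x y"
  using lip0_apply[of g] lip_seminorm_bound by (auto simp: norm_lip0.rep_eq)

lemma norm_lip0_nonneg: "norm (g :: 'a lip0) \<ge> 0"
  using lip0_apply[of g] lip_seminorm_nonneg by (auto simp: norm_lip0.rep_eq)

lemma norm_lip0_le:
  "(\<And>x y. cmod (lip0_apply g x - lip0_apply g y) \<le> L * dist x y) \<Longrightarrow> L \<ge> 0 \<Longrightarrow> norm g \<le> L"
  unfolding norm_lip0.rep_eq by (rule lip_seminorm_le)

lemma norm_scaleC_lip0: "norm (c *\<^sub>C g) = cmod c * norm (g :: 'a lip0)"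
proof (rule antisym)
  have le: "norm (c *\<^sub>C g) \<le> cmod c * norm (g :: 'a lip0)" for c g
  proof (rule norm_lip0_le)
    fix x y
    show "cmod (lip0_apply (c *\<^sub>C g) x - lip0_apply (c *\<^sub>C g) y) \<le> cmod c * norm g * dist x y"
      using mult_left_mono[OF norm_lip0_bound, of "cmod c" g x y]
      by (simp add: right_diff_distrib[symmetric] norm_mult mult.assoc)
  qed (simp add: norm_lip0_nonneg)
  show "norm (c *\<^sub>C g) \<le> cmod c * norm g" by (rule le)
  show "cmod c * norm g \<le> norm (c *\<^sub>C g)"
  proof (cases "c = 0")
    case False
    have "inverse c *\<^sub>C (c *\<^sub>C g) = g"
      using False by (intro lip0_eqI) simp
    then have "norm g \<le> inverse (cmod c) * norm (c *\<^sub>C g)"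
      using le[of "inverse c" "c *\<^sub>C g"] by (simp add: norm_inverse)
    then show ?thesis using False by (simp add: field_simps)
  qed (simp add: norm_lip0_nonneg)
qed

instance
proof
  fix g h k :: "'a lip0" and a b :: real and c d :: complex
  show "g + h + k = g + (h + k)" "g + h = h + g" "0 + g = g" "- g + g = 0" "g - h = g + - h"
    "c *\<^sub>C (g + h) = c *\<^sub>C g + c *\<^sub>C h" "(c + d) *\<^sub>C g = c *\<^sub>C g + d *\<^sub>C g"
    "c *\<^sub>C d *\<^sub>C g = (c * d) *\<^sub>C g" "complex_of_real a *\<^sub>C g = a *\<^sub>R g"
    "a *\<^sub>R (g + h) = a *\<^sub>R g + a *\<^sub>R h" "(a + b) *\<^sub>R g = a *\<^sub>R g + b *\<^sub>R g"
    "a *\<^sub>R b *\<^sub>R g = (a * b) *\<^sub>R g" "1 *\<^sub>R g = g"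
    by (auto intro!: lip0_eqI simp: algebra_simps scaleR_lip0_def)
  show "norm (c *\<^sub>C g) = cmod c * norm g" by (rule norm_scaleC_lip0)
  show "norm (a *\<^sub>R g) = \<bar>a\<bar> * norm g" by (simp add: scaleR_lip0_def norm_scaleC_lip0)
  show "norm g = 0 \<longleftrightarrow> g = 0"
  proof
    assume "norm g = 0"
    then show "g = 0"
      using norm_lip0_bound[of g _ 0] by (intro lip0_eqI) simp
  next
    assume "g = 0"
    then show "norm g = 0"
      using norm_lip0_le[of g 0] norm_lip0_nonneg[of g] by simp
  qed
  show "norm (g + h) \<le> norm g + norm h"
  proof (rule norm_lip0_le)
    fix x y
    have "cmod (lip0_apply (g + h) x - lip0_apply (g + h) y)
      \<le> cmod (lip0_apply g x - lip0_apply g y) + cmod (lip0_apply h x - lip0_apply h y)"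
      using norm_triangle_ineq[of "lip0_apply g x - lip0_apply g y"
          "lip0_apply h x - lip0_apply h y"] by (simp add: algebra_simps)
    also have "\<dots> \<le> (norm g + norm h) * dist x y"
      using norm_lip0_bound[of g x y] norm_lip0_bound[of h x y] by (simp add: algebra_simps)
    finally show "cmod (lip0_apply (g + h) x - lip0_apply (g + h) y)
      \<le> (norm g + norm h) * dist x y" .
  qed (simp add: norm_lip0_nonneg)
qed (rule sgn_lip0_def dist_lip0_def uniformity_lip0_def open_lip0_def)+

end

instance lip0 :: ("{metric_space, zero}") banach
proof
  fix G :: "nat \<Rightarrow> 'a lip0"
  assume G: "Cauchy G"
  have pt: "Cauchy (\<lambda>n. lip0_apply (G n) x)" for x
  proof (rule CauchyI)
    fix e :: real assume "e > 0"
    then have "e / (dist x 0 + 1) > 0" by (simp add: add_nonneg_pos)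
    then obtain K where K: "\<And>m n. m \<ge> K \<Longrightarrow> n \<ge> K \<Longrightarrow> norm (G m - G n) < e / (dist x 0 + 1)"
      using CauchyD[OF G] by blast
    have "cmod (lip0_apply (G m) x - lip0_apply (G n) x) < e" if "m \<ge> K" "n \<ge> K" for m n
    proof -
      have "cmod (lip0_apply (G m) x - lip0_apply (G n) x) \<le> norm (G m - G n) * dist x 0"
        using norm_lip0_bound[of "G m - G n" x 0] by simp
      also have "\<dots> \<le> e / (dist x 0 + 1) * dist x 0"
        using K[OF that] by (intro mult_right_mono) auto
      also have "\<dots> < e"
        using \<open>e > 0\<close> by (simp add: divide_less_eq add_nonneg_pos)
      finally show ?thesis .
    qed
    then show "\<exists>M. \<forall>m\<ge>M. \<forall>n\<ge>M. norm (lip0_apply (G m) x - lip0_apply (G n) x) < e"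
      by blast
  qed
  define g where "g x = lim (\<lambda>n. lip0_apply (G n) x)" for x
  have lim: "(\<lambda>n. lip0_apply (G n) x) \<longlonglongrightarrow> g x" for x
    using pt[of x] by (simp add: g_def Cauchy_convergent_iff convergent_LIMSEQ_iff)
  obtain B where B: "\<And>n. norm (G n) \<le> B"
    using Cauchy_Bseq[OF G] by (auto simp: Bseq_def)
  have "cmod (g x - g y) \<le> B * dist x y" for x y
  proof (rule LIMSEQ_le_const2[OF tendsto_norm[OF tendsto_diff[OF lim lim]]])
    show "\<exists>N. \<forall>n\<ge>N. cmod (lip0_apply (G n) x - lip0_apply (G n) y) \<le> B * dist x y"
      using norm_lip0_bound B by (meson mult_right_mono order_trans zero_le_dist)
  qed
  moreover have "B \<ge> 0"
    using B[of 0] norm_ge_zero order_trans by blast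
  moreover have "g 0 = 0"
    using LIMSEQ_unique[OF lim[of 0]] by simp
  ultimately have "g \<in> {g. (\<exists>L. L-lipschitz_on UNIV g) \<and> g 0 = 0}"
    by (auto simp: lipschitz_on_def dist_norm)
  then have g: "lip0_apply (Lip0 g) = g" by (rule Lip0_inverse)
  have "G \<longlonglongrightarrow> Lip0 g"
  proof (rule LIMSEQ_I)
    fix e :: real assume "e > 0"
    then obtain K where K: "\<And>m n. m \<ge> K \<Longrightarrow> n \<ge> K \<Longrightarrow> norm (G m - G n) < e / 2"
      using CauchyD[OF G, of "e / 2"] by auto
    have "norm (G n - Lip0 g) \<le> e / 2" if "n \<ge> K" for n
    proof (rule norm_lip0_le)
      fix x y
      have "(\<lambda>m. cmod (lip0_apply (G n - G m) x - lip0_apply (G n - G m) y))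
        \<longlonglongrightarrow> cmod (lip0_apply (G n - Lip0 g) x - lip0_apply (G n - Lip0 g) y)"
        unfolding lip0_rep_eq g by (intro tendsto_intros lim)
      then show "cmod (lip0_apply (G n - Lip0 g) x - lip0_apply (G n - Lip0 g) y) \<le> e / 2 * dist x y"
      proof (rule LIMSEQ_le_const2)
        have "cmod (lip0_apply (G n - G m) x - lip0_apply (G n - G m) y) \<le> e / 2 * dist x y"
          if "m \<ge> K" for m
          using norm_lip0_bound[of "G n - G m" x y] K[OF \<open>n \<ge> K\<close> that]
          by (meson less_imp_le mult_right_mono order_trans zero_le_dist)
        then show "\<exists>N. \<forall>m\<ge>N. cmod (lip0_apply (G n - G m) x - lip0_apply (G n - G m) y)
            \<le> e / 2 * dist x y" by blast
      qed
    qed (use \<open>e > 0\<close> in simp)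
    then have "norm (G n - Lip0 g) < e" if "n \<ge> K" for n
      using that \<open>e > 0\<close> by fastforce
    then show "\<exists>N. \<forall>n\<ge>N. norm (G n - Lip0 g) < e" by blast
  qed
  then show "convergent G" by (auto simp: convergent_def)
qed

text \<open>\<^const>\<open>Lip0\<close> is unspecified outside the set defining \<open>lip0\<close>, so this is the weighted
  composition operator only under \<open>weighted_composition_well_defined\<close> below.\<close>

definition weighted_composition ::
    "('m \<Rightarrow> complex) \<Rightarrow> ('m \<Rightarrow> 'n) \<Rightarrow> 'n::{metric_space, zero} lip0 \<Rightarrow> 'm::{metric_space, zero} lip0"
  where "weighted_composition w f g = Lip0 (\<lambda>x. w x * lip0_apply g (f x))"

definition weighted_composition_well_defined ::
    "('m::{metric_space, zero} \<Rightarrow> complex) \<Rightarrow> ('m \<Rightarrow> 'n::{metric_space, zero}) \<Rightarrow> bool"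
  where "weighted_composition_well_defined w f \<longleftrightarrow>
    (\<forall>g :: 'n lip0. (\<exists>L. L-lipschitz_on UNIV (\<lambda>x. w x * lip0_apply g (f x))) \<and>
       w 0 * lip0_apply g (f 0) = 0)"

lemma lip0_apply_weighted_composition:
  "weighted_composition_well_defined w f \<Longrightarrow>
    lip0_apply (weighted_composition w f g) x = w x * lip0_apply g (f x)"
  by (simp add: weighted_composition_def weighted_composition_well_defined_def Lip0_inverse)


section \<open>Quotient spaces\<close>

definition quotient_map :: "'a::complex_normed_vector set \<Rightarrow> 'a \<Rightarrow> 'a set"
  where "quotient_map Z y = (\<lambda>z. y + z) ` Z"

definition quotient_space :: "'a::complex_normed_vector set \<Rightarrow> 'a set set"
  where "quotient_space Z = range (quotient_map Z)"

definition quotient_norm :: "'a::complex_normed_vector set \<Rightarrow> real"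
  where "quotient_norm C = (INF y\<in>C. norm y)"

text \<open>For \<open>r = 1\<close> the closed unit ball of the quotient, otherwise its multiple by \<open>r\<close>;
  the scalar multiple of the coset of \<open>y\<close> is the coset of the scalar multiple of \<open>y\<close>.\<close>

definition scaled_quotient_ball :: "real \<Rightarrow> 'a::complex_normed_vector set \<Rightarrow> 'a set set"
  where "scaled_quotient_ball r Z =
    {quotient_map Z (r *\<^sub>R y) | y. quotient_norm (quotient_map Z y) \<le> 1}"

text \<open>The cosets of the elements of \<open>B\<close> are pairwise distinct and form a basis of the quotient
  by \<open>Z\<close>. A linear combination of cosets is the coset of the linear combination of
  representatives, and the zero vector of the quotient is the coset of \<open>0\<close>.\<close>

definition finite_quotient_basis :: "'a::complex_normed_vector set \<Rightarrow> 'a set \<Rightarrow> bool"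
  where "finite_quotient_basis Z B \<longleftrightarrow> finite B \<and> inj_on (quotient_map Z) B \<and>
    (\<forall>u :: 'a \<Rightarrow> complex. quotient_map Z (\<Sum>v\<in>B. u v *\<^sub>C v) = quotient_map Z 0 \<longrightarrow>
       (\<forall>v\<in>B. u v = 0)) \<and>
    (\<forall>C\<in>quotient_space Z. \<exists>u :: 'a \<Rightarrow> complex. C = quotient_map Z (\<Sum>v\<in>B. u v *\<^sub>C v))"

definition quotient_has_dim :: "'a::complex_normed_vector set \<Rightarrow> nat \<Rightarrow> bool"
  where "quotient_has_dim Z n \<longleftrightarrow> (\<exists>B. finite_quotient_basis Z B \<and> card B = n)"

definition quotient_infinite_dim :: "'a::complex_normed_vector set \<Rightarrow> bool"
  where "quotient_infinite_dim Z \<longleftrightarrow> (\<forall>n. \<not> quotient_has_dim Z n)"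


section \<open>Operator properties\<close>

definition finite_cdim :: "'a::complex_normed_vector set \<Rightarrow> bool"
  where "finite_cdim E \<longleftrightarrow> (\<exists>B. finite B \<and> B \<subseteq> E \<and> cspan B = E)"

text \<open>The second disjunct alone is not enough: \<^const>\<open>cdim\<close> is \<open>0\<close> on infinite-dimensional
  subspaces.\<close>

definition cdim_at_least :: "'a::complex_normed_vector set \<Rightarrow> nat \<Rightarrow> bool"
  where "cdim_at_least E n \<longleftrightarrow> \<not> finite_cdim E \<or> n \<le> cdim E"

text \<open>\<open>T\<close> restricts to a linear homeomorphism of \<open>E\<close> onto \<open>F\<close>.\<close>

definition isomorphism_on ::
    "'a::complex_normed_vector set \<Rightarrow> 'b::complex_normed_vector set \<Rightarrow> ('a \<Rightarrow> 'b) \<Rightarrow> bool"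
  where "isomorphism_on E F T \<longleftrightarrow>
    (\<forall>x\<in>E. \<forall>y\<in>E. T (x + y) = T x + T y) \<and> (\<forall>c. \<forall>x\<in>E. T (c *\<^sub>C x) = c *\<^sub>C T x) \<and>
    (\<exists>S. homeomorphism E F T S)"

definition isomorphic_to_linf :: "'a::complex_normed_vector set \<Rightarrow> bool"
  where "isomorphic_to_linf E \<longleftrightarrow> (\<exists>J :: 'a \<Rightarrow> linf. isomorphism_on E UNIV J)"

definition complemented :: "'a::complex_normed_vector set \<Rightarrow> bool"
  where "complemented E \<longleftrightarrow> (\<exists>P. bounded_clinear P \<and> P \<circ> P = P \<and> range P = E)"

definition weak_topology :: "'a::complex_normed_vector topology"
  where "weak_topology =
    topology_generated_by {\<phi> -` U | (\<phi> :: 'a \<Rightarrow> complex) U. bounded_clinear \<phi> \<and> open U}"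

context
  fixes T :: "'a::complex_normed_vector \<Rightarrow> 'b::complex_normed_vector"
begin

definition compact_operator :: bool
  where "compact_operator \<longleftrightarrow> compact (closure (T ` cball 0 1))"

definition weakly_compact_operator :: bool
  where "weakly_compact_operator \<longleftrightarrow>
    compactin weak_topology (weak_topology closure_of (T ` cball 0 1))"

definition strictly_singular :: bool
  where "strictly_singular \<longleftrightarrow>
    \<not> (\<exists>E. csubspace E \<and> closed E \<and> \<not> finite_cdim E \<and> isomorphism_on E (T ` E) T)"

definition strictly_cosingular :: bool
  where "strictly_cosingular \<longleftrightarrow>
    (\<forall>Z. csubspace Z \<and> closed Z \<and> quotient_infinite_dim Z \<longrightarrow>
      range (quotient_map Z \<circ> T) \<noteq> quotient_space Z)"

definition super_strictly_singular :: bool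
  where "super_strictly_singular \<longleftrightarrow>
    (\<forall>\<epsilon>>0. \<exists>N\<ge>1. \<forall>E. csubspace E \<and> cdim_at_least E N \<longrightarrow>
      (\<exists>x\<in>E. norm x = 1 \<and> norm (T x) \<le> \<epsilon>))"

text \<open>The suprema are taken in \<^typ>\<open>ennreal\<close>, so that \<open>cosingular_modulus\<close> is \<open>\<infinity>\<close> for the zero
  quotient and \<open>cosingular_number n\<close> is \<open>0\<close> if no quotient has dimension \<open>n\<close>.\<close>

definition cosingular_modulus :: "'b set \<Rightarrow> ennreal"
  where "cosingular_modulus E =
    Sup {ennreal \<alpha> | \<alpha>. \<alpha> \<ge> 0 \<and> scaled_quotient_ball \<alpha> E \<subseteq> (quotient_map E \<circ> T) ` cball 0 1}"

definition cosingular_number :: "nat \<Rightarrow> ennreal"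
  where "cosingular_number n =
    Sup {cosingular_modulus E | E. csubspace E \<and> closed E \<and> quotient_has_dim E n}"

definition super_strictly_cosingular :: bool
  where "super_strictly_cosingular \<longleftrightarrow> cosingular_number \<longlonglongrightarrow> 0"

definition fixes_copy_of_linf :: bool
  where "fixes_copy_of_linf \<longleftrightarrow>
    (\<exists>E F. csubspace E \<and> closed E \<and> csubspace F \<and> closed F \<and>
      isomorphic_to_linf E \<and> isomorphic_to_linf F \<and> isomorphism_on E F T)"

definition fixes_complemented_copy_of_linf :: bool
  where "fixes_complemented_copy_of_linf \<longleftrightarrow>
    (\<exists>E F. csubspace E \<and> closed E \<and> csubspace F \<and> closed F \<and>
      isomorphic_to_linf E \<and> isomorphic_to_linf F \<and> isomorphism_on E F T \<and>
      complemented E \<and> complemented F)"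

end

end

theory Submission
  imports Defs "HOL-Library.Ramsey"
begin

text \<open>An operator \<open>T\<close> fixes a complemented copy of \<open>\<ell>\<^sup>\<infinity>\<close> iff the identity of \<open>\<ell>\<^sup>\<infinity>\<close> factors as
  \<open>L T S\<close>, and such a factorisation contradicts each of the other seven properties. A compact
  operator has them all by Riesz's lemma: an infinite-dimensional subspace or quotient yields
  arbitrarily long separated sequences in a compact set.

  For the converse let \<open>T\<close> be the weighted composition operator. The difference quotients of \<open>T g\<close>
  are the values at \<open>g\<close> of bounded functionals \<open>a \<delta>\<^sub>p - b \<delta>\<^sub>q\<close>. If \<open>T\<close> is not compact, infinitely many
  of them are uniformly separated. Each is a sum of two atoms \<open>\<beta> (\<delta>\<^sub>u - \<delta>\<^sub>v)\<close>, namely \<open>a \<delta>\<^sub>p\<close> and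
  \<open>- b \<delta>\<^sub>q\<close> if \<open>p\<close> and \<open>q\<close> are far apart compared with the distance of \<open>p\<close> to the base point, and
  \<open>(a - b) \<delta>\<^sub>p\<close> and \<open>b (\<delta>\<^sub>p - \<delta>\<^sub>q)\<close> otherwise. By Ramsey's theorem a sequence of atoms either clusters
  along a subsequence, or has end points with pairwise disjoint balls of radius comparable to
  \<open>d(u, v)\<close>. Both sequences of atoms cannot cluster, and disjoint balls carry Lipschitz bumps that are
  biorthogonal to a subsequence of the functionals, which gives \<open>S\<close>; evaluating the difference
  quotients along this subsequence gives \<open>L\<close>.\<close>

text \<open>The obstacle is that \<open>a\<close> and \<open>b\<close> are not bounded separately: a
  bounded functional \<open>a \<delta>\<^sub>p - b \<delta>\<^sub>q\<close> with \<open>p\<close>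
  close to \<open>q\<close> may have huge coefficients that nearly cancel. Since
  \<open>\<delta>\<^sub>p\<close> has norm d(p, 0), far points control \<open>a d(p, 0)\<close> and
  \<open>b d(q, 0)\<close>, whereas close points control only \<open>(a - b) d(p, 0)\<close> and
  \<open>b d(p, q)\<close>. The two splittings are those whose atoms stay bounded; the pairs are
  ordered so that \<open>q\<close> is no farther from the base point than \<open>p\<close>.
  Clustering means being within \<epsilon>/2 of each other in the dual norm; two clustering
  sequences would put two functionals within \<epsilon>, against their separation.

  Quotients are handled upstairs, by independence and separation modulo a subspace. For weak
  compactness the contradiction comes from a functional on \<open>\<ell>\<^sup>\<infinity>\<close>
  that vanishes on finitely supported sequences and is 1 on the constant sequence 1.\<close>

lemma bounded_clinear_imp_bounded_linear: "bounded_clinear T \<Longrightarrow> bounded_linear T"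
  by (simp add: bounded_clinear_def)

lemma bounded_clinear_scaleC: "bounded_clinear T \<Longrightarrow> T (c *\<^sub>C x) = c *\<^sub>C T x"
  by (simp add: bounded_clinear_def)

lemma bounded_clinear_compose:
  "bounded_clinear T \<Longrightarrow> bounded_clinear S \<Longrightarrow> bounded_clinear (\<lambda>x. T (S x))"
  by (auto simp: bounded_clinear_def intro: bounded_linear_compose)

lemma bounded_clinear_continuous_on: "bounded_clinear T \<Longrightarrow> continuous_on A T"
  by (simp add: bounded_clinear_def linear_continuous_on)

lemma bounded_clinear_csum:
  assumes "bounded_clinear T" shows "T (\<Sum>v\<in>B. u v *\<^sub>C v) = (\<Sum>v\<in>B. u v *\<^sub>C T v)"
proof -
  interpret bounded_linear T using assms by (simp add: bounded_clinear_def)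
  show ?thesis using assms by (simp add: sum bounded_clinear_scaleC)
qed

lemma csubspace_scaleR: "csubspace F \<Longrightarrow> x \<in> F \<Longrightarrow> r *\<^sub>R x \<in> F"
  by (metis complex_vector.subspace_scale scaleC_of_real)

lemma csubspace_kernel:
  assumes "bounded_clinear T" shows "csubspace {x. T x = 0}"
proof -
  interpret bounded_linear T using assms by (simp add: bounded_clinear_def)
  show ?thesis
    using assms by (auto intro!: complex_vector.subspaceI simp: add zero bounded_clinear_scaleC)
qed

lemma csubspace_range:
  assumes "bounded_clinear T" shows "csubspace (range T)"
proof (rule complex_vector.subspaceI)
  interpret bounded_linear T using assms by (simp add: bounded_clinear_def)
  show "0 \<in> range T" using zero by (metis rangeI)
  show "x + y \<in> range T" if "x \<in> range T" "y \<in> range T" for x y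
    using that by (auto simp: add[symmetric])
  show "c *\<^sub>C x \<in> range T" if "x \<in> range T" for c x
    using that by (auto simp: bounded_clinear_scaleC[OF assms, symmetric])
qed

lemma cspan_csubspace_Un_cases:
  assumes "csubspace F" "x \<in> cspan (F \<union> B)"
  obtains z w where "z \<in> F" "w \<in> cspan B" "x = z + w"
proof -
  have "cspan F = F" using assms(1) by (rule complex_vector.span_eq_iff[THEN iffD2])
  with assms(2) show thesis unfolding complex_vector.span_Un by (auto intro: that)
qed

section \<open>Riesz sequences modulo a closed subspace\<close>

text \<open>After division by \<open>c\<close> this is the distance of \<open>v\<close> from the
  point \<open>-z/c\<close> of \<open>F\<close>. It controls the coefficient of \<open>v\<close> by
  the norm of the sum.\<close>

lemma norm_add_scaleC_ge_infdist:
  assumes F: "csubspace F" and z: "z \<in> F"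
  shows "cmod c * infdist v F \<le> norm (z + c *\<^sub>C v)"
proof (cases "c = 0")
  case False
  have "infdist v F \<le> dist v (- (inverse c *\<^sub>C z))"
    by (intro infdist_le complex_vector.subspace_neg[OF F] complex_vector.subspace_scale[OF F] z)
  then have "cmod c * infdist v F \<le> norm (c *\<^sub>C (v + inverse c *\<^sub>C z))"
    by (simp add: dist_norm norm_scaleC mult_left_mono)
  also have "c *\<^sub>C (v + inverse c *\<^sub>C z) = z + c *\<^sub>C v"
    using False by (simp add: scaleC_add_right scaleC_scaleC scaleC_one add.commute)
  finally show ?thesis .
qed simp

text \<open>Along a convergent sequence the coefficients of \<open>v\<close> are Cauchy, because
  \<open>v\<close> has positive distance from \<open>F\<close>; for \<open>v\<close> in
  \<open>F\<close> the set is \<open>F\<close> itself. The set-builder form is the one in which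
  \<open>span_insert\<close> describes a span.\<close>

lemma closed_csubspace_plus_line:
  fixes F :: "'a::complex_normed_vector set"
  assumes F: "csubspace F" "closed F"
  shows "closed {x. \<exists>c. x - c *\<^sub>C v \<in> F}"
proof (cases "v \<in> F")
  case True
  have "x - c *\<^sub>C v \<in> F \<longleftrightarrow> x \<in> F" for x c
    using complex_vector.subspace_scale[OF F(1) True, of c] complex_vector.subspace_add[OF F(1)]
      complex_vector.subspace_diff[OF F(1)] by (metis diff_add_cancel)
  then show ?thesis using F by simp
next
  case False
  define d where "d = infdist v F"
  have "F \<noteq> {}" using complex_vector.subspace_0[OF F(1)] by auto
  then have d: "d > 0"
    using False F by (simp add: d_def infdist_pos_not_in_closed)
  show ?thesis unfolding closed_sequential_limits
  proof (intro allI impI, elim conjE)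
    fix y l assume "\<forall>n. y n \<in> {x. \<exists>c. x - c *\<^sub>C v \<in> F}" and lim: "y \<longlonglongrightarrow> l"
    then have "\<forall>n. \<exists>c. y n - c *\<^sub>C v \<in> F" by auto
    then obtain c where c: "\<And>n. y n - c n *\<^sub>C v \<in> F" by metis
    have ineq: "cmod (c m - c n) * d \<le> norm (y m - y n)" for m n
    proof -
      have "(y m - c m *\<^sub>C v) - (y n - c n *\<^sub>C v) \<in> F"
        using c complex_vector.subspace_diff[OF F(1)] by blast
      from norm_add_scaleC_ge_infdist[OF F(1) this, of "c m - c n" v]
      show ?thesis by (simp add: d_def complex_vector.scale_left_diff_distrib)
    qed
    have "Cauchy c"
    proof (rule CauchyI)
      fix e :: real assume "e > 0"
      then obtain M where M: "\<And>m n. m \<ge> M \<Longrightarrow> n \<ge> M \<Longrightarrow> norm (y m - y n) < e * d"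
        using CauchyD[OF LIMSEQ_imp_Cauchy[OF lim], of "e * d"] d by auto
      then have "cmod (c m - c n) < e" if "m \<ge> M" "n \<ge> M" for m n
        using ineq[of m n] M[OF that] d by (meson le_less_trans mult_less_cancel_right_pos)
      then show "\<exists>M. \<forall>m\<ge>M. \<forall>n\<ge>M. norm (c m - c n) < e" by blast
    qed
    then obtain c0 where c0: "c \<longlonglongrightarrow> c0" using Cauchy_convergent_iff convergent_def by blast
    have "(\<lambda>n. c n *\<^sub>C v) \<longlonglongrightarrow> c0 *\<^sub>C v"
    proof (rule tendsto_norm_zero_cancel[THEN LIM_zero_cancel])
      have "(\<lambda>n. cmod (c n - c0) * norm v) \<longlonglongrightarrow> 0"
        using tendsto_mult_left_zero[OF tendsto_norm_zero[OF LIM_zero[OF c0]]] by blast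
      then show "(\<lambda>n. norm (c n *\<^sub>C v - c0 *\<^sub>C v)) \<longlonglongrightarrow> 0"
        by (simp add: complex_vector.scale_left_diff_distrib[symmetric] norm_scaleC)
    qed
    then have "(\<lambda>n. y n - c n *\<^sub>C v) \<longlonglongrightarrow> l - c0 *\<^sub>C v"
      using lim by (intro tendsto_diff)
    then have "l - c0 *\<^sub>C v \<in> F"
      by (rule closed_sequentially[OF F(2) c])
    then show "l \<in> {x. \<exists>c. x - c *\<^sub>C v \<in> F}" by blast
  qed
qed

lemma closed_cspan_Un_finite:
  assumes F: "csubspace F" "closed F" and "finite B"
  shows "closed (cspan (F \<union> B))"
  using \<open>finite B\<close>
proof induction
  case empty
  then show ?case using F complex_vector.span_eq_iff[THEN iffD2, of F] by (metis sup_bot_right)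
next
  case (insert b B)
  then show ?case
    using closed_csubspace_plus_line[of "cspan (F \<union> B)" b]
    by (simp add: complex_vector.span_insert complex_vector.subspace_span)
qed

text \<open>An almost nearest point \<open>y\<close> of \<open>F\<close> is subtracted from
  \<open>w\<close> and the difference normalised. The constant 1/2 comes from taking
  \<open>y\<close> within twice the distance of \<open>w\<close> from \<open>F\<close>.\<close>

lemma riesz_lemma:
  fixes F :: "'a::complex_normed_vector set"
  assumes F: "csubspace F" "closed F" and w: "w \<notin> F"
  obtains v where "v \<in> cspan (insert w F)" "norm v = 1" "\<And>z. z \<in> F \<Longrightarrow> 1 / 2 \<le> norm (v - z)"
proof -
  define d where "d = infdist w F"
  have ne: "F \<noteq> {}" using complex_vector.subspace_0[OF F(1)] by auto
  then have d: "d > 0"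
    using w F by (simp add: d_def infdist_pos_not_in_closed)
  obtain y where y: "y \<in> F" "dist w y < 2 * d"
    using d cInf_lessD[of "dist w ` F" "2 * d"] ne unfolding d_def infdist_def by auto
  define r where "r = norm (w - y)"
  have r: "r > 0" "r < 2 * d" using y w by (auto simp: r_def dist_norm)
  define v where "v = (1 / r) *\<^sub>R (w - y)"
  show thesis
  proof
    have "w \<in> cspan (insert w F)" "y \<in> cspan (insert w F)"
      using y by (auto intro: complex_vector.span_base)
    then show "v \<in> cspan (insert w F)" unfolding v_def
      by (intro csubspace_scaleR complex_vector.subspace_span complex_vector.span_diff)
    show "norm v = 1" using r by (simp add: v_def r_def)
    fix z assume z: "z \<in> F"
    have "d \<le> dist w (y + r *\<^sub>R z)" unfolding d_def
      by (intro infdist_le complex_vector.subspace_add[OF F(1)] csubspace_scaleR[OF F(1)] y z)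
    also have "\<dots> = norm (r *\<^sub>R (v - z))"
      using r by (simp add: v_def dist_norm scaleR_diff_right algebra_simps)
    finally have "d \<le> r * norm (v - z)" using r by simp
    then have "1 * r < (2 * norm (v - z)) * r" using r(2) by (simp add: mult.commute)
    then show "1 / 2 \<le> norm (v - z)" using r(1) by (simp add: mult_less_cancel_right)
  qed
qed

text \<open>Linear independence of cosets modulo \<open>F\<close>, in the incremental form that
  Riesz's lemma consumes. With \<open>F = {0}\<close> it serves subspaces, and with \<open>F\<close>
  the subspace divided out it serves quotients.\<close>

definition indep_mod :: "'a::complex_normed_vector set \<Rightarrow> (nat \<Rightarrow> 'a) \<Rightarrow> nat \<Rightarrow> bool"
  where "indep_mod F b n \<longleftrightarrow> (\<forall>k<n. b k \<notin> cspan (F \<union> b ` {..<k}))"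

text \<open>Riesz's lemma is applied along the increasing spans of \<open>F\<close> and the first
  vectors. Separation is claimed modulo \<open>F\<close>, so that it survives changing each
  \<open>v i\<close> by an element of \<open>F\<close>.\<close>

lemma riesz_sequence:
  assumes F: "csubspace F" "closed F" and b: "indep_mod F b n"
  obtains v where "\<And>i. i < n \<Longrightarrow> v i \<in> cspan (F \<union> b ` {..<n})" "\<And>i. i < n \<Longrightarrow> norm (v i) = 1"
    "\<And>i j z. i < n \<Longrightarrow> j < n \<Longrightarrow> i \<noteq> j \<Longrightarrow> z \<in> F \<Longrightarrow> 1 / 2 \<le> norm (v i - v j - z)"
proof -
  let ?F = "\<lambda>k. cspan (F \<union> b ` {..<k})"
  have mono: "?F i \<subseteq> ?F j" if "i \<le> j" for i j
    using that by (intro complex_vector.span_mono) auto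
  have "\<exists>v. v \<in> ?F (Suc k) \<and> norm v = 1 \<and> (\<forall>z\<in>?F k. 1 / 2 \<le> norm (v - z))" if "k < n" for k
  proof -
    have "b k \<notin> ?F k" using b that by (simp add: indep_mod_def)
    then obtain v where v: "v \<in> cspan (insert (b k) (?F k))" "norm v = 1"
      "\<And>z. z \<in> ?F k \<Longrightarrow> 1 / 2 \<le> norm (v - z)"
      using riesz_lemma[OF complex_vector.subspace_span closed_cspan_Un_finite[OF F]]
      by (metis finite_imageI finite_lessThan)
    have "cspan (insert (b k) (?F k)) \<subseteq> ?F (Suc k)"
      using mono[of k "Suc k"]
      by (intro complex_vector.span_minimal complex_vector.subspace_span)
        (auto intro: complex_vector.span_base)
    with v show ?thesis by blast
  qed
  then obtain v where v: "\<And>k. k < n \<Longrightarrow> v k \<in> ?F (Suc k)" "\<And>k. k < n \<Longrightarrow> norm (v k) = 1"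
    "\<And>k z. k < n \<Longrightarrow> z \<in> ?F k \<Longrightarrow> 1 / 2 \<le> norm (v k - z)" by metis
  have lt: "1 / 2 \<le> norm (v i - v j - z)" if "i < n" "j < i" "z \<in> F" for i j z
  proof -
    have "v j + z \<in> ?F i"
      using v(1)[of j] mono[of "Suc j" i] that
      by (intro complex_vector.span_add) (auto intro: complex_vector.span_base)
    from v(3)[OF that(1) this] show ?thesis by (simp add: diff_diff_eq)
  qed
  show thesis
  proof (rule that)
    show "v i \<in> ?F n" if "i < n" for i using v(1)[OF that] mono[OF Suc_leI[OF that]] by blast
    show "norm (v i) = 1" if "i < n" for i by (rule v(2)[OF that])
    fix i j z assume ij: "i < n" "j < n" "i \<noteq> j" and z: "z \<in> F"
    show "1 / 2 \<le> norm (v i - v j - z)"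
    proof (cases "j < i")
      case False
      then have "1 / 2 \<le> norm (v j - v i - (- z))"
        using lt ij z complex_vector.subspace_neg[OF F(1)] by (metis linorder_neqE_nat)
      also have "\<dots> = norm (v i - v j - z)"
        by (metis norm_minus_cancel minus_diff_eq diff_minus_eq_add diff_diff_eq2 add.commute)
      finally show ?thesis .
    qed (use lt ij z in blast)
  qed
qed

text \<open>The last coefficient must vanish, since dividing by it would express the last vector by
  \<open>F\<close> and its predecessors; then induction.\<close>

lemma indep_mod_combination_eq_0:
  assumes "csubspace F" "indep_mod F b n" "(\<Sum>k<n. u k *\<^sub>C b k) \<in> F" "k < n"
  shows "u k = 0"
  using assms(2-4)
proof (induction n)
  case (Suc n)
  have s: "(\<Sum>k<n. u k *\<^sub>C b k) \<in> cspan (F \<union> b ` {..<n})"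
    by (intro complex_vector.span_sum complex_vector.span_scale complex_vector.span_base) auto
  have "u n = 0"
  proof (rule ccontr)
    assume u: "u n \<noteq> 0"
    have "u n *\<^sub>C b n = (\<Sum>k<Suc n. u k *\<^sub>C b k) - (\<Sum>k<n. u k *\<^sub>C b k)" by simp
    also have "\<dots> \<in> cspan (F \<union> b ` {..<n})"
      using Suc.prems(2) by (intro complex_vector.span_diff s) (auto intro: complex_vector.span_base)
    finally have "inverse (u n) *\<^sub>C (u n *\<^sub>C b n) \<in> cspan (F \<union> b ` {..<n})"
      by (rule complex_vector.span_scale)
    then have "b n \<in> cspan (F \<union> b ` {..<n})" using u by (simp add: scaleC_scaleC scaleC_one)
    then show False using Suc.prems(1) by (auto simp: indep_mod_def)
  qed
  then show ?case using Suc by (cases "k = n") (auto simp: indep_mod_def less_Suc_eq)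
qed simp

section \<open>Independent families in quotients and in large subspaces\<close>

lemma quotient_map_eq_iff:
  assumes "csubspace Z" shows "quotient_map Z x = quotient_map Z y \<longleftrightarrow> x - y \<in> Z"
proof
  assume "quotient_map Z x = quotient_map Z y"
  then have "x \<in> quotient_map Z y"
    using complex_vector.subspace_0[OF assms] unfolding quotient_map_def by force
  then show "x - y \<in> Z" by (auto simp: quotient_map_def)
next
  assume xy: "x - y \<in> Z"
  have sub: "quotient_map Z a \<subseteq> quotient_map Z b" if "a - b \<in> Z" for a b
  proof
    fix w assume "w \<in> quotient_map Z a"
    then obtain z where z: "z \<in> Z" "w = a + z" by (auto simp: quotient_map_def)
    then have "w = b + (a - b + z)" by simp
    moreover have "a - b + z \<in> Z" using that z complex_vector.subspace_add[OF assms] by blast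
    ultimately show "w \<in> quotient_map Z b" unfolding quotient_map_def by blast
  qed
  have "y - x \<in> Z" using complex_vector.subspace_neg[OF assms xy] by simp
  then show "quotient_map Z x = quotient_map Z y" using sub xy by blast
qed

lemma indep_mod_inj_on:
  assumes "csubspace Z" "indep_mod Z b n" shows "inj_on (\<lambda>k. quotient_map Z (b k)) {..<n}"
proof -
  have ne: "quotient_map Z (b i) \<noteq> quotient_map Z (b j)" if "i < n" "j < i" for i j
  proof
    assume "quotient_map Z (b i) = quotient_map Z (b j)"
    then have "b i - b j \<in> Z" by (simp add: quotient_map_eq_iff[OF assms(1)])
    then have "(b i - b j) + b j \<in> cspan (Z \<union> b ` {..<i})"
      using that by (intro complex_vector.span_add) (auto intro: complex_vector.span_base)
    then show False using assms(2) that by (auto simp: indep_mod_def)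
  qed
  show ?thesis by (rule inj_onI) (metis ne lessThan_iff linorder_neqE_nat)
qed

lemma quotient_has_dimI:
  assumes Z: "csubspace Z" and b: "indep_mod Z b n" and span: "cspan (Z \<union> b ` {..<n}) = UNIV"
  shows "quotient_has_dim Z n"
  unfolding quotient_has_dim_def finite_quotient_basis_def
proof (intro exI[of _ "b ` {..<n}"] conjI allI impI ballI)
  have inj: "inj_on b {..<n}"
    using indep_mod_inj_on[OF Z b] by (auto simp: inj_on_def)
  show "card (b ` {..<n}) = n" using inj by (simp add: card_image)
  show "inj_on (quotient_map Z) (b ` {..<n})"
    using indep_mod_inj_on[OF Z b] by (auto simp: inj_on_def)
  fix u :: "'a \<Rightarrow> complex" and v
  assume "quotient_map Z (\<Sum>v\<in>b ` {..<n}. u v *\<^sub>C v) = quotient_map Z 0" and v: "v \<in> b ` {..<n}"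
  then have "(\<Sum>k<n. u (b k) *\<^sub>C b k) \<in> Z"
    by (simp add: quotient_map_eq_iff[OF Z] sum.reindex[OF inj])
  from indep_mod_combination_eq_0[OF Z b this] v show "u v = 0" by auto
next
  fix C assume "C \<in> quotient_space Z"
  then obtain y where y: "C = quotient_map Z y" by (auto simp: quotient_space_def)
  have "y \<in> cspan (Z \<union> b ` {..<n})" using span by simp
  then obtain z w where zw: "z \<in> Z" "w \<in> cspan (b ` {..<n})" "y = z + w"
    using cspan_csubspace_Un_cases[OF Z] by blast
  then obtain u where "w = (\<Sum>v\<in>b ` {..<n}. u v *\<^sub>C v)"
    by (auto simp: complex_vector.span_finite)
  then have "C = quotient_map Z (\<Sum>v\<in>b ` {..<n}. u v *\<^sub>C v)"
    using zw y by (simp add: quotient_map_eq_iff[OF Z])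
  then show "\<exists>u. C = quotient_map Z (\<Sum>v\<in>b ` {..<n}. u v *\<^sub>C v)" by blast
qed simp

text \<open>Any enumeration of the basis works: if \<open>b k\<close> were an element of
  \<open>Z\<close> plus a combination of its predecessors, the difference would be a relation modulo
  \<open>Z\<close> in which \<open>b k\<close> has coefficient 1.\<close>

lemma finite_quotient_basis_indep_mod:
  assumes Z: "csubspace Z" and B: "finite_quotient_basis Z B"
  obtains b where "indep_mod Z b (card B)"
proof -
  have "finite B" using B by (simp add: finite_quotient_basis_def)
  then obtain b where b: "bij_betw b {..<card B} B"
    using ex_bij_betw_nat_finite[of B] by (auto simp: atLeast0LessThan)
  have "indep_mod Z b (card B)" unfolding indep_mod_def
  proof (intro allI impI notI)
    fix k assume k: "k < card B" and "b k \<in> cspan (Z \<union> b ` {..<k})"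
    then obtain z w where zw: "z \<in> Z" "w \<in> cspan (b ` {..<k})" "b k = z + w"
      using cspan_csubspace_Un_cases[OF Z] by blast
    have inj: "inj_on b {..<k}" and sub: "b ` {..<k} \<subseteq> B - {b k}" and bk: "b k \<in> B"
      using b k by (auto simp: bij_betw_def inj_on_def)
    obtain u where u: "w = (\<Sum>v\<in>b ` {..<k}. u v *\<^sub>C v)"
      using zw(2) by (auto simp: complex_vector.span_finite)
    define u' where "u' v = (if v = b k then 1 else if v \<in> b ` {..<k} then - u v else 0)" for v
    have "(\<Sum>v\<in>B. u' v *\<^sub>C v) = b k + (\<Sum>v\<in>B - {b k}. u' v *\<^sub>C v)"
      using \<open>finite B\<close> bk by (simp add: sum.remove u'_def scaleC_one)
    also have "(\<Sum>v\<in>B - {b k}. u' v *\<^sub>C v) = (\<Sum>v\<in>b ` {..<k}. - u v *\<^sub>C v)"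
      using sub \<open>finite B\<close> by (intro sum.mono_neutral_cong_right) (auto simp: u'_def)
    also have "\<dots> = - w" by (simp add: u sum_negf)
    finally have "quotient_map Z (\<Sum>v\<in>B. u' v *\<^sub>C v) = quotient_map Z 0"
      using zw by (simp add: quotient_map_eq_iff[OF Z])
    then have "u' (b k) = 0" using B bk by (auto simp: finite_quotient_basis_def)
    then show False by (simp add: u'_def)
  qed
  then show thesis by (rule that)
qed

text \<open>Greedy extension: if \<open>n\<close> independent vectors and \<open>Z\<close> spanned
  everything, the vectors would be a basis of the quotient with \<open>n\<close> elements.\<close>

lemma quotient_infinite_dim_indep_mod:
  assumes Z: "csubspace Z" and "quotient_infinite_dim Z"
  shows "\<exists>b. indep_mod Z b n"
proof (induction n)
  case 0
  then show ?case by (simp add: indep_mod_def)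
next
  case (Suc n)
  then obtain b where b: "indep_mod Z b n" by blast
  then have "cspan (Z \<union> b ` {..<n}) \<noteq> UNIV"
    using assms quotient_has_dimI by (auto simp: quotient_infinite_dim_def)
  then obtain y where y: "y \<notin> cspan (Z \<union> b ` {..<n})" by auto
  have "indep_mod Z (b(n := y)) (Suc n)"
    unfolding indep_mod_def
  proof (intro allI impI)
    fix k assume "k < Suc n"
    then show "(b(n := y)) k \<notin> cspan (Z \<union> (b(n := y)) ` {..<k})"
      using b y by (cases "k = n") (auto simp: indep_mod_def less_Suc_eq simp del: fun_upd_image
          cong: image_cong_simp)
  qed
  then show ?case by blast
qed

text \<open>An algebraic basis of \<open>E\<close> is either infinite, with subsets of every size,
  or finite, with the dimension as its size; these cases mirror the disjuncts of
  \<open>cdim_at_least\<close>.\<close>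

lemma cdim_at_least_indep_mod:
  fixes E :: "'a::complex_normed_vector set"
  assumes E: "csubspace E" "cdim_at_least E n"
  obtains b where "indep_mod {0} b n" "b ` {..<n} \<subseteq> E"
proof -
  obtain B where B: "B \<subseteq> E" "\<not> cdependent B" "E \<subseteq> cspan B" "card B = cdim E"
    using complex_vector.basis_exists by blast
  have "\<exists>B'. B' \<subseteq> B \<and> finite B' \<and> card B' = n"
  proof (cases "finite B")
    case True
    have "cspan B = E" using B E(1) by (simp add: complex_vector.span_minimal subset_antisym)
    then have "n \<le> card B" using True B E(2) by (auto simp: cdim_at_least_def finite_cdim_def)
    then show ?thesis using True by (meson obtain_subset_with_card_n)
  qed (meson infinite_arbitrarily_large)
  then obtain B' where B': "B' \<subseteq> B" "finite B'" "card B' = n" by blast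
  then obtain b where b: "bij_betw b {..<n} B'"
    using ex_bij_betw_nat_finite[of B'] by (auto simp: atLeast0LessThan)
  have "indep_mod {0} b n" unfolding indep_mod_def
  proof (intro allI impI notI)
    fix k assume k: "k < n" and "b k \<in> cspan ({0} \<union> b ` {..<k})"
    moreover have "b ` {..<k} \<subseteq> B - {b k}" "b k \<in> B"
      using b k B' by (auto simp: bij_betw_def inj_on_def)
    ultimately have "b k \<in> cspan (B - {b k})"
      using complex_vector.span_mono[of "b ` {..<k}" "B - {b k}"] by (simp add: subset_iff)
    then show False using B(2) \<open>b k \<in> B\<close> unfolding complex_vector.dependent_def by blast
  qed
  moreover have "b ` {..<n} \<subseteq> E" using b B' B by (auto simp: bij_betw_def)
  ultimately show thesis by (rule that)
qed


section \<open>Bounded sequences\<close>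

lemma apply_Bcontfun_nat:
  fixes f :: "nat \<Rightarrow> complex"
  assumes "\<And>n. cmod (f n) \<le> b"
  shows "apply_bcontfun (Bcontfun f) = f"
  by (intro Bcontfun_inverse bcontfun_normI[where b = b] assms) simp

lemma bounded_clinear_apply_bcontfun: "bounded_clinear (\<lambda>x :: linf. apply_bcontfun x k)"
  unfolding bounded_clinear_def
  by (auto intro!: bounded_linear_intro[where K = 1] norm_bounded simp: scaleC_bcontfun_rep_eq
      scaleC_complex_def)

definition linf_unit :: "nat \<Rightarrow> linf"
  where "linf_unit k = Bcontfun (\<lambda>i. if i = k then 1 else 0)"

lemma apply_linf_unit: "apply_bcontfun (linf_unit k) i = (if i = k then 1 else 0)"
  unfolding linf_unit_def by (subst apply_Bcontfun_nat[where b = 1]) auto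

text \<open>The unit sequences are independent, because coordinate \<open>k\<close> vanishes on the
  span of the others, and an independent set inside a finite span is finite.\<close>

lemma linf_not_finite_span:
  assumes "finite (B :: linf set)" shows "cspan B \<noteq> UNIV"
proof
  assume span: "cspan B = UNIV"
  have "\<not> cdependent (range linf_unit)"
    unfolding complex_vector.dependent_def
  proof clarify
    fix k assume "linf_unit k \<in> cspan (range linf_unit - {linf_unit k})"
    moreover have "cspan (range linf_unit - {linf_unit k}) \<subseteq> {x. apply_bcontfun x k = 0}"
      using csubspace_kernel[OF bounded_clinear_apply_bcontfun[of k]]
      by (intro complex_vector.span_minimal) (auto simp: apply_linf_unit)
    ultimately show False by (auto simp: apply_linf_unit)
  qed
  then have "finite (range linf_unit)"
    using complex_vector.independent_span_bound[OF assms] span by auto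
  moreover have "inj linf_unit"
    by (rule injI) (metis apply_linf_unit zero_neq_one)
  ultimately show False using finite_imageD infinite_UNIV_nat by blast
qed

section \<open>Isomorphisms between subspaces\<close>

lemma isomorphism_on_sym:
  assumes E: "csubspace E" and T: "isomorphism_on E F T" and S: "homeomorphism E F T S"
  shows "isomorphism_on F E S"
  unfolding isomorphism_on_def
proof (intro conjI ballI allI)
  have TE: "\<And>x. x \<in> E \<Longrightarrow> S (T x) = x" and FT: "F = T ` E"
    using S by (auto simp: homeomorphism_def)
  show "S (x + y) = S x + S y" if xy: "x \<in> F" "y \<in> F" for x y
  proof -
    obtain a b where ab: "a \<in> E" "b \<in> E" "x = T a" "y = T b" using xy FT by auto
    moreover have "T (a + b) = T a + T b" using T ab by (simp add: isomorphism_on_def)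
    ultimately show ?thesis using TE complex_vector.subspace_add[OF E] by metis
  qed
  show "S (c *\<^sub>C x) = c *\<^sub>C S x" if x: "x \<in> F" for c x
  proof -
    obtain a where a: "a \<in> E" "x = T a" using x FT by auto
    moreover have "T (c *\<^sub>C a) = c *\<^sub>C T a" using T a by (simp add: isomorphism_on_def)
    ultimately show ?thesis using TE complex_vector.subspace_scale[OF E] by metis
  qed
  show "\<exists>T. homeomorphism F E S T" using S homeomorphism_symD by blast
qed

text \<open>Continuity of the inverse at 0 gives a radius below which inverse images have norm less
  than 1; homogeneity turns this into a lower bound.\<close>

lemma isomorphism_on_bounded_below:
  assumes E: "csubspace E" and T: "isomorphism_on E F T"
  obtains c where "c > 0" "\<And>x. x \<in> E \<Longrightarrow> c * norm x \<le> norm (T x)"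
proof -
  obtain S where S: "homeomorphism E F T S" using T by (auto simp: isomorphism_on_def)
  have scale: "T (c *\<^sub>C x) = c *\<^sub>C T x" if "x \<in> E" for c x
    using T that by (auto simp: isomorphism_on_def)
  have E0: "0 \<in> E" by (rule complex_vector.subspace_0[OF E])
  have T0: "T 0 = 0" using scale[OF E0, of 0] by simp
  have ST: "S (T x) = x" if "x \<in> E" for x using S that by (auto simp: homeomorphism_def)
  have TE: "T x \<in> F" if "x \<in> E" for x using S that by (auto simp: homeomorphism_def)
  have "continuous_on F S" using S by (simp add: homeomorphism_def)
  then obtain d where d: "d > 0" "\<And>y. y \<in> F \<Longrightarrow> dist y 0 < d \<Longrightarrow> dist (S y) (S 0) < 1"
    using TE[OF E0] unfolding T0 continuous_on_iff by (metis zero_less_one)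
  have S0: "S 0 = 0" using ST[OF E0] T0 by simp
  show thesis
  proof
    show "d / 2 > 0" using d by simp
    fix x assume x: "x \<in> E"
    show "d / 2 * norm x \<le> norm (T x)"
    proof (cases "T x = 0")
      case True
      then have "x = 0" using ST[OF x] S0 by simp
      then show ?thesis by simp
    next
      case False
      \<comment> \<open>Makes the image of the scaled vector have norm \<open>d / 2\<close>, inside
        the ball of radius \<open>d\<close>.\<close>
      define r where "r = d / (2 * norm (T x))"
      have r: "r > 0" using False d by (simp add: r_def)
      have rx: "r *\<^sub>R x \<in> E" by (rule csubspace_scaleR[OF E x])
      have "T (r *\<^sub>R x) = r *\<^sub>R T x" using scale[OF x, of "of_real r"] by (simp add: scaleC_of_real)
      then have "norm (T (r *\<^sub>R x)) = d / 2" using d False by (simp add: r_def)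
      then have "dist (S (T (r *\<^sub>R x))) (S 0) < 1" using d TE[OF rx] by (intro d(2)) auto
      then have "r * norm x < 1" using ST[OF rx] S0 r by simp
      then show ?thesis using False by (simp add: r_def field_simps)
    qed
  qed
qed

lemma isomorphic_to_linf_not_finite_cdim:
  assumes E: "csubspace E" and "isomorphic_to_linf E" shows "\<not> finite_cdim E"
proof
  obtain J :: "'a \<Rightarrow> linf" where J: "isomorphism_on E UNIV J"
    using assms by (auto simp: isomorphic_to_linf_def)
  assume "finite_cdim E"
  then obtain B where B: "finite B" "B \<subseteq> E" "cspan B = E" by (auto simp: finite_cdim_def)
  have add: "J (x + y) = J x + J y" and scale: "J (c *\<^sub>C x) = c *\<^sub>C J x" if "x \<in> E" "y \<in> E" for x y c
    using J that by (auto simp: isomorphism_on_def)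
  have E0: "0 \<in> E" by (rule complex_vector.subspace_0[OF E])
  have J0: "J 0 = 0" using scale[OF E0 E0, of 0] by simp
  \<comment> \<open>Membership in \<open>E\<close> is carried through the induction because
    \<open>J\<close> is linear on \<open>E\<close> only.\<close>
  have "x \<in> E \<and> J x \<in> cspan (J ` B)" if "x \<in> cspan B" for x
    using that
  proof (induction rule: complex_vector.span_induct_alt)
    case base
    then show ?case by (simp add: J0 E0 complex_vector.span_zero)
  next
    case (step c x y)
    then have E': "x \<in> E" "y \<in> E" "c *\<^sub>C x \<in> E"
      using B(2) complex_vector.subspace_scale[OF E] by auto
    moreover have "J (c *\<^sub>C x + y) = c *\<^sub>C J x + J y"
      using E' by (simp add: add scale[OF _ E0])
    ultimately show ?case
      using step by (auto intro!: complex_vector.span_add complex_vector.span_scale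
          complex_vector.subspace_add[OF E] intro: complex_vector.span_base)
  qed
  then have "J ` E \<subseteq> cspan (J ` B)" using B(3) by blast
  moreover have "J ` E = UNIV" using J by (auto simp: isomorphism_on_def homeomorphism_def)
  ultimately have "cspan (J ` B) = UNIV" by auto
  then show False using linf_not_finite_span B(1) by blast
qed

section \<open>Consequences of compactness\<close>

text \<open>Points at mutual distance at least \<open>e\<close> lie near different centres of a net
  of radius \<open>e / 2\<close>, so the size of the net bounds the length of every such
  family.\<close>

lemma compact_separated_bound:
  fixes K :: "'a::metric_space set"
  assumes "compact K" "e > 0"
  obtains m where "\<And>n v. (\<And>i. i < n \<Longrightarrow> v i \<in> K) \<Longrightarrow>
    (\<And>i j. i < n \<Longrightarrow> j < n \<Longrightarrow> i \<noteq> j \<Longrightarrow> e \<le> dist (v i) (v j)) \<Longrightarrow> n \<le> (m :: nat)"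
proof -
  obtain k where k: "finite k" "K \<subseteq> (\<Union>x\<in>k. ball x (e / 2))"
    using assms unfolding compact_eq_totally_bounded by (meson half_gt_zero)
  show thesis
  proof
    fix n and v :: "nat \<Rightarrow> 'a"
    assume v: "\<And>i. i < n \<Longrightarrow> v i \<in> K"
      and sep: "\<And>i j. i < n \<Longrightarrow> j < n \<Longrightarrow> i \<noteq> j \<Longrightarrow> e \<le> dist (v i) (v j)"
    have "\<forall>i<n. \<exists>x\<in>k. dist x (v i) < e / 2" using v k by fastforce
    then obtain c where c: "\<And>i. i < n \<Longrightarrow> c i \<in> k" "\<And>i. i < n \<Longrightarrow> dist (c i) (v i) < e / 2"
      by metis
    have "inj_on c {..<n}"
    proof (rule inj_onI, rule ccontr)
      fix i j assume ij: "i \<in> {..<n}" "j \<in> {..<n}" "c i = c j" "i \<noteq> j"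
      have "dist (v i) (v j) < e"
        using dist_triangle_half_r[OF c(2)[of i], of "v j"] c(2)[of j] ij by simp
      then show False using sep[of i j] ij by auto
    qed
    then show "n \<le> card k"
      using card_inj_on_le[of c "{..<n}" k] c(1) k(1) by auto
  qed
qed

text \<open>A Riesz sequence modulo \<open>Z\<close> is scaled by \<alpha> and each term is replaced
  by its representative in \<open>K\<close>. The change lies in \<open>Z\<close>, which separation
  modulo \<open>Z\<close> ignores. This is the common core of both cosingularity proofs.\<close>

lemma riesz_separated_lifts:
  assumes Z: "csubspace Z" "closed Z" and b: "indep_mod Z b n" and "\<alpha> > 0"
    and lift: "\<And>y. norm y = 1 \<Longrightarrow> \<exists>k\<in>K. k - \<alpha> *\<^sub>R y \<in> Z"
  obtains k where "\<And>i. i < n \<Longrightarrow> k i \<in> K"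
    "\<And>i j. i < n \<Longrightarrow> j < n \<Longrightarrow> i \<noteq> j \<Longrightarrow> \<alpha> / 2 \<le> dist (k i) (k j)"
proof -
  obtain v where v: "\<And>i. i < n \<Longrightarrow> norm (v i) = 1"
    "\<And>i j z. i < n \<Longrightarrow> j < n \<Longrightarrow> i \<noteq> j \<Longrightarrow> z \<in> Z \<Longrightarrow> 1 / 2 \<le> norm (v i - v j - z)"
    using riesz_sequence[OF Z b] by metis
  obtain k where k: "\<And>i. i < n \<Longrightarrow> k i \<in> K" "\<And>i. i < n \<Longrightarrow> k i - \<alpha> *\<^sub>R v i \<in> Z"
  proof -
    have "\<forall>i. \<exists>k. i < n \<longrightarrow> k \<in> K \<and> k - \<alpha> *\<^sub>R v i \<in> Z" using lift v(1) by blast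
    then show thesis using that by metis
  qed
  show thesis
  proof (rule that[of k])
    fix i j assume ij: "i < n" "j < n" "i \<noteq> j"
    \<comment> \<open>Chosen so that \<open>\<alpha> *\<^sub>R (v i - v j - z)\<close> is exactly
      \<open>k i - k j\<close>.\<close>
    define z where "z = (1 / \<alpha>) *\<^sub>R ((k j - \<alpha> *\<^sub>R v j) - (k i - \<alpha> *\<^sub>R v i))"
    have "z \<in> Z" unfolding z_def
      by (intro csubspace_scaleR Z complex_vector.subspace_diff k ij)
    then have "\<alpha> * (1 / 2) \<le> \<alpha> * norm (v i - v j - z)"
      using v(2)[OF ij] \<open>\<alpha> > 0\<close> by (intro mult_left_mono) auto
    also have "\<dots> = norm (\<alpha> *\<^sub>R (v i - v j - z))" using \<open>\<alpha> > 0\<close> by simp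
    also have "\<alpha> *\<^sub>R (v i - v j - z) = k i - k j"
      using \<open>\<alpha> > 0\<close> by (simp add: z_def algebra_simps)
    finally show "\<alpha> / 2 \<le> dist (k i) (k j)" by (simp add: dist_norm)
  qed (use k in blast)
qed

text \<open>If every unit vector of \<open>E\<close> has an image of norm more than \<epsilon>, the
  images of a Riesz sequence in \<open>E\<close> are \<epsilon>/2-separated points of a compact set,
  so its length is at most \<open>m\<close>.\<close>

lemma compact_imp_super_strictly_singular:
  fixes T :: "'a::complex_normed_vector \<Rightarrow> 'b::complex_normed_vector"
  assumes T: "bounded_clinear T" and "compact_operator T"
  shows "super_strictly_singular T"
  unfolding super_strictly_singular_def
proof (intro allI impI)
  interpret bounded_linear T by (rule bounded_clinear_imp_bounded_linear[OF T])
  fix \<epsilon> :: real assume "\<epsilon> > 0"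
  obtain m where m: "\<And>n v. (\<And>i. i < n \<Longrightarrow> v i \<in> closure (T ` cball 0 1)) \<Longrightarrow>
    (\<And>i j. i < n \<Longrightarrow> j < n \<Longrightarrow> i \<noteq> j \<Longrightarrow> \<epsilon> / 2 \<le> dist (v i) (v j)) \<Longrightarrow> n \<le> (m :: nat)"
    using compact_separated_bound[of _ "\<epsilon> / 2"] assms(2) \<open>\<epsilon> > 0\<close>
    unfolding compact_operator_def by (metis half_gt_zero)
  show "\<exists>N\<ge>1. \<forall>E. csubspace E \<and> cdim_at_least E N \<longrightarrow> (\<exists>x\<in>E. norm x = 1 \<and> norm (T x) \<le> \<epsilon>)"
  proof (intro exI[of _ "Suc m"] conjI allI impI)
    fix E :: "'a set" assume "csubspace E \<and> cdim_at_least E (Suc m)"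
    then have E: "csubspace E" "cdim_at_least E (Suc m)" by auto
    obtain b where b: "indep_mod {0} b (Suc m)" "b ` {..<Suc m} \<subseteq> E"
      by (rule cdim_at_least_indep_mod[OF E])
    obtain v where v: "\<And>i. i < Suc m \<Longrightarrow> v i \<in> cspan ({0} \<union> b ` {..<Suc m})"
      "\<And>i. i < Suc m \<Longrightarrow> norm (v i) = 1"
      "\<And>i j z. i < Suc m \<Longrightarrow> j < Suc m \<Longrightarrow> i \<noteq> j \<Longrightarrow> z \<in> {0} \<Longrightarrow> 1 / 2 \<le> norm (v i - v j - z)"
      by (rule riesz_sequence[OF complex_vector.subspace_single_0 closed_singleton b(1)], rule that)
    have "cspan ({0} \<union> b ` {..<Suc m}) \<subseteq> E"
      using b(2) complex_vector.subspace_0[OF E(1)] by (intro complex_vector.span_minimal E) auto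
    then have vE: "v i \<in> E" if "i < Suc m" for i using v(1) that by blast
    show "\<exists>x\<in>E. norm x = 1 \<and> norm (T x) \<le> \<epsilon>"
    proof (rule ccontr)
      assume contr: "\<not> ?thesis"
      have below: "\<epsilon> * norm x \<le> norm (T x)" if "x \<in> E" for x
      proof (cases "x = 0")
        case False
        have "(1 / norm x) *\<^sub>R x \<in> E" by (rule csubspace_scaleR[OF E(1) that])
        then have "\<epsilon> < norm (T ((1 / norm x) *\<^sub>R x))" using contr False by force
        then show ?thesis using False by (simp add: scaleR field_simps)
      qed (simp add: zero)
      have "Suc m \<le> m"
      proof (rule m)
        show "T (v i) \<in> closure (T ` cball 0 1)" if "i < Suc m" for i
          using v(2)[OF that] closure_subset by force
        fix i j assume ij: "i < Suc m" "j < Suc m" "i \<noteq> j"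
        have "\<epsilon> * (1 / 2) \<le> \<epsilon> * norm (v i - v j)"
          using v(3)[OF ij, of 0] \<open>\<epsilon> > 0\<close> by (intro mult_left_mono) auto
        also have "\<dots> \<le> norm (T (v i - v j))"
          by (intro below complex_vector.subspace_diff E vE ij)
        finally show "\<epsilon> / 2 \<le> dist (T (v i)) (T (v j))" by (simp add: dist_norm diff)
      qed
      then show False by simp
    qed
  qed simp
qed

text \<open>An infinite-dimensional subspace passes the dimension test for every \<open>N\<close>,
  so a lower bound \<open>c\<close> on it contradicts the property for \<epsilon> = c/2.\<close>

lemma super_strictly_singular_imp_strictly_singular:
  assumes "super_strictly_singular T" shows "strictly_singular T"
  unfolding strictly_singular_def
proof (intro notI, elim exE conjE)
  fix E assume E: "csubspace E" "\<not> finite_cdim E" and iso: "isomorphism_on E (T ` E) T"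
  obtain c where c: "c > 0" "\<And>x. x \<in> E \<Longrightarrow> c * norm x \<le> norm (T x)"
    by (rule isomorphism_on_bounded_below[OF E(1) iso], rule that)
  obtain N where "\<forall>E. csubspace E \<and> cdim_at_least E N \<longrightarrow> (\<exists>x\<in>E. norm x = 1 \<and> norm (T x) \<le> c / 2)"
    using assms c(1) unfolding super_strictly_singular_def by (meson half_gt_zero)
  then obtain x where "x \<in> E" "norm x = 1" "norm (T x) \<le> c / 2"
    using E by (auto simp: cdim_at_least_def)
  then show False using c(1) c(2)[of x] by simp
qed

lemma strictly_singular_imp_not_fixes_copy_of_linf:
  assumes "strictly_singular T" shows "\<not> fixes_copy_of_linf T"
proof
  assume "fixes_copy_of_linf T"
  then obtain E F where E: "csubspace E" "closed E" "isomorphic_to_linf E" "isomorphism_on E F T"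
    by (auto simp: fixes_copy_of_linf_def)
  moreover have "F = T ` E" using E(4) by (auto simp: isomorphism_on_def homeomorphism_def)
  ultimately show False
    using assms isomorphic_to_linf_not_finite_cdim by (auto simp: strictly_singular_def)
qed

section \<open>Cosingularity of compact operators\<close>

lemma quotient_norm_le:
  assumes "csubspace Z" shows "quotient_norm (quotient_map Z y) \<le> norm y"
  unfolding quotient_norm_def
proof (rule cINF_lower)
  show "bdd_below (norm ` quotient_map Z y)" by (rule bdd_belowI2[of _ 0]) simp
  show "y \<in> quotient_map Z y"
    using complex_vector.subspace_0[OF assms] unfolding quotient_map_def by force
qed

lemma ennreal_tendsto_0I:
  fixes f :: "nat \<Rightarrow> ennreal"
  assumes "\<And>\<epsilon>. \<epsilon> > 0 \<Longrightarrow> eventually (\<lambda>n. f n \<le> ennreal \<epsilon>) sequentially"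
  shows "f \<longlonglongrightarrow> 0"
proof (rule order_tendstoI)
  fix a :: ennreal assume "0 < a"
  then obtain z where z: "0 < z" "z < a" using dense by blast
  then obtain r where r: "z = ennreal r" "r \<ge> 0" by (cases z) auto
  then have "r > 0" using z by auto
  from assms[OF this] show "eventually (\<lambda>n. f n < a) sequentially"
    by eventually_elim (use z r in auto)
qed simp

text \<open>If the image of the unit ball covers a quotient ball of radius more than \<epsilon>,
  scaled unit vectors lift into the compact set and the dimension of the quotient is at most
  \<open>m\<close>.\<close>

lemma compact_imp_super_strictly_cosingular:
  fixes T :: "'a::complex_normed_vector \<Rightarrow> 'b::complex_normed_vector"
  assumes "compact_operator T"
  shows "super_strictly_cosingular T"
  unfolding super_strictly_cosingular_def
proof (rule ennreal_tendsto_0I)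
  fix \<epsilon> :: real assume "\<epsilon> > 0"
  obtain m where m: "\<And>n v. (\<And>i. i < n \<Longrightarrow> v i \<in> closure (T ` cball 0 1)) \<Longrightarrow>
    (\<And>i j. i < n \<Longrightarrow> j < n \<Longrightarrow> i \<noteq> j \<Longrightarrow> \<epsilon> / 2 \<le> dist (v i) (v j)) \<Longrightarrow> n \<le> (m :: nat)"
    using compact_separated_bound[of _ "\<epsilon> / 2"] assms \<open>\<epsilon> > 0\<close>
    unfolding compact_operator_def by (metis half_gt_zero)
  have "cosingular_number T n \<le> ennreal \<epsilon>" if n: "n > m" for n
    unfolding cosingular_number_def
  proof (rule Sup_least, clarify)
    fix E :: "'b set" assume E: "csubspace E" "closed E" and "quotient_has_dim E n"
    then obtain b where b: "indep_mod E b n"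
      using finite_quotient_basis_indep_mod by (metis quotient_has_dim_def)
    show "cosingular_modulus T E \<le> ennreal \<epsilon>"
      unfolding cosingular_modulus_def
    proof (rule Sup_least, clarify, rule ccontr)
      fix \<alpha> :: real
      assume ball: "scaled_quotient_ball \<alpha> E \<subseteq> (quotient_map E \<circ> T) ` cball 0 1"
        and "\<not> ennreal \<alpha> \<le> ennreal \<epsilon>"
      then have \<alpha>: "\<alpha> > \<epsilon>" using \<open>\<epsilon> > 0\<close> by (metis ennreal_leI not_le)
      have lift: "\<exists>k\<in>T ` cball 0 1. k - \<alpha> *\<^sub>R y \<in> E" if "norm y = 1" for y
      proof -
        have "quotient_map E (\<alpha> *\<^sub>R y) \<in> scaled_quotient_ball \<alpha> E"
          unfolding scaled_quotient_ball_def using quotient_norm_le[OF E(1), of y] that by auto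
        then obtain x where "x \<in> cball 0 1" "quotient_map E (T x) = quotient_map E (\<alpha> *\<^sub>R y)"
          using ball by auto
        then show ?thesis using quotient_map_eq_iff[OF E(1)] by blast
      qed
      obtain k where k: "\<And>i. i < n \<Longrightarrow> k i \<in> T ` cball 0 1"
        "\<And>i j. i < n \<Longrightarrow> j < n \<Longrightarrow> i \<noteq> j \<Longrightarrow> \<alpha> / 2 \<le> dist (k i) (k j)"
        by (rule riesz_separated_lifts[OF E b less_trans[OF \<open>\<epsilon> > 0\<close> \<alpha>] lift], assumption, rule that)
      have "n \<le> m"
      proof (rule m)
        show "k i \<in> closure (T ` cball 0 1)" if "i < n" for i
          by (rule subsetD[OF closure_subset k(1)[OF that]])
        show "\<epsilon> / 2 \<le> dist (k i) (k j)" if "i < n" "j < n" "i \<noteq> j" for i j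
          using k(2)[OF that] \<alpha> by simp
      qed
      then show False using n by simp
    qed
  qed
  then show "eventually (\<lambda>n. cosingular_number T n \<le> ennreal \<epsilon>) sequentially"
    unfolding eventually_sequentially by (metis Suc_le_eq)
qed

text \<open>By Baire's theorem one of the integer dilates of \<open>D\<close>, which cover the
  space, contains a ball. Halved differences of its points stay in that dilate by symmetry and
  convexity, and they move the ball to the origin.\<close>

lemma convex_symmetric_contains_ball:
  fixes D :: "'a::banach set"
  assumes D: "closed D" "convex D" "\<And>x. x \<in> D \<Longrightarrow> - x \<in> D"
    and cover: "\<And>x. \<exists>n. (1 / (real n + 1)) *\<^sub>R x \<in> D"
  obtains \<delta> where "\<delta> > 0" "ball 0 \<delta> \<subseteq> D"
proof -
  define S where "S n = (\<lambda>x. (real n + 1) *\<^sub>R x) ` D" for n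
  have "\<Union> (range S) = UNIV"
  proof (rule UNIV_eq_I[symmetric])
    fix x :: 'a
    obtain n where "(1 / (real n + 1)) *\<^sub>R x \<in> D" using cover by blast
    then have "(real n + 1) *\<^sub>R ((1 / (real n + 1)) *\<^sub>R x) \<in> S n" unfolding S_def by blast
    then show "x \<in> \<Union> (range S)" by (auto simp: add_nonneg_eq_0_iff)
  qed
  have "\<exists>n. interior (S n) \<noteq> {}"
  proof (rule ccontr)
    assume "\<not> ?thesis"
    then have "closedin euclidean T \<and> euclidean interior_of T = {}" if "T \<in> range S" for T
      using that closed_scaling[OF D(1)] by (auto simp: S_def)
    then have "euclidean interior_of \<Union> (range S) = {}"
      by (intro Baire_category_alt) (auto simp: completely_metrizable_space_euclidean)
    then show False using \<open>\<Union> (range S) = UNIV\<close> by simp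
  qed
  then obtain n where n: "interior (S n) \<noteq> {}" by blast
  then obtain x r where r: "r > 0" "ball x r \<subseteq> S n"
    by (meson ex_in_conv mem_interior)
  have half: "y \<in> S n \<Longrightarrow> z \<in> S n \<Longrightarrow> (1 / 2) *\<^sub>R (y - z) \<in> S n" for y z
  proof -
    assume "y \<in> S n" "z \<in> S n"
    then obtain a b where ab: "a \<in> D" "b \<in> D" "y = (real n + 1) *\<^sub>R a" "z = (real n + 1) *\<^sub>R b"
      by (auto simp: S_def)
    have "(1 / 2) *\<^sub>R a + (1 / 2) *\<^sub>R (- b) \<in> D"
      by (intro convexD[OF D(2)] ab D(3)) auto
    moreover have "(1 / 2) *\<^sub>R (y - z) = (real n + 1) *\<^sub>R ((1 / 2) *\<^sub>R a + (1 / 2) *\<^sub>R (- b))"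
      unfolding ab by (simp add: scaleR_diff_right)
    ultimately show "(1 / 2) *\<^sub>R (y - z) \<in> S n" unfolding S_def by blast
  qed
  define c where "c = real n + 1"
  have c: "c > 0" by (simp add: c_def)
  have S: "S n = (\<lambda>x. c *\<^sub>R x) ` D" by (simp add: S_def c_def)
  show thesis
  proof
    show "r / c > 0" using r c by simp
    show "ball 0 (r / c) \<subseteq> D"
    proof
      fix u :: 'a assume "u \<in> ball 0 (r / c)"
      then have "norm (c *\<^sub>R u) < r" using c by (simp add: pos_less_divide_eq mult.commute)
      then have "x + c *\<^sub>R u \<in> S n" "x - c *\<^sub>R u \<in> S n"
        by (intro subsetD[OF r(2)]; simp add: dist_norm)+
      from half[OF this] have "(1 / 2) *\<^sub>R (2 *\<^sub>R (c *\<^sub>R u)) \<in> S n"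
        unfolding scaleR_2 by simp
      then have "c *\<^sub>R u \<in> S n" by simp
      then obtain a where "a \<in> D" "c *\<^sub>R u = c *\<^sub>R a" unfolding S by blast
      then show "u \<in> D" using c by simp
    qed
  qed
qed

text \<open>The open mapping argument is carried out on the sum \<open>D\<close> of \<open>K\<close>
  and \<open>Z\<close>: it is closed as a compact plus a closed set, surjectivity makes it
  absorbing, so it contains a ball about 0. Short vectors thus lift to \<open>K\<close> modulo
  \<open>Z\<close>, which bounds the length of Riesz sequences modulo \<open>Z\<close>.\<close>

lemma compact_imp_strictly_cosingular:
  fixes T :: "'a::complex_normed_vector \<Rightarrow> 'b::{complex_normed_vector, banach}"
  assumes T: "bounded_clinear T" and "compact_operator T"
  shows "strictly_cosingular T"
  unfolding strictly_cosingular_def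
proof (intro allI impI notI)
  interpret bounded_linear T by (rule bounded_clinear_imp_bounded_linear[OF T])
  fix Z :: "'b set"
  assume "csubspace Z \<and> closed Z \<and> quotient_infinite_dim Z"
    and surj: "range (quotient_map Z \<circ> T) = quotient_space Z"
  then have Z: "csubspace Z" "closed Z" "quotient_infinite_dim Z" by auto
  define K where "K = closure (T ` cball 0 1)"
  define D where "D = (\<Union>x\<in>K. \<Union>y\<in>Z. {x + y})"
  have K: "compact K" using assms(2) by (simp add: K_def compact_operator_def)
  have TK: "T x \<in> K" if "norm x \<le> 1" for x
    unfolding K_def using that by (intro subsetD[OF closure_subset]) auto
  have convK: "convex K"
    unfolding K_def by (intro convex_closure convex_linear_image linear_axioms convex_cball)
  have symK: "- k \<in> K" if "k \<in> K" for k
  proof -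
    have "T ` cball 0 1 \<subseteq> uminus -` K"
      by (auto simp: neg[symmetric] intro!: TK)
    moreover have "closed (uminus -` K)"
      unfolding K_def by (intro closed_vimage closed_closure continuous_intros)
    ultimately have "K \<subseteq> uminus -` K" unfolding K_def by (rule closure_minimal)
    then show ?thesis using that by auto
  qed
  have "\<exists>\<delta>>0. ball 0 \<delta> \<subseteq> D"
  proof -
    have "closed D" unfolding D_def by (rule compact_closed_sums[OF K Z(2)])
    moreover have "convex D"
    proof -
      have "convex Z"
        using complex_vector.subspace_add[OF Z(1)] csubspace_scaleR[OF Z(1)] by (simp add: convex_def)
      then show ?thesis unfolding D_def by (rule convex_sums[OF convK])
    qed
    moreover have "- x \<in> D" if x: "x \<in> D" for x
    proof -
      obtain k z where "k \<in> K" "z \<in> Z" "x = k + z" using x unfolding D_def by blast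
      moreover have "- x = - k + - z" using \<open>x = k + z\<close> by simp
      ultimately show ?thesis
        using symK complex_vector.subspace_neg[OF Z(1)] unfolding D_def by blast
    qed
    moreover have "\<exists>n. (1 / (real n + 1)) *\<^sub>R y \<in> D" for y
    proof -
      have "quotient_map Z y \<in> range (quotient_map Z \<circ> T)"
        unfolding surj by (simp add: quotient_space_def)
      then obtain x where "quotient_map Z y = quotient_map Z (T x)" by auto
      then have x: "y - T x \<in> Z" by (simp add: quotient_map_eq_iff[OF Z(1)])
      obtain n where n: "norm x \<le> real n" using real_arch_simple by blast
      let ?c = "1 / (real n + 1)"
      have "norm (?c *\<^sub>R x) \<le> 1" using n by (simp add: divide_le_eq)
      then have "T (?c *\<^sub>R x) \<in> K" by (rule TK)
      moreover have "?c *\<^sub>R (y - T x) \<in> Z" by (rule csubspace_scaleR[OF Z(1) x])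
      moreover have "?c *\<^sub>R y = T (?c *\<^sub>R x) + ?c *\<^sub>R (y - T x)"
        by (simp add: scaleR scaleR_diff_right)
      ultimately show ?thesis unfolding D_def by blast
    qed
    ultimately show ?thesis using convex_symmetric_contains_ball by metis
  qed
  then obtain \<delta> where \<delta>: "\<delta> > 0" "ball 0 \<delta> \<subseteq> D" by blast
  have lift: "\<exists>k\<in>K. k - (\<delta> / 2) *\<^sub>R y \<in> Z" if "norm y = 1" for y
  proof -
    have "(\<delta> / 2) *\<^sub>R y \<in> D" using that \<delta>(1) by (intro subsetD[OF \<delta>(2)]) auto
    then obtain k z where kz: "k \<in> K" "z \<in> Z" "(\<delta> / 2) *\<^sub>R y = k + z" unfolding D_def by blast
    moreover have "k - (\<delta> / 2) *\<^sub>R y = - z" unfolding kz(3) by simp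
    ultimately show ?thesis using complex_vector.subspace_neg[OF Z(1)] by metis
  qed
  have "\<delta> / 2 / 2 > 0" "\<delta> / 2 > 0" using \<delta> by auto
  obtain m where m: "\<And>n v. (\<And>i. i < n \<Longrightarrow> v i \<in> K) \<Longrightarrow>
    (\<And>i j. i < n \<Longrightarrow> j < n \<Longrightarrow> i \<noteq> j \<Longrightarrow> \<delta> / 2 / 2 \<le> dist (v i) (v j)) \<Longrightarrow> n \<le> (m :: nat)"
    using compact_separated_bound[OF K \<open>\<delta> / 2 / 2 > 0\<close>] by metis
  obtain b where b: "indep_mod Z b (Suc m)"
    using quotient_infinite_dim_indep_mod[OF Z(1,3)] by blast
  obtain k where "\<And>i. i < Suc m \<Longrightarrow> k i \<in> K"
    "\<And>i j. i < Suc m \<Longrightarrow> j < Suc m \<Longrightarrow> i \<noteq> j \<Longrightarrow> \<delta> / 2 / 2 \<le> dist (k i) (k j)"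
    by (rule riesz_separated_lifts[OF Z(1,2) b \<open>\<delta> / 2 > 0\<close> lift], assumption, rule that)
  then have "Suc m \<le> m" by (rule m)
  then show False by simp
qed

section \<open>The weak topology\<close>

lemma openin_weak_topology_vimage:
  fixes \<phi> :: "'a::complex_normed_vector \<Rightarrow> complex"
  assumes "bounded_clinear \<phi>" "open U" shows "openin weak_topology (\<phi> -` U)"
  unfolding weak_topology_def using assms by (intro topology_generated_by_Basis) blast

lemma bounded_clinear_zero: "bounded_clinear (\<lambda>_. 0)"
  by (simp add: bounded_clinear_def bounded_linear_zero)

lemma topspace_weak_topology:
  "topspace (weak_topology :: 'a::complex_normed_vector topology) = UNIV"
proof -
  \<comment> \<open>The zero functional shows that the whole space is among the generating
    sets.\<close>
  have "(\<lambda>_::'a. 0::complex) -` UNIV \<subseteq> topspace weak_topology"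
    by (intro openin_subset openin_weak_topology_vimage bounded_clinear_zero open_UNIV)
  then show ?thesis by auto
qed

lemma continuous_map_weak_topology: "continuous_map euclidean weak_topology (\<lambda>x. x)"
  unfolding weak_topology_def
proof (rule continuous_on_generated_topo)
  fix U :: "'a set" assume "U \<in> {\<phi> -` U |(\<phi> :: 'a \<Rightarrow> complex) U. bounded_clinear \<phi> \<and> open U}"
  then obtain \<phi> :: "'a \<Rightarrow> complex" and V where "U = \<phi> -` V" "bounded_clinear \<phi>" "open V" by blast
  then show "openin euclidean ((\<lambda>x. x) -` U \<inter> topspace euclidean)"
    by (simp add: open_vimage bounded_clinear_continuous_on)
next
  have "UNIV = (\<lambda>_::'a. 0::complex) -` UNIV" by simp
  then show "(\<lambda>x. x) ` topspace euclidean \<subseteq>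
      \<Union> {\<phi> -` U |(\<phi> :: 'a \<Rightarrow> complex) U. bounded_clinear \<phi> \<and> open U}"
    using bounded_clinear_zero open_UNIV by blast
qed

text \<open>Preimages of disjoint open sets of scalars separate the points. The functionals are a
  hypothesis; for Lipschitz functions they are evaluations at points.\<close>

lemma Hausdorff_weak_topology:
  assumes sep: "\<And>x y :: 'a::complex_normed_vector. x \<noteq> y \<Longrightarrow>
    \<exists>\<phi> :: 'a \<Rightarrow> complex. bounded_clinear \<phi> \<and> \<phi> x \<noteq> \<phi> y"
  shows "Hausdorff_space (weak_topology :: 'a topology)"
  unfolding Hausdorff_space_def
proof (intro allI impI, elim conjE)
  fix x y :: 'a assume "x \<noteq> y"
  then obtain \<phi> :: "'a \<Rightarrow> complex" where \<phi>: "bounded_clinear \<phi>" "\<phi> x \<noteq> \<phi> y" using sep by blast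
  obtain U V where UV: "open U" "open V" "\<phi> x \<in> U" "\<phi> y \<in> V" "U \<inter> V = {}"
    using hausdorff[OF \<phi>(2)] by blast
  have "openin weak_topology (\<phi> -` U)" "openin weak_topology (\<phi> -` V)"
    "x \<in> \<phi> -` U" "y \<in> \<phi> -` V" "disjnt (\<phi> -` U) (\<phi> -` V)"
    using UV \<phi>(1) by (auto simp: disjnt_def intro: openin_weak_topology_vimage)
  then show "\<exists>U V. openin weak_topology U \<and> openin weak_topology V \<and> x \<in> U \<and> y \<in> V \<and> disjnt U V"
    by blast
qed

text \<open>The norm closure is weakly compact, hence weakly closed by the Hausdorff property, hence
  contains the weak closure.\<close>

lemma compact_imp_weakly_compact:
  fixes T :: "'a::complex_normed_vector \<Rightarrow> 'b::complex_normed_vector"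
  assumes sep: "\<And>x y :: 'b. x \<noteq> y \<Longrightarrow> \<exists>\<phi> :: 'b \<Rightarrow> complex. bounded_clinear \<phi> \<and> \<phi> x \<noteq> \<phi> y"
    and "compact_operator T"
  shows "weakly_compact_operator T"
proof -
  let ?K = "closure (T ` cball 0 1)"
  have "compactin weak_topology ((\<lambda>x. x) ` ?K)"
    using assms(2) by (intro image_compactin[OF _ continuous_map_weak_topology])
      (simp add: compact_operator_def)
  then have K: "compactin weak_topology ?K" by simp
  then have "closedin weak_topology ?K"
    by (intro compactin_imp_closedin Hausdorff_weak_topology sep)
  then have "weak_topology closure_of (T ` cball 0 1) \<subseteq> ?K"
    by (intro closure_of_minimal closure_subset)
  then show ?thesis
    unfolding weakly_compact_operator_def by (intro closed_compactin[OF K]) simp_all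
qed

text \<open>A cluster point, in the product topology, of the evaluations at the coordinates.\<close>

lemma exists_linf_limit_functional:
  obtains \<phi> :: "linf \<Rightarrow> complex" where "bounded_clinear \<phi>"
    "\<And>x n. \<forall>k\<ge>n. apply_bcontfun x k = 0 \<Longrightarrow> \<phi> x = 0"
    "\<And>x. \<forall>k. apply_bcontfun x k = 1 \<Longrightarrow> \<phi> x = 1"
proof -
  let ?e = "\<lambda>n (x :: linf). apply_bcontfun x n"
  define F where "F = filtermap ?e sequentially"
  \<comment> \<open>A product of discs, compact by Tychonoff, that contains all evaluations.\<close>
  let ?K = "PiE UNIV (\<lambda>x :: linf. cball (0 :: complex) (norm x))"
  have "compactin (product_topology (\<lambda>_. euclidean) UNIV) ?K"
    unfolding compactin_PiE by simp
  then have "compact ?K" unfolding euclidean_product_topology by simp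
  moreover have "F \<noteq> bot" unfolding F_def by (simp add: filtermap_bot_iff)
  moreover have "eventually (\<lambda>\<psi>. \<psi> \<in> ?K) F"
    unfolding F_def eventually_filtermap by (auto simp: norm_bounded intro: always_eventually)
  ultimately obtain \<phi> where \<phi>: "\<phi> \<in> ?K" "inf (nhds \<phi>) F \<noteq> bot"
    unfolding compact_filter by blast
  \<comment> \<open>A filter finer than the evaluations at large \<open>n\<close> that converges to
    \<phi>: identities between coordinates that hold for all large \<open>n\<close> pass to
    \<phi>.\<close>
  define H where "H = inf (nhds \<phi>) F"
  have lim: "((\<lambda>\<psi>. \<psi> x) \<longlongrightarrow> \<phi> x) H" for x
  proof -
    have "continuous_on UNIV (\<lambda>\<psi> :: linf \<Rightarrow> complex. \<psi> x)"
      using continuous_map_product_coordinates[of x UNIV "\<lambda>_. euclidean"]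
      by (simp add: euclidean_product_topology)
    then have "((\<lambda>\<psi>. \<psi> x) \<longlongrightarrow> \<phi> x) (nhds \<phi>)"
      using tendsto_at_iff_tendsto_nhds[of "\<lambda>\<psi>. \<psi> x" \<phi>]
      by (simp add: continuous_on_def)
    then show ?thesis unfolding H_def by (rule tendsto_mono[OF inf_le1])
  qed
  have ev: "eventually P H" if "\<And>n. n \<ge> N \<Longrightarrow> P (?e n)" for P N
    unfolding H_def F_def using that
    by (intro filter_leD[OF inf_le2]) (auto simp: eventually_filtermap eventually_sequentially)
  have uniq: "\<phi>1 = \<phi>2" if "(f \<longlongrightarrow> \<phi>1) H" "(g \<longlongrightarrow> \<phi>2) H" "\<And>n. n \<ge> N \<Longrightarrow> f (?e n) = g (?e n)"
    for f g :: "(linf \<Rightarrow> complex) \<Rightarrow> complex" and \<phi>1 \<phi>2 N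
  proof -
    have "eventually (\<lambda>\<psi>. f \<psi> = g \<psi>) H" using that(3) by (rule ev)
    then have "(f \<longlongrightarrow> \<phi>2) H" using that(2) tendsto_cong by blast
    then show ?thesis using that(1) \<phi>(2) tendsto_unique unfolding H_def by blast
  qed
  have add: "\<phi> (x + y) = \<phi> x + \<phi> y" for x y
    by (rule uniq[OF lim[of "x + y"] tendsto_add[OF lim[of x] lim[of y]], of 0]) simp
  have scale: "\<phi> (c *\<^sub>C x) = c *\<^sub>C \<phi> x" for c x
    unfolding scaleC_complex_def
    by (rule uniq[OF lim[of "c *\<^sub>C x"] tendsto_mult_left[OF lim[of x], of c], of 0]) (simp add: scaleC_bcontfun_rep_eq scaleC_complex_def)
  show thesis
  proof
    have "bounded_linear \<phi>"
    proof (rule bounded_linear_intro[where K = 1])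
      show "\<phi> (r *\<^sub>R x) = r *\<^sub>R \<phi> x" for r x
        using scale[of "of_real r" x] by (simp add: scaleC_of_real)
      show "norm (\<phi> x) \<le> norm x * 1" for x using \<phi>(1) by auto
    qed (rule add)
    then show "bounded_clinear \<phi>" using scale by (simp add: bounded_clinear_def)
    show "\<phi> x = 0" if "\<forall>k\<ge>n. apply_bcontfun x k = 0" for x n
      by (rule uniq[OF lim[of x] tendsto_const, of n]) (use that in blast)
    show "\<phi> x = 1" if "\<forall>k. apply_bcontfun x k = 1" for x
      by (rule uniq[OF lim[of x] tendsto_const, of 0]) (use that in blast)
  qed
qed

section \<open>Factorisations of the identity of \<open>\<ell>\<^sup>\<infinity>\<close>\<close>

definition linf_factors ::
    "('a::complex_normed_vector \<Rightarrow> 'b::complex_normed_vector) \<Rightarrow> bool"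
  where "linf_factors T \<longleftrightarrow> (\<exists>(S :: linf \<Rightarrow> 'a) (L :: 'b \<Rightarrow> linf).
    bounded_clinear S \<and> bounded_clinear L \<and> (\<forall>a. L (T (S a)) = a))"

lemma isomorphism_on_bounded:
  assumes "csubspace E" "csubspace F" "isomorphism_on E F T"
  obtains C where "\<And>x. x \<in> E \<Longrightarrow> norm (T x) \<le> norm x * C"
proof -
  obtain S where S: "homeomorphism E F T S" using assms(3) by (auto simp: isomorphism_on_def)
  obtain c where c: "c > 0" "\<And>y. y \<in> F \<Longrightarrow> c * norm y \<le> norm (S y)"
    by (rule isomorphism_on_bounded_below[OF assms(2) isomorphism_on_sym[OF assms(1,3) S]], rule that)
  show thesis
  proof
    fix x assume "x \<in> E"
    then have "T x \<in> F" "S (T x) = x" using S by (auto simp: homeomorphism_def)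
    then have "c * norm (T x) \<le> norm x" using c(2)[of "T x"] by simp
    then show "norm (T x) \<le> norm x * (1 / c)" using c(1) by (simp add: field_simps)
  qed
qed

lemma bounded_clinear_isomorphism_on_UNIV:
  assumes "csubspace F" "isomorphism_on UNIV F J"
  shows "bounded_clinear J"
proof -
  obtain C where C: "\<And>x. norm (J x) \<le> norm x * C"
    using isomorphism_on_bounded[OF complex_vector.subspace_UNIV assms] by auto
  have scale: "J (c *\<^sub>C x) = c *\<^sub>C J x" and add: "J (x + y) = J x + J y" for c x y
    using assms(2) by (auto simp: isomorphism_on_def)
  have "bounded_linear J"
  proof (rule bounded_linear_intro[OF add _ C])
    show "J (r *\<^sub>R x) = r *\<^sub>R J x" for r x
      using scale[of "of_real r" x] by (simp add: scaleC_of_real)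
  qed
  then show ?thesis using scale by (simp add: bounded_clinear_def)
qed

text \<open>\<open>J\<close> is linear and bounded on \<open>F\<close> only; precomposing with an
  operator into \<open>F\<close> gives an operator on the whole space.\<close>

lemma bounded_clinear_isomorphism_on_comp:
  assumes F: "csubspace F" "csubspace G" and J: "isomorphism_on F G J"
    and P: "bounded_clinear P" "range P \<subseteq> F"
  shows "bounded_clinear (\<lambda>x. J (P x))"
proof -
  interpret P: bounded_linear P by (rule bounded_clinear_imp_bounded_linear[OF P(1)])
  obtain C where C: "\<And>x. x \<in> F \<Longrightarrow> norm (J x) \<le> norm x * C"
    by (rule isomorphism_on_bounded[OF F J], rule that)
  have PF: "P x \<in> F" for x using P(2) by auto
  have add: "J (P (x + y)) = J (P x) + J (P y)" for x y
    using J PF by (simp add: isomorphism_on_def P.add)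
  have scale: "J (P (c *\<^sub>C x)) = c *\<^sub>C J (P x)" for c x
    using J PF by (simp add: isomorphism_on_def bounded_clinear_scaleC[OF P(1)])
  obtain D where D: "\<And>x. norm (P x) \<le> norm x * D" using P.bounded by blast
  have "norm (J (P x)) \<le> norm x * (D * \<bar>C\<bar>)" for x
  proof -
    have "norm (J (P x)) \<le> norm (P x) * C" by (rule C[OF PF])
    \<comment> \<open>The sign of \<open>C\<close> is unknown, hence the absolute value.\<close>
    also have "\<dots> \<le> norm (P x) * \<bar>C\<bar>" by (intro mult_left_mono) auto
    also have "\<dots> \<le> norm x * D * \<bar>C\<bar>" by (intro mult_right_mono D) auto
    finally show ?thesis by (simp add: mult.assoc)
  qed
  then have "bounded_linear (\<lambda>x. J (P x))"
  proof (rule bounded_linear_intro[OF add, rotated])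
    show "J (P (r *\<^sub>R x)) = r *\<^sub>R J (P x)" for r x
      using scale[of "of_real r" x] by (simp add: scaleC_of_real)
  qed
  then show ?thesis using scale by (simp add: bounded_clinear_def)
qed

text \<open>With coordinates \<open>J\<close> on \<open>F\<close> and a projection \<open>P\<close>
  onto \<open>F\<close>, the left factor is \<open>J\<close> after \<open>P\<close>, and the right
  factor is the inverse of \<open>J\<close> followed by the inverse of \<open>T\<close> on
  \<open>F\<close>.\<close>

lemma fixes_complemented_copy_imp_linf_factors:
  fixes T :: "'a::complex_normed_vector \<Rightarrow> 'b::complex_normed_vector"
  assumes "fixes_complemented_copy_of_linf T"
  shows "linf_factors T"
proof -
  obtain E F where E: "csubspace E" and F: "csubspace F" and iso: "isomorphic_to_linf F"
    and T: "isomorphism_on E F T" and "complemented F"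
    using assms by (auto simp: fixes_complemented_copy_of_linf_def)
  then obtain P where P: "bounded_clinear P" "P \<circ> P = P" "range P = F"
    by (auto simp: complemented_def)
  obtain J :: "'b \<Rightarrow> linf" where J: "isomorphism_on F UNIV J"
    using iso by (auto simp: isomorphic_to_linf_def)
  obtain K where K: "homeomorphism F UNIV J K" using J by (auto simp: isomorphism_on_def)
  obtain S where S: "homeomorphism E F T S" using T by (auto simp: isomorphism_on_def)
  have K': "isomorphism_on UNIV F K" by (rule isomorphism_on_sym[OF F J K])
  have S': "isomorphism_on F E S" by (rule isomorphism_on_sym[OF E T S])
  have KF: "K a \<in> F" and JK: "J (K a) = a" for a
    using K by (auto simp: homeomorphism_def)
  have "bounded_clinear (\<lambda>a. S (K a))"
    using bounded_clinear_isomorphism_on_UNIV[OF F K'] KF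
    by (intro bounded_clinear_isomorphism_on_comp[OF F E S']) auto
  moreover have "bounded_clinear (\<lambda>y. J (P y))"
    using P by (intro bounded_clinear_isomorphism_on_comp[OF F complex_vector.subspace_UNIV J]) auto
  moreover have "J (P (T (S (K a)))) = a" for a
  proof -
    have "T (S (K a)) = K a" using S KF by (auto simp: homeomorphism_def)
    moreover obtain y where "K a = P y" using KF[of a] P(3) by auto
    moreover have "P (P y) = P y" using P(2) by (metis comp_apply)
    ultimately show ?thesis using JK[of a] by simp
  qed
  ultimately show ?thesis unfolding linf_factors_def by blast
qed

text \<open>The copies are the ranges of \<open>S\<close> and \<open>T S\<close>, with projections
  \<open>S L T\<close> and \<open>T S L\<close>; they are closed as the fixed point sets of these
  projections.\<close>

lemma linf_factors_imp_fixes_complemented_copy: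
  fixes T :: "'a::complex_normed_vector \<Rightarrow> 'b::complex_normed_vector"
  assumes T: "bounded_clinear T" and "linf_factors T"
  shows "fixes_complemented_copy_of_linf T"
proof -
  obtain S :: "linf \<Rightarrow> 'a" and L :: "'b \<Rightarrow> linf" where S: "bounded_clinear S" and L: "bounded_clinear L"
    and LTS: "\<And>a. L (T (S a)) = a" using assms(2) by (auto simp: linf_factors_def)
  have TS: "bounded_clinear (\<lambda>a. T (S a))" and LT: "bounded_clinear (\<lambda>x. L (T x))"
    using T S L bounded_clinear_compose by blast+
  have SLT: "bounded_clinear (\<lambda>x. S (L (T x)))" and TSL: "bounded_clinear (\<lambda>y. T (S (L y)))"
    using T S L bounded_clinear_compose LT TS by blast+
  define E where "E = range S"
  define F where "F = range (\<lambda>a. T (S a))"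
  have comp_iso: "isomorphism_on A B U" if "bounded_clinear U" "homeomorphism A B U V" for A B U V
    using that unfolding isomorphism_on_def
    by (auto simp: bounded_clinear_scaleC bounded_clinear_def linear_simps)
  have "E = {x. S (L (T x)) = x}" unfolding E_def by (auto simp: LTS) (metis rangeI)
  then have clE: "closed E"
    using closed_Collect_eq[OF bounded_clinear_continuous_on[OF SLT] continuous_on_id] by simp
  have "F = {y. T (S (L y)) = y}" unfolding F_def by (auto simp: LTS) (metis rangeI)
  then have clF: "closed F"
    using closed_Collect_eq[OF bounded_clinear_continuous_on[OF TSL] continuous_on_id] by simp
  have "homeomorphism E UNIV (\<lambda>x. L (T x)) S"
    unfolding homeomorphism_def E_def
    using bounded_clinear_continuous_on[OF LT] bounded_clinear_continuous_on[OF S] LTS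
    by (auto simp: image_image)
  then have "isomorphic_to_linf E"
    using comp_iso[OF LT] by (auto simp: isomorphic_to_linf_def)
  moreover have "homeomorphism F UNIV L (\<lambda>a. T (S a))"
    unfolding homeomorphism_def F_def
    using bounded_clinear_continuous_on[OF L] bounded_clinear_continuous_on[OF TS] LTS
    by (auto simp: image_image)
  then have "isomorphic_to_linf F"
    using comp_iso[OF L] by (auto simp: isomorphic_to_linf_def)
  moreover have "homeomorphism E F T (\<lambda>y. S (L y))"
    unfolding homeomorphism_def E_def F_def
    using bounded_clinear_continuous_on[OF T]
      bounded_clinear_continuous_on[OF bounded_clinear_compose[OF S L]] LTS
    by (auto simp: image_image)
  then have "isomorphism_on E F T" by (rule comp_iso[OF T])
  moreover have "complemented E" unfolding complemented_def
    using SLT by (intro exI[of _ "\<lambda>x. S (L (T x))"]) (auto simp: fun_eq_iff E_def LTS, metis LTS rangeI)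
  moreover have "complemented F" unfolding complemented_def
    using TSL by (intro exI[of _ "\<lambda>y. T (S (L y))"]) (auto simp: fun_eq_iff F_def LTS, metis LTS rangeI)
  moreover have "csubspace E" "csubspace F"
    unfolding E_def F_def using csubspace_range[OF S] csubspace_range[OF TS] by auto
  ultimately show ?thesis
    unfolding fixes_complemented_copy_of_linf_def using clE clF by blast
qed

text \<open>Truncations of the constant sequence \<open>1/C\<close> are mapped by \<open>T S\<close>
  into the image of the unit ball. A weak cluster point would have all coordinates
  \<open>1/C\<close> under \<open>L\<close> and yet be annihilated by the limit functional, which is
  1 on the constant sequence 1. The proof states this as an open cover without a suitable finite
  subcover.\<close>

lemma linf_factors_imp_not_weakly_compact:
  fixes T :: "'a::complex_normed_vector \<Rightarrow> 'b::complex_normed_vector"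
  assumes "bounded_clinear T" and "linf_factors T"
  shows "\<not> weakly_compact_operator T"
proof
  assume "weakly_compact_operator T"
  then have comp: "compactin weak_topology (weak_topology closure_of (T ` cball 0 1))"
    by (simp add: weakly_compact_operator_def)
  obtain S :: "linf \<Rightarrow> 'a" and L :: "'b \<Rightarrow> linf" where S: "bounded_clinear S" and L: "bounded_clinear L"
    and LTS: "\<And>a. L (T (S a)) = a" using assms(2) by (auto simp: linf_factors_def)
  obtain C where C: "C > 0" "\<And>a. norm (S a) \<le> norm a * C"
    using bounded_linear.pos_bounded[OF bounded_clinear_imp_bounded_linear[OF S]] by blast
  obtain \<phi> :: "linf \<Rightarrow> complex" where \<phi>: "bounded_clinear \<phi>"
    "\<And>x n. \<forall>k\<ge>n. apply_bcontfun x k = 0 \<Longrightarrow> \<phi> x = 0"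
    "\<And>x. \<forall>k. apply_bcontfun x k = 1 \<Longrightarrow> \<phi> x = 1"
    by (rule exists_linf_limit_functional, rule that)
  let ?\<psi> = "\<lambda>y. \<phi> (L y)" and ?e = "\<lambda>k y. apply_bcontfun (L y) k"
  let ?r = "of_real (1 / C) :: complex"
  define U where "U = ?\<psi> -` (- {0})"
  define V where "V k = ?e k -` (- {?r})" for k
  have oU: "openin weak_topology U"
    unfolding U_def by (intro openin_weak_topology_vimage bounded_clinear_compose[OF \<phi>(1) L]) auto
  have oV: "openin weak_topology (V k)" for k
    unfolding V_def
    by (intro openin_weak_topology_vimage bounded_clinear_compose[OF bounded_clinear_apply_bcontfun L]) auto
  have cover: "y \<in> U \<union> \<Union> (range V)" for y
  proof (rule ccontr)
    assume "y \<notin> U \<union> \<Union> (range V)"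
    then have *: "\<phi> (L y) = 0" "\<And>k. apply_bcontfun (L y) k = ?r" by (auto simp: U_def V_def)
    have "\<phi> (of_real C *\<^sub>C L y) = 1"
      using C(1) by (intro \<phi>(3)) (simp add: scaleC_bcontfun_rep_eq scaleC_complex_def *)
    then show False
      using * by (simp add: bounded_clinear_scaleC[OF \<phi>(1)] scaleC_complex_def)
  qed
  have "\<exists>\<F>. finite \<F> \<and> \<F> \<subseteq> insert U (range V) \<and> weak_topology closure_of (T ` cball 0 1) \<subseteq> \<Union> \<F>"
  proof (rule compactinD[OF comp])
    show "openin weak_topology W" if "W \<in> insert U (range V)" for W using that oU oV by auto
    show "weak_topology closure_of (T ` cball 0 1) \<subseteq> \<Union> (insert U (range V))"
      using cover by auto
  qed
  then obtain \<F> where \<F>: "finite \<F>" "\<F> \<subseteq> insert U (range V)"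
    "weak_topology closure_of (T ` cball 0 1) \<subseteq> \<Union> \<F>" by blast
  then obtain I where I: "finite I" "\<F> - {U} \<subseteq> V ` I"
    using finite_subset_image[of "\<F> - {U}" V UNIV] by (metis Diff_subset_conv finite_Diff insert_is_Un order_refl)
  obtain n where n: "\<And>k. k \<in> I \<Longrightarrow> k < n" using I(1)[unfolded finite_nat_set_iff_bounded] by auto
  \<comment> \<open>\<open>n\<close> exceeds all indices of the subcover, so \<open>s\<close>
    escapes every chosen \<open>V k\<close>; being finitely supported it also escapes
    \<open>U\<close>.\<close>
  define s :: linf where "s = Bcontfun (\<lambda>k. if k < n then ?r else 0)"
  have s: "apply_bcontfun s = (\<lambda>k. if k < n then ?r else 0)"
    unfolding s_def using C(1) by (intro apply_Bcontfun_nat[where b = "1 / C"]) (auto simp: norm_divide)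
  have "norm s \<le> 1 / C"
    using C(1) by (intro norm_bound) (auto simp: s norm_divide)
  then have "norm s * C \<le> 1" using C(1) by (simp add: field_simps)
  then have "norm (S s) \<le> 1" using C(2)[of s] by simp
  then have "T (S s) \<in> T ` cball 0 1" by auto
  then have "T (S s) \<in> weak_topology closure_of (T ` cball 0 1)"
    using closure_of_subset[of "T ` cball 0 1" weak_topology] by (auto simp: topspace_weak_topology)
  then have "T (S s) \<in> U \<or> (\<exists>k\<in>I. T (S s) \<in> V k)" using \<F>(3) I(2) by blast
  moreover have "T (S s) \<notin> U" using \<phi>(2)[of n s] by (auto simp: U_def LTS s)
  moreover have "T (S s) \<notin> V k" if "k \<in> I" for k using n[OF that] by (simp add: V_def LTS s)
  ultimately show False by blast
qed

text \<open>The vector \<open>y - T (S (L y))\<close> always lies in the kernel \<open>Z\<close> of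
  \<open>L\<close>. Hence \<open>T\<close> hits every coset, and \<open>L\<close> identifies the
  quotient with the sequence space.\<close>

lemma linf_factors_imp_not_strictly_cosingular:
  fixes T :: "'a::complex_normed_vector \<Rightarrow> 'b::complex_normed_vector"
  assumes T: "bounded_clinear T" and "linf_factors T"
  shows "\<not> strictly_cosingular T"
proof
  assume cosing: "strictly_cosingular T"
  obtain S :: "linf \<Rightarrow> 'a" and L :: "'b \<Rightarrow> linf" where S: "bounded_clinear S" and L: "bounded_clinear L"
    and LTS: "\<And>a. L (T (S a)) = a" using assms(2) by (auto simp: linf_factors_def)
  define Z where "Z = {y. L y = 0}"
  interpret L: bounded_linear L by (rule bounded_clinear_imp_bounded_linear[OF L])
  have Z: "csubspace Z" unfolding Z_def by (rule csubspace_kernel[OF L])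
  moreover have "closed Z"
    unfolding Z_def by (intro closed_Collect_eq bounded_clinear_continuous_on[OF L] continuous_on_const)
  moreover have "quotient_infinite_dim Z"
    unfolding quotient_infinite_dim_def quotient_has_dim_def
  proof (intro allI notI, elim exE conjE)
    fix n B assume B: "finite_quotient_basis Z B"
    have "cspan (L ` B) = UNIV"
    proof (rule UNIV_eq_I[symmetric])
      fix a
      have "quotient_map Z (T (S a)) \<in> quotient_space Z" by (simp add: quotient_space_def)
      then obtain u where "quotient_map Z (T (S a)) = quotient_map Z (\<Sum>v\<in>B. u v *\<^sub>C v)"
        using B by (auto simp: finite_quotient_basis_def)
      then have "L (T (S a) - (\<Sum>v\<in>B. u v *\<^sub>C v)) = 0"
        by (simp add: quotient_map_eq_iff[OF Z]) (simp add: Z_def)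
      then have "a = (\<Sum>v\<in>B. u v *\<^sub>C L v)"
        by (simp add: L.diff LTS bounded_clinear_csum[OF L])
      also have "\<dots> \<in> cspan (L ` B)"
        by (intro complex_vector.span_sum complex_vector.span_scale complex_vector.span_base) auto
      finally show "a \<in> cspan (L ` B)" .
    qed
    moreover have "finite (L ` B)" using B by (simp add: finite_quotient_basis_def)
    ultimately show False using linf_not_finite_span by blast
  qed
  moreover have "range (quotient_map Z \<circ> T) = quotient_space Z"
  proof -
    have "quotient_map Z y = quotient_map Z (T (S (L y)))" for y
      by (simp add: quotient_map_eq_iff[OF Z]) (simp add: Z_def L.diff LTS)
    then have "quotient_map Z y \<in> range (quotient_map Z \<circ> T)" for y by (metis comp_apply rangeI)
    then show ?thesis unfolding quotient_space_def by auto
  qed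
  ultimately show False using cosing unfolding strictly_cosingular_def by blast
qed

text \<open>The witness of dimension \<open>n\<close> is the quotient by the vectors whose first
  \<open>n\<close> coordinates under \<open>L\<close> vanish. Lifting by \<open>S L\<close> costs
  the same factor \<open>C\<close> for every \<open>n\<close>.\<close>

lemma linf_factors_imp_not_super_strictly_cosingular:
  fixes T :: "'a::complex_normed_vector \<Rightarrow> 'b::complex_normed_vector"
  assumes T: "bounded_clinear T" and "linf_factors T"
  shows "\<not> super_strictly_cosingular T"
proof
  assume cosing: "super_strictly_cosingular T"
  obtain S :: "linf \<Rightarrow> 'a" and L :: "'b \<Rightarrow> linf" where S: "bounded_clinear S" and L: "bounded_clinear L"
    and LTS: "\<And>a. L (T (S a)) = a" using assms(2) by (auto simp: linf_factors_def)
  have SL: "bounded_clinear (\<lambda>y. S (L y))" by (rule bounded_clinear_compose[OF S L])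
  interpret L: bounded_linear L by (rule bounded_clinear_imp_bounded_linear[OF L])
  interpret SL: bounded_linear "\<lambda>y. S (L y)" by (rule bounded_clinear_imp_bounded_linear[OF SL])
  obtain C where C: "C > 0" "\<And>y. norm (S (L y)) \<le> norm y * C"
    using SL.pos_bounded by blast
  \<comment> \<open>The factor 2 pays for the quotient norm being an infimum: a coset of norm at
    most 1 has a representative of norm less than 2.\<close>
  define \<alpha> where "\<alpha> = 1 / (2 * C)"
  have \<alpha>: "\<alpha> > 0" using C(1) by (simp add: \<alpha>_def)
  have "ennreal \<alpha> \<le> cosingular_number T n" for n
  proof -
    define E where "E = (\<Inter>k<n. {y. apply_bcontfun (L y) k = 0})"
    have Lk: "bounded_clinear (\<lambda>y. apply_bcontfun (L y) k)" for k
      by (rule bounded_clinear_compose[OF bounded_clinear_apply_bcontfun L])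
    have E: "csubspace E"
      unfolding E_def by (intro complex_vector.subspace_Inter) (auto intro: csubspace_kernel[OF Lk])
    have "closed E" unfolding E_def
      by (intro closed_INT ballI closed_Collect_eq bounded_clinear_continuous_on[OF Lk] continuous_on_const)
    define b where "b k = T (S (linf_unit k))" for k
    have Lb: "apply_bcontfun (L (b k)) i = (if i = k then 1 else 0)" for k i
      by (simp add: b_def LTS apply_linf_unit)
    have "indep_mod E b n" unfolding indep_mod_def
    proof (intro allI impI notI)
      fix k assume "k < n" and *: "b k \<in> cspan (E \<union> b ` {..<k})"
      have "cspan (E \<union> b ` {..<k}) \<subseteq> {y. apply_bcontfun (L y) k = 0}"
        using \<open>k < n\<close> by (intro complex_vector.span_minimal csubspace_kernel[OF Lk]) (auto simp: E_def Lb)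
      then show False using * Lb[of k k] by auto
    qed
    moreover have "cspan (E \<union> b ` {..<n}) = UNIV"
    proof (rule UNIV_eq_I[symmetric])
      fix y
      let ?w = "\<Sum>k<n. apply_bcontfun (L y) k *\<^sub>C b k"
      have "apply_bcontfun (L ?w) i = apply_bcontfun (L y) i" if "i < n" for i
      proof -
        have "apply_bcontfun (L ?w) i = (\<Sum>k<n. apply_bcontfun (L (apply_bcontfun (L y) k *\<^sub>C b k)) i)"
          by (rule linear_sum[OF bounded_linear.linear[OF bounded_clinear_imp_bounded_linear[OF Lk]]])
        also have "\<dots> = (\<Sum>k<n. if k = i then apply_bcontfun (L y) k else 0)"
          by (intro sum.cong) (auto simp: bounded_clinear_scaleC[OF L] scaleC_bcontfun_rep_eq
              scaleC_complex_def Lb)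
        finally show ?thesis using that by simp
      qed
      then have "y - ?w \<in> E" by (simp add: E_def L.diff)
      then have "(y - ?w) + ?w \<in> cspan (E \<union> b ` {..<n})"
        by (intro complex_vector.span_add complex_vector.span_sum complex_vector.span_scale)
          (auto intro: complex_vector.span_base)
      then show "y \<in> cspan (E \<union> b ` {..<n})" by simp
    qed
    ultimately have dim: "quotient_has_dim E n" by (rule quotient_has_dimI[OF E])
    have "scaled_quotient_ball \<alpha> E \<subseteq> (quotient_map E \<circ> T) ` cball 0 1"
    proof
      fix D assume "D \<in> scaled_quotient_ball \<alpha> E"
      then obtain y where y: "D = quotient_map E (\<alpha> *\<^sub>R y)" "quotient_norm (quotient_map E y) \<le> 1"
        by (auto simp: scaled_quotient_ball_def)
      have "quotient_map E y \<noteq> {}"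
        using complex_vector.subspace_0[OF E] by (auto simp: quotient_map_def)
      then have "\<exists>x\<in>norm ` quotient_map E y. x < 2"
        using y(2) unfolding quotient_norm_def by (intro cInf_lessD) auto
      then obtain z where z: "z \<in> E" "norm (y + z) < 2" by (auto simp: quotient_map_def)
      define x where "x = S (L (\<alpha> *\<^sub>R (y + z)))"
      have "norm x \<le> \<alpha> * norm (y + z) * C" unfolding x_def using C(2)[of "\<alpha> *\<^sub>R (y + z)"] \<alpha> by simp
      also have "\<dots> \<le> \<alpha> * 2 * C" using z(2) \<alpha> C(1) by (intro mult_left_mono mult_right_mono) auto
      also have "\<dots> = 1" using C(1) by (simp add: \<alpha>_def)
      finally have "x \<in> cball 0 1" by simp
      moreover have "T x - \<alpha> *\<^sub>R y \<in> E"
        using z(1) by (simp add: E_def L.diff x_def LTS L.scaleR L.add algebra_simps)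
      then have "D = (quotient_map E \<circ> T) x"
        by (simp add: y(1) quotient_map_eq_iff[OF E, symmetric])
      ultimately show "D \<in> (quotient_map E \<circ> T) ` cball 0 1" by blast
    qed
    then have "ennreal \<alpha> \<le> cosingular_modulus T E"
      unfolding cosingular_modulus_def using \<alpha> by (intro Sup_upper) auto
    also have "\<dots> \<le> cosingular_number T n"
      unfolding cosingular_number_def using E \<open>closed E\<close> dim by (intro Sup_upper) auto
    finally show ?thesis .
  qed
  then have "ennreal \<alpha> \<le> 0"
    using cosing unfolding super_strictly_cosingular_def by (intro LIMSEQ_le_const) auto
  then show False using \<alpha> by simp
qed

section \<open>Infinite combinatorics\<close>

text \<open>Pigeonhole over a finite net of radius \<delta>/2 in the disc of radius
  \<open>K\<close>.\<close>

lemma infinite_bounded_small_oscillation: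
  fixes \<phi> :: "'i \<Rightarrow> complex"
  assumes "infinite I" "\<And>n. n \<in> I \<Longrightarrow> cmod (\<phi> n) \<le> K" "\<delta> > 0"
  obtains J where "J \<subseteq> I" "infinite J" "\<And>m n. m \<in> J \<Longrightarrow> n \<in> J \<Longrightarrow> cmod (\<phi> m - \<phi> n) < \<delta>"
proof -
  obtain k where k: "finite k" "cball (0 :: complex) K \<subseteq> (\<Union>x\<in>k. ball x (\<delta> / 2))"
    using compact_cball[of "0 :: complex" K, unfolded compact_eq_totally_bounded]
      half_gt_zero[OF \<open>\<delta> > 0\<close>] by meson
  have "\<forall>n\<in>I. \<exists>x\<in>k. dist x (\<phi> n) < \<delta> / 2"
  proof
    fix n assume "n \<in> I"
    then have "\<phi> n \<in> cball 0 K" using assms(2) by simp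
    from subsetD[OF k(2) this] show "\<exists>x\<in>k. dist x (\<phi> n) < \<delta> / 2" by auto
  qed
  then obtain x where x: "infinite {n \<in> I. dist x (\<phi> n) < \<delta> / 2}"
    using pigeonhole_infinite_rel[OF assms(1) k(1), of "\<lambda>n x. dist x (\<phi> n) < \<delta> / 2"] by auto
  show thesis
  proof
    show "cmod (\<phi> m - \<phi> n) < \<delta>"
      if "m \<in> {n \<in> I. dist x (\<phi> n) < \<delta> / 2}" "n \<in> {n \<in> I. dist x (\<phi> n) < \<delta> / 2}" for m n
      using that dist_triangle_half_r[of x "\<phi> m" \<delta> "\<phi> n"] by (simp add: dist_norm)
  qed (use x in auto)
qed

lemma infinite_homogeneous_subset:
  assumes "infinite I" "\<And>m n. P m n \<Longrightarrow> P n m"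
  obtains J where "J \<subseteq> I" "infinite J"
    "(\<forall>m\<in>J. \<forall>n\<in>J. m \<noteq> n \<longrightarrow> P m n) \<or> (\<forall>m\<in>J. \<forall>n\<in>J. m \<noteq> n \<longrightarrow> \<not> P m n)"
proof -
  define c :: "'a set \<Rightarrow> nat" where "c X = (if \<exists>m n. X = {m, n} \<and> P m n then 0 else 1)" for X
  have c: "c {m, n} = 0 \<longleftrightarrow> P m n" for m n
    using assms(2) by (auto simp: c_def doubleton_eq_iff)
  have "\<forall>x\<in>I. \<forall>y\<in>I. x \<noteq> y \<longrightarrow> c {x, y} < 2" by (simp add: c_def)
  then obtain J t where J: "J \<subseteq> I" "infinite J" "\<forall>x\<in>J. \<forall>y\<in>J. x \<noteq> y \<longrightarrow> c {x, y} = t"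
    using Ramsey2[OF assms(1), of c 2] by blast
  show thesis
  proof (rule that[OF J(1,2)], cases "t = 0")
    case True
    then show "(\<forall>m\<in>J. \<forall>n\<in>J. m \<noteq> n \<longrightarrow> P m n) \<or> (\<forall>m\<in>J. \<forall>n\<in>J. m \<noteq> n \<longrightarrow> \<not> P m n)"
      using J(3) c by simp
  next
    case False
    then show "(\<forall>m\<in>J. \<forall>n\<in>J. m \<noteq> n \<longrightarrow> P m n) \<or> (\<forall>m\<in>J. \<forall>n\<in>J. m \<noteq> n \<longrightarrow> \<not> P m n)"
      using J(3) c by metis
  qed
qed

text \<open>Each \<open>n\<close> has at most one target. In an infinite set where all pairs are
  related one way or the other, take \<open>n\<close> and \<open>n'\<close> different from
  \<open>a\<close> and its target: both have target \<open>a\<close>, yet one of them also has the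
  other as target. So Ramsey's theorem yields an unrelated set. It serves to discard indices whose
  points meet bumps of other indices.\<close>

lemma infinite_free_subset:
  assumes I: "infinite I" and H: "\<And>n m m'. H n m \<Longrightarrow> H n m' \<Longrightarrow> m = m'"
  obtains J where "J \<subseteq> I" "infinite J" "\<And>m n. m \<in> J \<Longrightarrow> n \<in> J \<Longrightarrow> m \<noteq> n \<Longrightarrow> \<not> H m n"
proof -
  obtain J where J: "J \<subseteq> I" "infinite J"
    "(\<forall>m\<in>J. \<forall>n\<in>J. m \<noteq> n \<longrightarrow> H m n \<or> H n m) \<or> (\<forall>m\<in>J. \<forall>n\<in>J. m \<noteq> n \<longrightarrow> \<not> (H m n \<or> H n m))"
    by (rule infinite_homogeneous_subset[OF I, of "\<lambda>m n. H m n \<or> H n m"]) auto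
  have "\<not> (\<forall>m\<in>J. \<forall>n\<in>J. m \<noteq> n \<longrightarrow> H m n \<or> H n m)"
  proof
    assume clique: "\<forall>m\<in>J. \<forall>n\<in>J. m \<noteq> n \<longrightarrow> H m n \<or> H n m"
    obtain a where a: "a \<in> J" using infinite_imp_nonempty[OF J(2)] by blast
    have "finite {m. H a m}"
    proof (cases "\<exists>m. H a m")
      case True
      then obtain m where "H a m" by blast
      then have "{m. H a m} \<subseteq> {m}" using H by blast
      then show ?thesis using finite_subset by blast
    qed simp
    then have inf: "infinite (J - insert a {m. H a m})" using J(2) by simp
    obtain n where n: "n \<in> J - insert a {m. H a m}" using infinite_imp_nonempty[OF inf] by blast
    have inf': "infinite (J - insert a {m. H a m} - {n})" using inf by simp
    obtain n' where n': "n' \<in> J - insert a {m. H a m} - {n}" using infinite_imp_nonempty[OF inf'] by blast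
    have "H n a" "H n' a" "H n n' \<or> H n' n" using clique a n n' by blast+
    then have "n' = a \<or> n = a" using H by blast
    then show False using n n' by blast
  qed
  with J that show thesis by blast
qed

text \<open>Greedy choice of each term against all earlier ones; symmetry of \<open>R\<close>
  removes the order of the indices.\<close>

lemma separated_sequence:
  assumes ex: "\<And>F. finite F \<Longrightarrow> F \<subseteq> A \<Longrightarrow> \<exists>x\<in>A. \<forall>y\<in>F. R x y" and sym: "\<And>x y. R x y \<Longrightarrow> R y x"
  shows "\<exists>s :: nat \<Rightarrow> 'a. (\<forall>n. s n \<in> A) \<and> (\<forall>m n. m \<noteq> n \<longrightarrow> R (s m) (s n))"
proof -
  define P where "P s n r \<longleftrightarrow> r \<in> A \<and> (\<forall>m<n. R r (s m))" for s :: "nat \<Rightarrow> 'a" and n r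
  have "\<exists>s. \<forall>n. P s n (s n)"
  proof (rule dependent_wf_choice[OF wf_less_than])
    fix s :: "nat \<Rightarrow> 'a" and n
    assume "\<And>m. (m, n) \<in> less_than \<Longrightarrow> P s m (s m)"
    then have "s ` {..<n} \<subseteq> A" by (auto simp: P_def)
    then show "\<exists>r. P s n r" using ex[of "s ` {..<n}"] by (auto simp: P_def)
  qed (auto simp: P_def)
  then obtain s where "\<forall>n. P s n (s n)" by blast
  then have s: "\<And>n. s n \<in> A" "\<And>m n. m < n \<Longrightarrow> R (s n) (s m)" by (auto simp: P_def)
  have "R (s m) (s n)" if "m \<noteq> n" for m n
    using that s(2)[of m n] s(2)[of n m] sym by (cases m n rule: linorder_cases) auto
  with s(1) show ?thesis by blast
qed

section \<open>Functionals supported on two points\<close>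

text \<open>Infinitely many atoms of norm below \<eta>/2 cluster. Otherwise Ramsey's theorem is
  applied to both sequences of end points. If neither becomes separated, the end points are close on
  the scale \<open>R\<close>, so the lengths are comparable and the coefficients bounded; once these
  are almost constant, the atoms cluster again. The bound 1/8 on \<open>c\<close> serves the
  comparison of lengths, the bound on \<open>12 * c * K\<close> the motion of the end
  points.\<close>

lemma atom_dichotomy:
  fixes p q :: "nat \<Rightarrow> 'n::{metric_space, zero}" and \<beta> :: "nat \<Rightarrow> complex"
  defines "R \<equiv> \<lambda>n. dist (p n) (q n)"
  assumes I: "infinite I" and bound: "\<And>n. n \<in> I \<Longrightarrow> cmod (\<beta> n) * R n \<le> K"
    and \<eta>: "\<eta> > 0" and c: "c > 0" "c \<le> 1 / 8" "12 * c * K \<le> \<eta>"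
  obtains J where "J \<subseteq> I" "infinite J"
    "(\<forall>m\<in>J. \<forall>n\<in>J. \<forall>g. cmod (\<beta> m * (lip0_apply g (p m) - lip0_apply g (q m)) -
        \<beta> n * (lip0_apply g (p n) - lip0_apply g (q n))) \<le> \<eta> * norm g) \<or>
     (\<forall>n\<in>J. \<eta> / 2 \<le> cmod (\<beta> n) * R n) \<and>
       ((\<forall>m\<in>J. \<forall>n\<in>J. m \<noteq> n \<longrightarrow> c * R m + c * R n \<le> dist (p m) (p n)) \<or>
        (\<forall>m\<in>J. \<forall>n\<in>J. m \<noteq> n \<longrightarrow> c * R m + c * R n \<le> dist (q m) (q n)))"
proof (cases "infinite {n \<in> I. cmod (\<beta> n) * R n < \<eta> / 2}")
  case True
  let ?u = "\<lambda>g n. \<beta> n * (lip0_apply g (p n) - lip0_apply g (q n))"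
  have small: "cmod (?u g n) \<le> \<eta> / 2 * norm g" if "n \<in> {n \<in> I. cmod (\<beta> n) * R n < \<eta> / 2}" for n g
  proof -
    have "cmod (?u g n) \<le> cmod (\<beta> n) * (norm g * R n)"
      unfolding norm_mult R_def by (intro mult_left_mono norm_lip0_bound) auto
    also have "\<dots> = cmod (\<beta> n) * R n * norm g" by simp
    also have "\<dots> \<le> \<eta> / 2 * norm g" using that by (intro mult_right_mono) auto
    finally show ?thesis .
  qed
  show thesis
  proof (rule that[OF _ True], goal_cases)
    case 2
    show ?case
    proof (rule disjI1, intro ballI allI)
      fix m n g
      assume "m \<in> {n \<in> I. cmod (\<beta> n) * R n < \<eta> / 2}" "n \<in> {n \<in> I. cmod (\<beta> n) * R n < \<eta> / 2}"
      then show "cmod (?u g m - ?u g n) \<le> \<eta> * norm g"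
        using norm_triangle_ineq4[of "?u g m" "?u g n"] small[of m g] small[of n g] by simp
    qed
  qed auto
next
  case False
  define I' where "I' = I - {n \<in> I. cmod (\<beta> n) * R n < \<eta> / 2}"
  have I': "infinite I'" "I' \<subseteq> I" "\<And>n. n \<in> I' \<Longrightarrow> \<eta> / 2 \<le> cmod (\<beta> n) * R n"
    using I False unfolding I'_def by auto
  obtain J1 where J1: "J1 \<subseteq> I'" "infinite J1"
    "(\<forall>m\<in>J1. \<forall>n\<in>J1. m \<noteq> n \<longrightarrow> c * R m + c * R n \<le> dist (p m) (p n)) \<or>
     (\<forall>m\<in>J1. \<forall>n\<in>J1. m \<noteq> n \<longrightarrow> \<not> c * R m + c * R n \<le> dist (p m) (p n))"
    by (rule infinite_homogeneous_subset[OF I'(1),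
          of "\<lambda>m n. c * R m + c * R n \<le> dist (p m) (p n)"]) (simp_all add: dist_commute add.commute)
  obtain J2 where J2: "J2 \<subseteq> J1" "infinite J2"
    "(\<forall>m\<in>J2. \<forall>n\<in>J2. m \<noteq> n \<longrightarrow> c * R m + c * R n \<le> dist (q m) (q n)) \<or>
     (\<forall>m\<in>J2. \<forall>n\<in>J2. m \<noteq> n \<longrightarrow> \<not> c * R m + c * R n \<le> dist (q m) (q n))"
    by (rule infinite_homogeneous_subset[OF J1(2),
          of "\<lambda>m n. c * R m + c * R n \<le> dist (q m) (q n)"]) (simp_all add: dist_commute add.commute)
  have J2I': "J2 \<subseteq> I'" using J1 J2 by blast
  consider (far_p) "\<forall>m\<in>J2. \<forall>n\<in>J2. m \<noteq> n \<longrightarrow> c * R m + c * R n \<le> dist (p m) (p n)"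
    | (far_q) "\<forall>m\<in>J2. \<forall>n\<in>J2. m \<noteq> n \<longrightarrow> c * R m + c * R n \<le> dist (q m) (q n)"
    | (near) "\<And>m n. m \<in> J2 \<Longrightarrow> n \<in> J2 \<Longrightarrow> m \<noteq> n \<Longrightarrow> dist (p m) (p n) < c * R m + c * R n"
        "\<And>m n. m \<in> J2 \<Longrightarrow> n \<in> J2 \<Longrightarrow> m \<noteq> n \<Longrightarrow> dist (q m) (q n) < c * R m + c * R n"
    using J1(3) J2(1,3) by (meson not_le subsetD)
  then show thesis
  proof cases
    case far_p
    then show thesis using J2I' I'(2,3) J2(2) by (intro that[of J2]) blast+
  next
    case far_q
    then show thesis using J2I' I'(2,3) J2(2) by (intro that[of J2]) blast+
  next
    case near
    \<comment> \<open>The triangle inequality gives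
      \<open>R m \<le> 2 * (c * (R m + R n)) + R n\<close>, hence
      \<open>3 * R m \<le> 5 * R n\<close>.\<close>
    have R2: "R m \<le> 2 * R n" if "m \<in> J2" "n \<in> J2" for m n
    proof (cases "m = n")
      case False
      have "R m \<le> dist (p m) (p n) + R n + dist (q m) (q n)"
        using dist_triangle[of "p m" "q m" "p n"] dist_triangle[of "p n" "q m" "q n"]
        unfolding R_def by (simp add: dist_commute)
      also have "\<dots> \<le> 2 * (c * (R m + R n)) + R n"
        using near(1)[OF that False] near(2)[OF that False] by (simp add: algebra_simps)
      also have "c * (R m + R n) \<le> 1 / 8 * (R m + R n)"
        using c by (intro mult_right_mono) (auto simp: R_def)
      finally have "3 * R m \<le> 5 * R n" by (simp add: field_simps)
      moreover have "R n \<ge> 0" by (simp add: R_def)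
      ultimately show ?thesis by linarith
    qed (simp add: R_def)
    obtain m0 where m0: "m0 \<in> J2" using infinite_imp_nonempty[OF J2(2)] by blast
    have "\<eta> / 2 \<le> cmod (\<beta> m0) * R m0" using m0 J2I' I'(3) by blast
    then have R0: "R m0 > 0" using \<eta> by (cases "R m0 = 0") (auto simp: R_def)
    have \<beta>K: "cmod (\<beta> n) \<le> 2 * K / R m0" if "n \<in> J2" for n
    proof -
      have "cmod (\<beta> n) * R m0 \<le> cmod (\<beta> n) * (2 * R n)"
        by (intro mult_left_mono R2 that m0) auto
      also have "\<dots> \<le> 2 * K" using bound[of n] that J2I' I'(2) by auto
      finally show ?thesis using R0 by (simp add: field_simps)
    qed
    \<comment> \<open>\<open>R m0\<close> is the common scale: this oscillation times a length of at
      most \<open>2 * R m0\<close> costs at most \<eta>/2.\<close>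
    obtain J where J: "J \<subseteq> J2" "infinite J"
      "\<And>m n. m \<in> J \<Longrightarrow> n \<in> J \<Longrightarrow> cmod (\<beta> m - \<beta> n) < \<eta> / (4 * R m0)"
      by (rule infinite_bounded_small_oscillation[OF J2(2) \<beta>K, where \<delta> = "\<eta> / (4 * R m0)"])
        (use \<eta> R0 in auto)
    show thesis
    proof (rule that[of J])
      show "J \<subseteq> I" "infinite J" using J J2I' I'(2) by auto
      show "(\<forall>m\<in>J. \<forall>n\<in>J. \<forall>g. cmod (\<beta> m * (lip0_apply g (p m) - lip0_apply g (q m)) -
        \<beta> n * (lip0_apply g (p n) - lip0_apply g (q n))) \<le> \<eta> * norm g) \<or>
     (\<forall>n\<in>J. \<eta> / 2 \<le> cmod (\<beta> n) * R n) \<and>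
       ((\<forall>m\<in>J. \<forall>n\<in>J. m \<noteq> n \<longrightarrow> c * R m + c * R n \<le> dist (p m) (p n)) \<or>
        (\<forall>m\<in>J. \<forall>n\<in>J. m \<noteq> n \<longrightarrow> c * R m + c * R n \<le> dist (q m) (q n)))"
      proof (rule disjI1, intro ballI allI)
        fix m n and g :: "'n lip0" assume mn: "m \<in> J" "n \<in> J"
        then have mn2: "m \<in> J2" "n \<in> J2" using J by auto
        let ?g = "lip0_apply g"
        show "cmod (\<beta> m * (?g (p m) - ?g (q m)) - \<beta> n * (?g (p n) - ?g (q n))) \<le> \<eta> * norm g"
        proof (cases "m = n")
          case False
          \<comment> \<open>The coefficient is changed with the end points fixed, then the end
            points with the coefficient fixed.\<close>
          have "\<beta> m * (?g (p m) - ?g (q m)) - \<beta> n * (?g (p n) - ?g (q n)) =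
            (\<beta> m - \<beta> n) * (?g (p m) - ?g (q m)) +
            \<beta> n * ((?g (p m) - ?g (p n)) - (?g (q m) - ?g (q n)))"
            by (simp add: algebra_simps)
          also have "cmod \<dots> \<le> cmod (\<beta> m - \<beta> n) * cmod (?g (p m) - ?g (q m)) +
            cmod (\<beta> n) * cmod ((?g (p m) - ?g (p n)) - (?g (q m) - ?g (q n)))"
            by (metis norm_mult norm_triangle_ineq)
          also have "\<dots> \<le> \<eta> / (4 * R m0) * (norm g * (2 * R m0)) +
            cmod (\<beta> n) * (norm g * (6 * c * R n))"
          proof (intro add_mono mult_mono mult_left_mono)
            show "cmod (\<beta> m - \<beta> n) \<le> \<eta> / (4 * R m0)" using J(3)[OF mn] by simp
            have "cmod (?g (p m) - ?g (q m)) \<le> norm g * R m"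
              unfolding R_def by (rule norm_lip0_bound)
            also have "\<dots> \<le> norm g * (2 * R m0)" by (intro mult_left_mono R2 mn2 m0) auto
            finally show "cmod (?g (p m) - ?g (q m)) \<le> norm g * (2 * R m0)" .
            have "cmod ((?g (p m) - ?g (p n)) - (?g (q m) - ?g (q n))) \<le>
              cmod (?g (p m) - ?g (p n)) + cmod (?g (q m) - ?g (q n))"
              by (rule norm_triangle_ineq4)
            also have "\<dots> \<le> norm g * dist (p m) (p n) + norm g * dist (q m) (q n)"
              by (intro add_mono norm_lip0_bound)
            also have "\<dots> \<le> norm g * (c * R m + c * R n) + norm g * (c * R m + c * R n)"
              using near(1)[OF mn2 False] near(2)[OF mn2 False] by (intro add_mono mult_left_mono) auto
            also have "\<dots> = norm g * (2 * c * (R m + R n))" by (simp add: algebra_simps)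
            also have "\<dots> \<le> norm g * (2 * c * (2 * R n + R n))"
              using c R2[OF mn2] by (intro mult_left_mono add_mono) auto
            finally show "cmod ((?g (p m) - ?g (p n)) - (?g (q m) - ?g (q n))) \<le> norm g * (6 * c * R n)"
              by simp
          qed (use \<eta> R0 in auto)
          also have "\<dots> = \<eta> / 2 * norm g + 6 * c * (cmod (\<beta> n) * R n) * norm g"
            using R0 by (simp add: field_simps)
          also have "\<dots> \<le> \<eta> / 2 * norm g + 6 * c * K * norm g"
            using c bound[of n] mn2 J2I' I'(2) by (intro add_mono mult_right_mono mult_left_mono) auto
          also have "\<dots> \<le> \<eta> / 2 * norm g + \<eta> / 2 * norm g"
            using c by (intro add_mono mult_right_mono) auto
          finally show ?thesis by simp
        qed (use \<eta> in simp)
      qed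
    qed
  qed
qed

text \<open>A cone of height \<open>r\<close> cut off at \<open>r / 2\<close>. The plateau gives two
  nearby points the same value, so that a functional with coefficients \<open>A\<close> and
  \<open>-B\<close> there sees only \<open>A - B\<close>.\<close>

definition bump :: "'n::metric_space \<Rightarrow> real \<Rightarrow> 'n \<Rightarrow> real"
  where "bump z r w = max 0 (min (r / 2) (r - dist w z))"

lemma bump_lipschitz: "\<bar>bump z r w - bump z r w'\<bar> \<le> dist w w'"
proof -
  have "\<bar>dist w z - dist w' z\<bar> \<le> dist w w'"
    using dist_triangle[of w z w'] dist_triangle[of w' z w] by (simp add: dist_commute abs_le_iff)
  then show ?thesis by (auto simp: bump_def max_def min_def)
qed

lemma bump_outside: "r \<le> dist w z \<Longrightarrow> bump z r w = 0"
  by (simp add: bump_def)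

lemma bump_plateau: "0 \<le> r \<Longrightarrow> dist w z \<le> r / 2 \<Longrightarrow> bump z r w = r / 2"
  by (simp add: bump_def)

lemma bump_nonzero: "bump z r w \<noteq> 0 \<Longrightarrow> dist w z < r"
  by (rule ccontr) (simp add: bump_outside)

lemma bump_lip0:
  fixes z :: "'n::{metric_space, zero}"
  assumes "r \<le> dist z 0"
  obtains g :: "'n lip0" where "norm g \<le> 1" "\<And>w. lip0_apply g w = of_real (bump z r w)"
proof -
  have "1-lipschitz_on UNIV (\<lambda>w. of_real (bump z r w) :: complex)"
    by (auto simp: lipschitz_on_def dist_norm bump_lipschitz simp flip: of_real_diff)
  moreover have "bump z r 0 = 0" using assms by (intro bump_outside) (simp add: dist_commute)
  ultimately have g: "lip0_apply (Lip0 (\<lambda>w. of_real (bump z r w))) = (\<lambda>w. of_real (bump z r w))"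
    by (intro Lip0_inverse) auto
  show thesis
  proof
    show "norm (Lip0 (\<lambda>w. of_real (bump z r w)) :: 'n lip0) \<le> 1"
      by (intro norm_lip0_le) (simp_all add: g bump_lipschitz flip: of_real_diff)
  qed (simp add: g)
qed

text \<open>Bumps on pairwise disjoint balls that avoid the base point, each clearly seen by its own
  functional. Interaction between different indices is removed later by passing to a
  subsequence.\<close>

definition bump_system :: "(nat \<Rightarrow> complex) \<Rightarrow> (nat \<Rightarrow> complex) \<Rightarrow>
    (nat \<Rightarrow> 'n::{metric_space, zero}) \<Rightarrow> (nat \<Rightarrow> 'n) \<Rightarrow> nat set \<Rightarrow> bool"
  where "bump_system A B p q I \<longleftrightarrow> (\<exists>z r \<kappa>. \<kappa> > 0 \<and>
    (\<forall>n\<in>I. r n \<le> dist (z n) 0 \<and>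
      \<kappa> \<le> cmod (A n * of_real (bump (z n) (r n) (p n)) - B n * of_real (bump (z n) (r n) (q n)))) \<and>
    (\<forall>m\<in>I. \<forall>n\<in>I. m \<noteq> n \<longrightarrow> r m + r n \<le> dist (z m) (z n)))"

lemma bump_systemI:
  assumes "\<kappa> > 0" "\<And>n. n \<in> I \<Longrightarrow> r n \<le> dist (z n) 0"
    "\<And>n. n \<in> I \<Longrightarrow>
      \<kappa> \<le> cmod (A n * of_real (bump (z n) (r n) (p n)) - B n * of_real (bump (z n) (r n) (q n)))"
    "\<And>m n. m \<in> I \<Longrightarrow> n \<in> I \<Longrightarrow> m \<noteq> n \<Longrightarrow> r m + r n \<le> dist (z m) (z n)"
  shows "bump_system A B p q I"
  unfolding bump_system_def using assms by blast

text \<open>Choosing the centre and radius of the test bump isolates \<open>a\<close>,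
  \<open>b\<close> or \<open>a - b\<close>, which is how coefficients get bounded.\<close>

lemma two_point_bump_le:
  fixes a b :: complex and p q z :: "'n::{metric_space, zero}"
  assumes "\<And>g. cmod (a * lip0_apply g p - b * lip0_apply g q) \<le> K * norm g" "K > 0" "r \<le> dist z 0"
  shows "cmod (a * of_real (bump z r p) - b * of_real (bump z r q)) \<le> K"
proof -
  obtain g where g: "norm g \<le> 1" "\<And>w. lip0_apply g w = of_real (bump z r w)"
    using bump_lip0[OF assms(3)] by blast
  have "cmod (a * of_real (bump z r p) - b * of_real (bump z r q)) \<le> K * norm g"
    using assms(1)[of g] by (simp add: g(2))
  also have "\<dots> \<le> K * 1" using g(1) assms(2) by (intro mult_left_mono) auto
  finally show ?thesis by simp
qed

text \<open>Excludes the separated alternative of \<open>atom_dichotomy\<close> for end points that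
  are all equal to the base point.\<close>

lemma dist_0_0_not_separated:
  assumes "infinite J" "\<And>n. n \<in> J \<Longrightarrow> R n > 0" "c > 0"
    "\<forall>m\<in>J. \<forall>n\<in>J. m \<noteq> n \<longrightarrow> c * R m + c * R n \<le> dist (x :: 'n::metric_space) x"
  shows False
proof -
  obtain m where m: "m \<in> J" using infinite_imp_nonempty[OF assms(1)] by blast
  have "infinite (J - {m})" using assms(1) by simp
  then obtain n where n: "n \<in> J - {m}" using infinite_imp_nonempty by blast
  have "c * R m + c * R n \<le> 0" using assms(4) m n by auto
  moreover have "c * R m > 0" "c * R n > 0" using assms(2,3) m n by auto
  ultimately show False by simp
qed

lemma pos_of_mult_ge:
  fixes a b :: real assumes "e > 0" "e \<le> a * b" "b \<ge> 0" shows "b > 0"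
  using assms by (cases "b = 0") auto

text \<open>Bumps of radius \<theta> times the distance to the base point, centred at one of the two
  points, miss the other one. They bound the two terms separately, so the atoms are
  \<open>A \<delta>\<^sub>p\<close> and \<open>B \<delta>\<^sub>q\<close>, written with the base
  point as second end point.\<close>

lemma bump_system_far:
  fixes p q :: "nat \<Rightarrow> 'n::{metric_space, zero}" and A B :: "nat \<Rightarrow> complex"
  defines "\<gamma> \<equiv> \<lambda>n g. A n * lip0_apply g (p n) - B n * lip0_apply g (q n)"
  assumes I: "infinite I" and K: "K > 0" and \<epsilon>: "\<epsilon> > 0" and \<theta>: "\<theta> > 0" "\<theta> \<le> 1 / 8"
    and bound: "\<And>n g. cmod (\<gamma> n g) \<le> K * norm g"
    and sep: "\<And>m n. m \<noteq> n \<Longrightarrow> \<exists>g. \<epsilon> * norm g < cmod (\<gamma> m g - \<gamma> n g)"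
    and pq: "\<And>n. dist (q n) 0 \<le> dist (p n) 0"
    and far: "\<And>n. n \<in> I \<Longrightarrow> \<theta> * dist (p n) 0 \<le> dist (p n) (q n)"
  shows "\<exists>J\<subseteq>I. infinite J \<and> bump_system A B p q J"
proof -
  \<comment> \<open>\<open>c \<le> \<theta>\<close> makes the bumps miss the other point; the second
    bound is the hypothesis of \<open>atom_dichotomy\<close> for tolerance \<epsilon>/2 and atoms of
    norm at most \<open>2 * K / \<theta>\<close>.\<close>
  define c where "c = min \<theta> (\<epsilon> * \<theta> / (48 * K))"
  have c: "c > 0" "c \<le> 1 / 8" "c \<le> \<theta>" using K \<epsilon> \<theta> by (auto simp: c_def)
  have "c \<le> \<epsilon> * \<theta> / (48 * K)" by (simp add: c_def)
  then have cK: "12 * c * (2 * K / \<theta>) \<le> \<epsilon> / 2"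
    using K \<theta>(1) by (simp add: field_simps)
  have bump_le: "cmod (A n * of_real (bump z r (p n)) - B n * of_real (bump z r (q n))) \<le> K"
    if "r \<le> dist z 0" for n z r
    by (rule two_point_bump_le[OF _ K that]) (use bound in \<open>simp add: \<gamma>_def\<close>)
  have \<theta>1: "\<theta> * x \<le> x" "c * x \<le> x" "c * x \<le> \<theta> * x" if "x \<ge> 0" for x
    using that \<theta> c by (auto intro: mult_left_le_one_le mult_right_mono)
  have at_p: "bump (p n) (s * dist (p n) 0) (q n) = 0" if "n \<in> I" "s \<le> \<theta>" for n s
  proof (rule bump_outside)
    have "s * dist (p n) 0 \<le> \<theta> * dist (p n) 0" using that by (intro mult_right_mono) auto
    then show "s * dist (p n) 0 \<le> dist (q n) (p n)" using far[OF that(1)] by (simp add: dist_commute)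
  qed
  \<comment> \<open>As \<open>q n\<close> is no farther from the base point than \<open>p n\<close>,
    the separation measured from \<open>p n\<close> also covers the ball around
    \<open>q n\<close>.\<close>
  have at_q: "bump (q n) (s * dist (q n) 0) (p n) = 0" if "n \<in> I" "s \<le> \<theta>" for n s
  proof (rule bump_outside)
    have "s * dist (q n) 0 \<le> \<theta> * dist (p n) 0" using that \<theta>(1) pq by (intro mult_mono) auto
    then show "s * dist (q n) 0 \<le> dist (p n) (q n)" using far[OF that(1)] by (simp add: dist_commute)
  qed
  have boundA: "cmod (A n) * dist (p n) 0 \<le> 2 * K / \<theta>" if n: "n \<in> I" for n
  proof -
    have "cmod (A n) * (\<theta> * dist (p n) 0 / 2) \<le> K"
      using bump_le[of "\<theta> * dist (p n) 0" "p n" n] at_p[OF n order_refl] \<theta>1(1)[of "dist (p n) 0"] \<theta>(1)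
      by (simp add: bump_plateau norm_mult)
    then show ?thesis using \<theta>(1) by (simp add: field_simps)
  qed
  have boundB: "cmod (B n) * dist (q n) 0 \<le> 2 * K / \<theta>" if n: "n \<in> I" for n
  proof -
    have "cmod (B n) * (\<theta> * dist (q n) 0 / 2) \<le> K"
      using bump_le[of "\<theta> * dist (q n) 0" "q n" n] at_q[OF n order_refl] \<theta>1(1)[of "dist (q n) 0"] \<theta>(1)
      by (simp add: bump_plateau norm_mult)
    then show ?thesis using \<theta>(1) by (simp add: field_simps)
  qed
  have \<eta>: "\<epsilon> / 2 > 0" using \<epsilon> by simp
  have \<kappa>: "c * \<epsilon> / 8 > 0" using c \<epsilon> by simp
  have scale: "c * \<epsilon> / 8 \<le> x * (c * R / 2)" if "\<epsilon> / 2 / 2 \<le> x * R" for x R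
  proof -
    have "c / 2 * (\<epsilon> / 2 / 2) \<le> c / 2 * (x * R)" using that c by (intro mult_left_mono) auto
    then show ?thesis by (simp add: algebra_simps)
  qed
  obtain J1 where J1: "J1 \<subseteq> I" "infinite J1" and dich1:
    "(\<forall>m\<in>J1. \<forall>n\<in>J1. \<forall>g. cmod (A m * (lip0_apply g (p m) - lip0_apply g 0) -
        A n * (lip0_apply g (p n) - lip0_apply g 0)) \<le> \<epsilon> / 2 * norm g) \<or>
     (\<forall>n\<in>J1. \<epsilon> / 2 / 2 \<le> cmod (A n) * dist (p n) 0) \<and>
       ((\<forall>m\<in>J1. \<forall>n\<in>J1. m \<noteq> n \<longrightarrow> c * dist (p m) 0 + c * dist (p n) 0 \<le> dist (p m) (p n)) \<or>
        (\<forall>m\<in>J1. \<forall>n\<in>J1. m \<noteq> n \<longrightarrow> c * dist (p m) 0 + c * dist (p n) 0 \<le> dist (0 :: 'n) 0))"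
    by (rule atom_dichotomy[OF I boundA \<eta> c(1,2) cK])
  from dich1 show ?thesis
  proof (elim disjE conjE)
    assume big: "\<forall>n\<in>J1. \<epsilon> / 2 / 2 \<le> cmod (A n) * dist (p n) 0"
      and "\<forall>m\<in>J1. \<forall>n\<in>J1. m \<noteq> n \<longrightarrow> c * dist (p m) 0 + c * dist (p n) 0 \<le> dist (p m) (p n)"
    then have "bump_system A B p q J1"
      using J1(1) c(1,3) \<theta>1(2) scale
      by (intro bump_systemI[OF \<kappa>, where z = p and r = "\<lambda>n. c * dist (p n) 0"])
        (auto simp: at_p subset_iff bump_plateau norm_mult)
    then show ?thesis using J1 by blast
  next
    assume big: "\<forall>n\<in>J1. \<epsilon> / 2 / 2 \<le> cmod (A n) * dist (p n) 0"
      and "\<forall>m\<in>J1. \<forall>n\<in>J1. m \<noteq> n \<longrightarrow> c * dist (p m) 0 + c * dist (p n) 0 \<le> dist (0 :: 'n) 0"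
    then show ?thesis
      using dist_0_0_not_separated[OF J1(2), of "\<lambda>n. dist (p n) 0" c 0] c(1) \<epsilon>
        pos_of_mult_ge[of "\<epsilon> / 2 / 2"] by (meson half_gt_zero zero_le_dist)
  next
    assume clust1: "\<forall>m\<in>J1. \<forall>n\<in>J1. \<forall>g. cmod (A m * (lip0_apply g (p m) - lip0_apply g 0) -
        A n * (lip0_apply g (p n) - lip0_apply g 0)) \<le> \<epsilon> / 2 * norm g"
    obtain J2 where J2: "J2 \<subseteq> J1" "infinite J2" and dich2:
      "(\<forall>m\<in>J2. \<forall>n\<in>J2. \<forall>g. cmod (B m * (lip0_apply g (q m) - lip0_apply g 0) -
          B n * (lip0_apply g (q n) - lip0_apply g 0)) \<le> \<epsilon> / 2 * norm g) \<or>
       (\<forall>n\<in>J2. \<epsilon> / 2 / 2 \<le> cmod (B n) * dist (q n) 0) \<and>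
         ((\<forall>m\<in>J2. \<forall>n\<in>J2. m \<noteq> n \<longrightarrow> c * dist (q m) 0 + c * dist (q n) 0 \<le> dist (q m) (q n)) \<or>
          (\<forall>m\<in>J2. \<forall>n\<in>J2. m \<noteq> n \<longrightarrow> c * dist (q m) 0 + c * dist (q n) 0 \<le> dist (0 :: 'n) 0))"
      by (rule atom_dichotomy[OF J1(2) boundB \<eta> c(1,2) cK]) (use J1(1) in blast)+
    have J2I: "J2 \<subseteq> I" using J1 J2 by blast
    from dich2 show ?thesis
    proof (elim disjE conjE)
      assume big: "\<forall>n\<in>J2. \<epsilon> / 2 / 2 \<le> cmod (B n) * dist (q n) 0"
        and "\<forall>m\<in>J2. \<forall>n\<in>J2. m \<noteq> n \<longrightarrow> c * dist (q m) 0 + c * dist (q n) 0 \<le> dist (q m) (q n)"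
      then have "bump_system A B p q J2"
        using J2I c(1,3) \<theta>1(2) scale
        by (intro bump_systemI[OF \<kappa>, where z = q and r = "\<lambda>n. c * dist (q n) 0"])
          (auto simp: at_q subset_iff bump_plateau norm_mult)
      then show ?thesis using J2(2) J2I by blast
    next
      assume big: "\<forall>n\<in>J2. \<epsilon> / 2 / 2 \<le> cmod (B n) * dist (q n) 0"
        and "\<forall>m\<in>J2. \<forall>n\<in>J2. m \<noteq> n \<longrightarrow> c * dist (q m) 0 + c * dist (q n) 0 \<le> dist (0 :: 'n) 0"
      then show ?thesis
        using dist_0_0_not_separated[OF J2(2), of "\<lambda>n. dist (q n) 0" c 0] c(1) \<epsilon>
          pos_of_mult_ge[of "\<epsilon> / 2 / 2"] by (meson half_gt_zero zero_le_dist)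
    next
      assume clust2: "\<forall>m\<in>J2. \<forall>n\<in>J2. \<forall>g. cmod (B m * (lip0_apply g (q m) - lip0_apply g 0) -
          B n * (lip0_apply g (q n) - lip0_apply g 0)) \<le> \<epsilon> / 2 * norm g"
      obtain m where m: "m \<in> J2" using infinite_imp_nonempty[OF J2(2)] by blast
      have "infinite (J2 - {m})" using J2(2) by simp
      then obtain n where n: "n \<in> J2" "n \<noteq> m" using infinite_imp_nonempty by blast
      obtain g where g: "\<epsilon> * norm g < cmod (\<gamma> m g - \<gamma> n g)" using sep n(2) by metis
      let ?g = "lip0_apply g"
      have "\<gamma> m g - \<gamma> n g = (A m * ?g (p m) - A n * ?g (p n)) - (B m * ?g (q m) - B n * ?g (q n))"
        by (simp add: \<gamma>_def)
      also have "cmod \<dots> \<le> cmod (A m * ?g (p m) - A n * ?g (p n)) + cmod (B m * ?g (q m) - B n * ?g (q n))"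
        by (rule norm_triangle_ineq4)
      also have "\<dots> \<le> \<epsilon> / 2 * norm g + \<epsilon> / 2 * norm g"
        using clust1[rule_format, of m n g] clust2[rule_format, of m n g] m n J2(1)
        by (intro add_mono) auto
      finally show ?thesis using g by simp
    qed
  qed
qed

text \<open>The splitting is \<open>(A - B) \<delta>\<^sub>p + B (\<delta>\<^sub>p -
  \<delta>\<^sub>q)\<close>. A bump around \<open>p n\<close> whose plateau contains
  \<open>q n\<close> bounds \<open>A - B\<close> on the scale \<open>dist (p n) 0\<close>; a bump
  around \<open>q n\<close> that misses \<open>p n\<close> bounds \<open>B\<close> on the scale
  \<open>dist (p n) (q n)\<close>.\<close>

lemma bump_system_near:
  fixes p q :: "nat \<Rightarrow> 'n::{metric_space, zero}" and A B :: "nat \<Rightarrow> complex"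
  defines "\<gamma> \<equiv> \<lambda>n g. A n * lip0_apply g (p n) - B n * lip0_apply g (q n)"
  assumes I: "infinite I" and K: "K > 0" and \<epsilon>: "\<epsilon> > 0"
    and c: "c > 0" "c \<le> 1 / 8" "48 * c * K \<le> \<epsilon>"
    and bound: "\<And>n g. cmod (\<gamma> n g) \<le> K * norm g"
    and sep: "\<And>m n. m \<noteq> n \<Longrightarrow> \<exists>g. \<epsilon> * norm g < cmod (\<gamma> m g - \<gamma> n g)"
    and near: "\<And>n. n \<in> I \<Longrightarrow> dist (p n) (q n) \<le> c / 2 * dist (p n) 0"
  shows "\<exists>J\<subseteq>I. infinite J \<and> bump_system A B p q J"
proof -
  have cK: "12 * c * (2 * K) \<le> \<epsilon> / 2" using c(3) by simp
  have bump_le: "cmod (A n * of_real (bump z r (p n)) - B n * of_real (bump z r (q n))) \<le> K"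
    if "r \<le> dist z 0" for n z r
    by (rule two_point_bump_le[OF _ K that]) (use bound in \<open>simp add: \<gamma>_def\<close>)
  have near16: "16 * dist (p n) (q n) \<le> dist (p n) 0" if "n \<in> I" for n
  proof -
    have "c / 2 * dist (p n) 0 \<le> 1 / 16 * dist (p n) 0" using c by (intro mult_right_mono) auto
    then show ?thesis using near[OF that] by simp
  qed
  have q0: "dist (p n) (q n) \<le> dist (q n) 0" if "n \<in> I" for n
    using near16[OF that] dist_triangle[of "p n" 0 "q n"] zero_le_dist[of "p n" "q n"] by linarith
  have \<theta>1: "c * x \<le> x" if "x \<ge> 0" for x
    using that c by (auto intro: mult_left_le_one_le)
  have boundAB: "cmod (A n - B n) * dist (p n) 0 \<le> 2 * K" if n: "n \<in> I" for n
  proof -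
    have "dist (q n) (p n) \<le> dist (p n) 0 / 2"
      using near16[OF n] zero_le_dist[of "p n" "q n"] unfolding dist_commute[of "q n"] by linarith
    then have "cmod (A n * of_real (dist (p n) 0 / 2) - B n * of_real (dist (p n) 0 / 2)) \<le> K"
      using bump_le[of "dist (p n) 0" "p n" n] by (simp add: bump_plateau)
    also have "A n * of_real (dist (p n) 0 / 2) - B n * of_real (dist (p n) 0 / 2) =
        (A n - B n) * of_real (dist (p n) 0 / 2)" by (simp add: algebra_simps)
    finally have "cmod (A n - B n) * (dist (p n) 0 / 2) \<le> K" unfolding norm_mult by simp
    then show ?thesis by simp
  qed
  have boundB: "cmod (B n) * dist (p n) (q n) \<le> 2 * K" if n: "n \<in> I" for n
  proof -
    have "cmod (B n) * (dist (p n) (q n) / 2) \<le> K"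
      using bump_le[OF q0[OF n], of n]
      by (simp add: bump_plateau bump_outside norm_mult)
    then show ?thesis by simp
  qed
  have \<eta>: "\<epsilon> / 2 > 0" using \<epsilon> by simp
  have \<kappa>: "c * \<epsilon> / 16 > 0" using c \<epsilon> by simp
  have scale: "c * \<epsilon> / 16 \<le> x * (c * R / 2)" if "\<epsilon> / 8 \<le> x * R" for x R
  proof -
    have "c / 2 * (\<epsilon> / 8) \<le> c / 2 * (x * R)" using that c by (intro mult_left_mono) auto
    then show ?thesis by (simp add: algebra_simps)
  qed
  obtain J1 where J1: "J1 \<subseteq> I" "infinite J1" and dich1:
    "(\<forall>m\<in>J1. \<forall>n\<in>J1. \<forall>g. cmod ((A m - B m) * (lip0_apply g (p m) - lip0_apply g 0) -
        (A n - B n) * (lip0_apply g (p n) - lip0_apply g 0)) \<le> \<epsilon> / 2 * norm g) \<or>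
     (\<forall>n\<in>J1. \<epsilon> / 2 / 2 \<le> cmod (A n - B n) * dist (p n) 0) \<and>
       ((\<forall>m\<in>J1. \<forall>n\<in>J1. m \<noteq> n \<longrightarrow> c * dist (p m) 0 + c * dist (p n) 0 \<le> dist (p m) (p n)) \<or>
        (\<forall>m\<in>J1. \<forall>n\<in>J1. m \<noteq> n \<longrightarrow> c * dist (p m) 0 + c * dist (p n) 0 \<le> dist (0 :: 'n) 0))"
    by (rule atom_dichotomy[OF I boundAB \<eta> c(1,2) cK])
  from dich1 show ?thesis
  proof (elim disjE conjE)
    assume big: "\<forall>n\<in>J1. \<epsilon> / 2 / 2 \<le> cmod (A n - B n) * dist (p n) 0"
      and dist: "\<forall>m\<in>J1. \<forall>n\<in>J1. m \<noteq> n \<longrightarrow> c * dist (p m) 0 + c * dist (p n) 0 \<le> dist (p m) (p n)"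
    have "bump_system A B p q J1"
    proof (rule bump_systemI[OF \<kappa>, where z = p and r = "\<lambda>n. c * dist (p n) 0"])
      fix n assume n: "n \<in> J1"
      show "c * dist (p n) 0 \<le> dist (p n) 0" by (rule \<theta>1) simp
      \<comment> \<open>\<open>near\<close> places \<open>q n\<close> on the plateau, so both
        coefficients get the same factor.\<close>
      have "bump (p n) (c * dist (p n) 0) (p n) = c * dist (p n) 0 / 2"
        "bump (p n) (c * dist (p n) 0) (q n) = c * dist (p n) 0 / 2"
        using c(1) near[of n] n J1(1) by (intro bump_plateau; auto simp: dist_commute)+
      then have eq: "A n * of_real (bump (p n) (c * dist (p n) 0) (p n)) -
          B n * of_real (bump (p n) (c * dist (p n) 0) (q n)) =
          (A n - B n) * of_real (c * dist (p n) 0 / 2)" by (simp only: left_diff_distrib)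
      have "\<epsilon> / 8 \<le> cmod (A n - B n) * dist (p n) 0" using big[rule_format, OF n] \<epsilon> by simp
      from scale[OF this] show "c * \<epsilon> / 16 \<le>
          cmod (A n * of_real (bump (p n) (c * dist (p n) 0) (p n)) -
            B n * of_real (bump (p n) (c * dist (p n) 0) (q n)))"
        unfolding eq using c(1) by (simp add: norm_mult)
    qed (use dist in blast)
    then show ?thesis using J1 by blast
  next
    assume big: "\<forall>n\<in>J1. \<epsilon> / 2 / 2 \<le> cmod (A n - B n) * dist (p n) 0"
      and "\<forall>m\<in>J1. \<forall>n\<in>J1. m \<noteq> n \<longrightarrow> c * dist (p m) 0 + c * dist (p n) 0 \<le> dist (0 :: 'n) 0"
    then show ?thesis
      using dist_0_0_not_separated[OF J1(2), of "\<lambda>n. dist (p n) 0" c 0] c(1) \<epsilon>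
        pos_of_mult_ge[of "\<epsilon> / 2 / 2"] by (meson half_gt_zero zero_le_dist)
  next
    assume clust1: "\<forall>m\<in>J1. \<forall>n\<in>J1. \<forall>g. cmod ((A m - B m) * (lip0_apply g (p m) - lip0_apply g 0) -
        (A n - B n) * (lip0_apply g (p n) - lip0_apply g 0)) \<le> \<epsilon> / 2 * norm g"
    obtain J2 where J2: "J2 \<subseteq> J1" "infinite J2" and dich2:
      "(\<forall>m\<in>J2. \<forall>n\<in>J2. \<forall>g. cmod (B m * (lip0_apply g (p m) - lip0_apply g (q m)) -
          B n * (lip0_apply g (p n) - lip0_apply g (q n))) \<le> \<epsilon> / 2 * norm g) \<or>
       (\<forall>n\<in>J2. \<epsilon> / 2 / 2 \<le> cmod (B n) * dist (p n) (q n)) \<and>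
         ((\<forall>m\<in>J2. \<forall>n\<in>J2. m \<noteq> n \<longrightarrow>
            c * dist (p m) (q m) + c * dist (p n) (q n) \<le> dist (p m) (p n)) \<or>
          (\<forall>m\<in>J2. \<forall>n\<in>J2. m \<noteq> n \<longrightarrow>
            c * dist (p m) (q m) + c * dist (p n) (q n) \<le> dist (q m) (q n)))"
      by (rule atom_dichotomy[OF J1(2) boundB \<eta> c(1,2) cK]) (use J1(1) in blast)+
    have J2I: "J2 \<subseteq> I" using J1 J2 by blast
    from dich2 show ?thesis
    proof (elim disjE conjE)
      assume big: "\<forall>n\<in>J2. \<epsilon> / 2 / 2 \<le> cmod (B n) * dist (p n) (q n)"
        and dist: "\<forall>m\<in>J2. \<forall>n\<in>J2. m \<noteq> n \<longrightarrow>
            c * dist (p m) (q m) + c * dist (p n) (q n) \<le> dist (p m) (p n)"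
      have "bump_system A B p q J2"
      proof (rule bump_systemI[OF \<kappa>, where z = p and r = "\<lambda>n. c * dist (p n) (q n)"])
        fix n assume n: "n \<in> J2"
        then have nI: "n \<in> I" using J2I by blast
        have le: "c * dist (p n) (q n) \<le> dist (p n) (q n)" by (rule \<theta>1) simp
        then show "c * dist (p n) (q n) \<le> dist (p n) 0"
          using near16[OF nI] zero_le_dist[of "p n" "q n"] by linarith
        \<comment> \<open>The bump at \<open>p n\<close> misses \<open>q n\<close> and sees only
          \<open>A n\<close>, whereas \<open>big\<close> concerns \<open>B n\<close>. On the scale
          \<open>dist (p n) (q n)\<close> they differ by at most \<epsilon>/8, half of the
          \<epsilon>/4 available.\<close>
        have "cmod (A n - B n) * dist (p n) (q n) \<le> cmod (A n - B n) * (c / 2 * dist (p n) 0)"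
          by (intro mult_left_mono near nI) auto
        also have "\<dots> = c / 2 * (cmod (A n - B n) * dist (p n) 0)" by simp
        also have "\<dots> \<le> c / 2 * (2 * K)" using c(1) by (intro mult_left_mono boundAB nI) auto
        also have "\<dots> \<le> \<epsilon> / 8" using c(3) \<epsilon> by simp
        finally have small: "cmod (A n - B n) * dist (p n) (q n) \<le> \<epsilon> / 8" .
        have "cmod (B n) * dist (p n) (q n) \<le> (cmod (A n) + cmod (A n - B n)) * dist (p n) (q n)"
          using norm_triangle_ineq4[of "A n" "A n - B n"] by (intro mult_right_mono) auto
        then have "\<epsilon> / 8 \<le> cmod (A n) * dist (p n) (q n)"
          using small big[rule_format, OF n] by (simp add: distrib_right)
        from scale[OF this] show "c * \<epsilon> / 16 \<le> cmod (A n * of_real (bump (p n) (c * dist (p n) (q n)) (p n)) -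
          B n * of_real (bump (p n) (c * dist (p n) (q n)) (q n)))"
          using c(1) le by (simp add: norm_mult bump_plateau bump_outside dist_commute)
      qed (use dist in blast)
      then show ?thesis using J2(2) J2I by blast
    next
      assume big: "\<forall>n\<in>J2. \<epsilon> / 2 / 2 \<le> cmod (B n) * dist (p n) (q n)"
        and dist: "\<forall>m\<in>J2. \<forall>n\<in>J2. m \<noteq> n \<longrightarrow>
            c * dist (p m) (q m) + c * dist (p n) (q n) \<le> dist (q m) (q n)"
      have "bump_system A B p q J2"
      proof (rule bump_systemI[OF \<kappa>, where z = q and r = "\<lambda>n. c * dist (p n) (q n)"])
        fix n assume n: "n \<in> J2"
        then have nI: "n \<in> I" using J2I by blast
        have le: "c * dist (p n) (q n) \<le> dist (p n) (q n)" by (rule \<theta>1) simp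
        then show "c * dist (p n) (q n) \<le> dist (q n) 0" using q0[OF nI] by linarith
        have "\<epsilon> / 8 \<le> cmod (B n) * dist (p n) (q n)" using big[rule_format, OF n] \<epsilon> by simp
        from scale[OF this] show "c * \<epsilon> / 16 \<le> cmod (A n * of_real (bump (q n) (c * dist (p n) (q n)) (p n)) -
          B n * of_real (bump (q n) (c * dist (p n) (q n)) (q n)))"
          using c(1) le by (simp add: norm_mult bump_plateau bump_outside)
      qed (use dist in blast)
      then show ?thesis using J2(2) J2I by blast
    next
      assume clust2: "\<forall>m\<in>J2. \<forall>n\<in>J2. \<forall>g. cmod (B m * (lip0_apply g (p m) - lip0_apply g (q m)) -
          B n * (lip0_apply g (p n) - lip0_apply g (q n))) \<le> \<epsilon> / 2 * norm g"
      obtain m where m: "m \<in> J2" using infinite_imp_nonempty[OF J2(2)] by blast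
      have "infinite (J2 - {m})" using J2(2) by simp
      then obtain n where n: "n \<in> J2" "n \<noteq> m" using infinite_imp_nonempty by blast
      obtain g where g: "\<epsilon> * norm g < cmod (\<gamma> m g - \<gamma> n g)" using sep n(2) by metis
      let ?g = "lip0_apply g"
      have "\<gamma> m g - \<gamma> n g = ((A m - B m) * ?g (p m) - (A n - B n) * ?g (p n)) +
          (B m * (?g (p m) - ?g (q m)) - B n * (?g (p n) - ?g (q n)))"
        by (simp add: \<gamma>_def algebra_simps)
      also have "cmod \<dots> \<le> cmod ((A m - B m) * ?g (p m) - (A n - B n) * ?g (p n)) +
          cmod (B m * (?g (p m) - ?g (q m)) - B n * (?g (p n) - ?g (q n)))"
        by (rule norm_triangle_ineq)
      also have "\<dots> \<le> \<epsilon> / 2 * norm g + \<epsilon> / 2 * norm g"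
        using clust1[rule_format, of m n g] clust2[rule_format, of m n g] m n J2(1)
        by (intro add_mono) auto
      finally show ?thesis using g by simp
    qed
  qed
qed

lemma separated_two_point_bump_system:
  fixes p q :: "nat \<Rightarrow> 'n::{metric_space, zero}" and A B :: "nat \<Rightarrow> complex"
  assumes K: "K > 0" and \<epsilon>: "\<epsilon> > 0"
    and bound: "\<And>n g. cmod (A n * lip0_apply g (p n) - B n * lip0_apply g (q n)) \<le> K * norm g"
    and sep: "\<And>m n. m \<noteq> n \<Longrightarrow> \<exists>g. \<epsilon> * norm g <
      cmod ((A m * lip0_apply g (p m) - B m * lip0_apply g (q m)) -
        (A n * lip0_apply g (p n) - B n * lip0_apply g (q n)))"
    and pq: "\<And>n. dist (q n) 0 \<le> dist (p n) 0"
  obtains J where "infinite J" "bump_system A B p q J"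
proof -
  define c where "c = min (1 / 8) (\<epsilon> / (48 * K))"
  have "c \<le> \<epsilon> / (48 * K)" by (simp add: c_def)
  then have "48 * c * K \<le> \<epsilon>" using K by (simp add: field_simps)
  moreover have "c > 0" "c \<le> 1 / 8" using K \<epsilon> by (auto simp: c_def)
  ultimately have c: "c > 0" "c \<le> 1 / 8" "48 * c * K \<le> \<epsilon>" by auto
  \<comment> \<open>The threshold \<open>c / 2\<close> is dictated by the close case, where
    \<open>q n\<close> has to lie on the plateau of a bump of radius
    \<open>c * dist (p n) 0\<close>; the far case takes it as its \<theta>.\<close>
  define I where "I = {n. c / 2 * dist (p n) 0 \<le> dist (p n) (q n)}"
  have "\<exists>J. infinite J \<and> bump_system A B p q J"
  proof (cases "infinite I")
    case True
    have "\<exists>J\<subseteq>I. infinite J \<and> bump_system A B p q J"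
    proof (rule bump_system_far[OF True K \<epsilon>, where \<theta> = "c / 2"])
      show "c / 2 > 0" "c / 2 \<le> 1 / 8" using c by auto
      show "c / 2 * dist (p n) 0 \<le> dist (p n) (q n)" if "n \<in> I" for n using that by (simp add: I_def)
    qed (rule bound, erule sep, rule pq)
    then show ?thesis by blast
  next
    case False
    then have "infinite (- I)" by (simp add: finite_compl)
    then have "\<exists>J\<subseteq>- I. infinite J \<and> bump_system A B p q J"
    proof (rule bump_system_near[OF _ K \<epsilon> c])
      show "dist (p n) (q n) \<le> c / 2 * dist (p n) 0" if "n \<in> - I" for n using that by (simp add: I_def)
    qed (rule bound, erule sep)
    then show ?thesis by blast
  qed
  then show thesis using that by blast
qed

text \<open>Disjointly supported bumps span a copy of \<open>\<ell>\<^sup>\<infinity>\<close>; a functional supported on two points meets at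
  most two of the supports, so after passing to a subsequence the system is biorthogonal.\<close>

lemma bump_system_linf_section:
  fixes p q :: "nat \<Rightarrow> 'n::{metric_space, zero}" and A B :: "nat \<Rightarrow> complex"
  assumes I: "infinite I" and sys: "bump_system A B p q I"
  obtains \<phi> :: "nat \<Rightarrow> nat" and S :: "linf \<Rightarrow> 'n lip0" where "bounded_clinear S"
    "\<And>a k. A (\<phi> k) * lip0_apply (S a) (p (\<phi> k)) - B (\<phi> k) * lip0_apply (S a) (q (\<phi> k)) =
      apply_bcontfun a k"
proof -
  obtain z r \<kappa> where \<kappa>: "\<kappa> > 0" and r: "\<And>n. n \<in> I \<Longrightarrow> r n \<le> dist (z n) 0"
    and big: "\<And>n. n \<in> I \<Longrightarrow>
      \<kappa> \<le> cmod (A n * of_real (bump (z n) (r n) (p n)) - B n * of_real (bump (z n) (r n) (q n)))"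
    and dist: "\<And>m n. m \<in> I \<Longrightarrow> n \<in> I \<Longrightarrow> m \<noteq> n \<Longrightarrow> r m + r n \<le> dist (z m) (z n)"
    using sys unfolding bump_system_def by blast
  let ?b = "\<lambda>n w. bump (z n) (r n) w"
  have disj: "m = n" if "m \<in> I" "n \<in> I" "?b m w \<noteq> 0" "?b n w \<noteq> 0" for m n w
  proof (rule ccontr)
    assume "m \<noteq> n"
    then have "r m + r n \<le> dist (z m) (z n)" using dist that by blast
    also have "\<dots> \<le> dist w (z m) + dist w (z n)" by (rule dist_triangle3)
    also have "\<dots> < r m + r n" using bump_nonzero[OF that(3)] bump_nonzero[OF that(4)] by simp
    finally show False by simp
  qed
  \<comment> \<open>At most one bump is nonzero at \<open>p m\<close>, so the relation has at most
    one target for each \<open>m\<close>.\<close>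
  obtain J1 where J1: "J1 \<subseteq> I" "infinite J1"
    and free_p: "\<And>m n. m \<in> J1 \<Longrightarrow> n \<in> J1 \<Longrightarrow> m \<noteq> n \<Longrightarrow> \<not> (n \<in> I \<and> ?b n (p m) \<noteq> 0)"
    by (rule infinite_free_subset[OF I, of "\<lambda>m n. n \<in> I \<and> ?b n (p m) \<noteq> 0"]) (use disj in blast)+
  obtain J where J: "J \<subseteq> J1" "infinite J"
    and free_q: "\<And>m n. m \<in> J \<Longrightarrow> n \<in> J \<Longrightarrow> m \<noteq> n \<Longrightarrow> \<not> (n \<in> I \<and> ?b n (q m) \<noteq> 0)"
    by (rule infinite_free_subset[OF J1(2), of "\<lambda>m n. n \<in> I \<and> ?b n (q m) \<noteq> 0"]) (use disj in blast)+
  define \<phi> where "\<phi> = enumerate J"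
  have \<phi>J: "\<phi> k \<in> J" for k unfolding \<phi>_def by (rule enumerate_in_set[OF J(2)])
  have \<phi>I: "\<phi> k \<in> I" for k using \<phi>J J(1) J1(1) by blast
  have \<phi>_inj: "\<phi> j = \<phi> k \<longleftrightarrow> j = k" for j k
    using strict_mono_enumerate[OF J(2)] strict_mono_eq unfolding \<phi>_def by blast
  define D where
    "D k = A (\<phi> k) * of_real (?b (\<phi> k) (p (\<phi> k))) - B (\<phi> k) * of_real (?b (\<phi> k) (q (\<phi> k)))" for k
  have D: "\<kappa> \<le> cmod (D k)" for k unfolding D_def by (rule big[OF \<phi>I])
  \<comment> \<open>Normalised so that the functional with index \<open>\<phi> k\<close> takes the
    value 1 on \<open>\<sigma> k\<close>.\<close>
  define \<sigma> where "\<sigma> k w = of_real (?b (\<phi> k) w) / D k" for k w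
  have D0: "D k \<noteq> 0" for k using D[of k] \<kappa> by auto
  have \<sigma>0: "\<sigma> k w = 0 \<longleftrightarrow> ?b (\<phi> k) w = 0" for k w using D0 by (simp add: \<sigma>_def)
  have \<sigma>_lip: "cmod (\<sigma> k w - \<sigma> k w') \<le> dist w w' / \<kappa>" for k w w'
  proof -
    have "cmod (\<sigma> k w - \<sigma> k w') = \<bar>?b (\<phi> k) w - ?b (\<phi> k) w'\<bar> / cmod (D k)"
      by (simp add: \<sigma>_def norm_divide flip: diff_divide_distrib of_real_diff)
    also have "\<dots> \<le> dist w w' / \<kappa>" using \<kappa> D by (intro frac_le bump_lipschitz) auto
    finally show ?thesis .
  qed
  \<comment> \<open>The index of the only bump that is nonzero at \<open>w\<close>. Where all of
    them vanish the choice is arbitrary and \<open>h a w\<close> is 0; so \<open>h a\<close> is the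
    pointwise sum of the bumps with coefficients \<open>a\<close>.\<close>
  define idx where "idx w = (SOME k. \<sigma> k w \<noteq> 0)" for w
  have idx: "idx w = k" if "\<sigma> k w \<noteq> 0" for k w
  proof -
    have "\<sigma> (idx w) w \<noteq> 0" unfolding idx_def by (rule someI[of "\<lambda>k. \<sigma> k w \<noteq> 0", OF that])
    then show ?thesis using that disj[OF \<phi>I \<phi>I] \<phi>_inj unfolding \<sigma>0 by blast
  qed
  define h where "h a w = apply_bcontfun a (idx w) * \<sigma> (idx w) w" for a :: linf and w
  have h_eq: "h a w = apply_bcontfun a k * \<sigma> k w" if "\<And>j. j \<noteq> k \<Longrightarrow> \<sigma> j w = 0" for a k w
    using that[of "idx w"] idx[of k w] by (cases "idx w = k") (auto simp: h_def)
  have h_lip: "cmod (h a w - h a w') \<le> 2 * norm a / \<kappa> * dist w w'" for a w w'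
  proof -
    have le: "cmod (apply_bcontfun a k * (\<sigma> k w - \<sigma> k w')) \<le> norm a / \<kappa> * dist w w'" for k w w'
      using mult_mono[OF norm_bounded[of a k] \<sigma>_lip[of k w w']] by (simp add: norm_mult)
    have nonneg: "0 \<le> norm a / \<kappa> * dist w w'" using \<kappa> by simp
    show ?thesis
    proof (cases "idx w = idx w'")
      case True
      then have "h a w - h a w' = apply_bcontfun a (idx w) * (\<sigma> (idx w) w - \<sigma> (idx w) w')"
        by (simp add: h_def algebra_simps)
      then show ?thesis using le[of "idx w" w w'] nonneg by simp
    next
      case False
      \<comment> \<open>Each of the two active bumps vanishes at the other point, so two increments
        appear; hence the factor 2.\<close>
      then have "\<sigma> (idx w) w' = 0" "\<sigma> (idx w') w = 0" using idx by metis+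
      then have "h a w - h a w' = apply_bcontfun a (idx w) * (\<sigma> (idx w) w - \<sigma> (idx w) w') +
          apply_bcontfun a (idx w') * (\<sigma> (idx w') w - \<sigma> (idx w') w')"
        by (simp add: h_def)
      then show ?thesis
        using norm_triangle_ineq[of "apply_bcontfun a (idx w) * (\<sigma> (idx w) w - \<sigma> (idx w) w')"
            "apply_bcontfun a (idx w') * (\<sigma> (idx w') w - \<sigma> (idx w') w')"]
          le[of "idx w" w w'] le[of "idx w'" w w'] by simp
    qed
  qed
  have "\<sigma> k 0 = 0" for k
    unfolding \<sigma>0 using r[OF \<phi>I] by (intro bump_outside) (simp add: dist_commute)
  then have h0: "h a 0 = 0" for a by (simp add: h_def)
  define S where "S a = Lip0 (h a)" for a
  have "(2 * norm a / \<kappa>)-lipschitz_on UNIV (h a)" for a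
    using h_lip \<kappa> by (auto simp: lipschitz_on_def dist_norm)
  then have S: "lip0_apply (S a) = h a" for a
    unfolding S_def using h0 by (intro Lip0_inverse) auto
  show thesis
  proof (rule that)
    have scale: "S (c *\<^sub>C a) = c *\<^sub>C S a" for c a
      by (rule lip0_eqI) (simp add: S h_def scaleC_bcontfun_rep_eq scaleC_complex_def)
    have "bounded_linear S"
    proof (rule bounded_linear_intro[where K = "2 / \<kappa>"])
      show "S (a + b) = S a + S b" for a b
        by (rule lip0_eqI) (simp add: S h_def distrib_right)
      show "S (t *\<^sub>R a) = t *\<^sub>R S a" for t a
        using scale[of "of_real t" a] by (simp add: scaleC_of_real)
      show "norm (S a) \<le> norm a * (2 / \<kappa>)" for a
        by (rule norm_lip0_le) (use h_lip[of a] \<kappa> in \<open>simp_all add: S mult.commute\<close>)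
    qed
    then show "bounded_clinear S" using scale by (simp add: bounded_clinear_def)
    fix a k
    have "\<sigma> j (p (\<phi> k)) = 0 \<and> \<sigma> j (q (\<phi> k)) = 0" if "j \<noteq> k" for j
    proof -
      have "\<phi> k \<noteq> \<phi> j" using that \<phi>_inj[of k j] by simp
      then show ?thesis
        using free_p[OF subsetD[OF J(1) \<phi>J[of k]] subsetD[OF J(1) \<phi>J[of j]]]
          free_q[OF \<phi>J[of k] \<phi>J[of j]] \<phi>I[of j] by (simp add: \<sigma>0)
    qed
    then have "lip0_apply (S a) (p (\<phi> k)) = apply_bcontfun a k * \<sigma> k (p (\<phi> k))"
      "lip0_apply (S a) (q (\<phi> k)) = apply_bcontfun a k * \<sigma> k (q (\<phi> k))"
      unfolding S by (intro h_eq; simp)+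
    then have "A (\<phi> k) * lip0_apply (S a) (p (\<phi> k)) - B (\<phi> k) * lip0_apply (S a) (q (\<phi> k)) =
        apply_bcontfun a k * (A (\<phi> k) * \<sigma> k (p (\<phi> k)) - B (\<phi> k) * \<sigma> k (q (\<phi> k)))"
      by (simp add: algebra_simps)
    also have "A (\<phi> k) * \<sigma> k (p (\<phi> k)) - B (\<phi> k) * \<sigma> k (q (\<phi> k)) = D k / D k"
      unfolding \<sigma>_def times_divide_eq_right diff_divide_distrib[symmetric] D_def[symmetric] ..
    finally show "A (\<phi> k) * lip0_apply (S a) (p (\<phi> k)) - B (\<phi> k) * lip0_apply (S a) (q (\<phi> k)) =
        apply_bcontfun a k" using D0 by simp
  qed
qed

section \<open>Non-compact weighted composition operators\<close>

text \<open>By completeness the closure of the image is not totally bounded. Halving the radius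
  leaves room to pass from closed balls covering the image to open balls covering its
  closure.\<close>

lemma not_compact_operator_separated_images:
  fixes T :: "'a::complex_normed_vector \<Rightarrow> 'b::{complex_normed_vector, banach}"
  assumes "\<not> compact_operator T"
  shows "\<exists>e>0. \<exists>g :: nat \<Rightarrow> 'a.
    (\<forall>n. norm (g n) \<le> 1) \<and> (\<forall>m n. m \<noteq> n \<longrightarrow> e \<le> dist (T (g m)) (T (g n)))"
proof -
  have "complete (closure (T ` cball 0 1))" by (simp add: complete_eq_closed)
  then obtain e where e: "e > 0"
    "\<And>k. finite k \<Longrightarrow> \<not> closure (T ` cball 0 1) \<subseteq> (\<Union>x\<in>k. ball x e)"
    using assms unfolding compact_operator_def compact_eq_totally_bounded by blast
  have ex: "\<exists>g\<in>cball 0 1. \<forall>h\<in>F. e / 2 \<le> dist (T g) (T h)" if F: "finite F" for F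
  proof (rule ccontr)
    assume contr: "\<not> ?thesis"
    have "T ` cball 0 1 \<subseteq> (\<Union>x\<in>T ` F. cball x (e / 2))"
    proof clarify
      fix g :: 'a assume "g \<in> cball 0 1"
      then obtain h where "h \<in> F" "dist (T g) (T h) < e / 2" using contr by (meson not_le)
      then have "T h \<in> T ` F" "T g \<in> cball (T h) (e / 2)" by (auto simp: dist_commute)
      then show "T g \<in> (\<Union>x\<in>T ` F. cball x (e / 2))" by (rule UN_I)
    qed
    moreover have "closed (\<Union>x\<in>T ` F. cball x (e / 2))" using F by (intro closed_UN) auto
    ultimately have "closure (T ` cball 0 1) \<subseteq> (\<Union>x\<in>T ` F. cball x (e / 2))" by (rule closure_minimal)
    also have "\<dots> \<subseteq> (\<Union>x\<in>T ` F. ball x e)" using e(1) by fastforce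
    finally show False using e(2)[of "T ` F"] F by blast
  qed
  have "\<exists>g. (\<forall>n :: nat. g n \<in> cball 0 1) \<and> (\<forall>m n. m \<noteq> n \<longrightarrow> e / 2 \<le> dist (T (g m)) (T (g n)))"
    by (rule separated_sequence[of _ "\<lambda>g h. e / 2 \<le> dist (T g) (T h)"])
      (erule ex, simp add: dist_commute)
  then show ?thesis using e(1) by (intro exI[of _ "e / 2"]) auto
qed

text \<open>A finite \<open>\<epsilon>\<close>-net among the difference quotients would make the image of the unit ball totally
  bounded, since finitely many bounded functionals can be stabilised along an infinite set.\<close>

lemma not_compact_operator_separated_quotients:
  fixes T :: "'n::{metric_space, zero} lip0 \<Rightarrow> 'm::{metric_space, zero} lip0"
  defines "\<gamma> \<equiv> \<lambda>x y g. (lip0_apply (T g) x - lip0_apply (T g) y) / of_real (dist x y)"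
  assumes T: "bounded_clinear T" and "\<not> compact_operator T" and total: "\<And>x y. P x y \<or> P y x"
  shows "\<exists>\<epsilon>>0. \<exists>x y. (\<forall>k :: nat. x k \<noteq> y k \<and> P (x k) (y k)) \<and>
    (\<forall>m n. m \<noteq> n \<longrightarrow> (\<exists>g. \<epsilon> * norm g < cmod (\<gamma> (x m) (y m) g - \<gamma> (x n) (y n) g)))"
proof -
  interpret bounded_linear T by (rule bounded_clinear_imp_bounded_linear[OF T])
  obtain e and g :: "nat \<Rightarrow> 'n lip0" where e: "e > 0" and gsep: "\<forall>n. norm (g n) \<le> 1"
    "\<forall>m n. m \<noteq> n \<longrightarrow> e \<le> dist (T (g m)) (T (g n))"
    using not_compact_operator_separated_images[OF assms(3)] by blast
  have g: "norm (g n) \<le> 1" for n using gsep(1) by blast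
  have sep: "e \<le> dist (T (g m)) (T (g n))" if "m \<noteq> n" for m n using gsep(2) that by blast
  obtain K where K: "\<And>h. norm (T h) \<le> norm h * K" "K > 0" using pos_bounded by blast
  have \<gamma>_le: "cmod (\<gamma> x y h) \<le> norm (T h)" for x y h
    using norm_lip0_bound[of "T h" x y] norm_ge_zero[of "T h"]
    by (cases "x = y") (auto simp: \<gamma>_def norm_divide divide_le_eq)
  have \<gamma>_diff: "\<gamma> x y (h - h') = \<gamma> x y h - \<gamma> x y h'" for x y h h'
    by (simp add: \<gamma>_def diff diff_divide_distrib)
  \<comment> \<open>An assumed net will give \<open>norm (T h) \<le> 3 * \<epsilon> < e\<close>: one
    \<epsilon> for the net functional, and two for the distance from the net, as
    \<open>norm h \<le> 2\<close>.\<close>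
  define \<epsilon> where "\<epsilon> = e / 4"
  \<comment> \<open>\<open>P\<close> fixes the order of the two points in a difference quotient;
    \<open>total\<close> makes one order available for each pair.\<close>
  define A where "A = {(x, y). x \<noteq> y \<and> P x y}"
  define R where "R = (\<lambda>(x, y) (x', y'). \<exists>h. \<epsilon> * norm h < cmod (\<gamma> x y h - \<gamma> x' y' h))"
  have osc: "\<exists>J. infinite (J :: nat set) \<and> (\<forall>m\<in>J. \<forall>n\<in>J. \<forall>(x, y)\<in>F. cmod (\<gamma> x y (g m - g n)) < \<epsilon>)"
    if "finite F" for F
    using that
  proof induction
    case empty
    then show ?case by (intro exI[of _ UNIV]) auto
  next
    case (insert xy F)
    then obtain J where J: "infinite J"
      "\<forall>m\<in>J. \<forall>n\<in>J. \<forall>(x, y)\<in>F. cmod (\<gamma> x y (g m - g n)) < \<epsilon>" by blast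
    obtain x y where xy: "xy = (x, y)" by (cases xy)
    have "cmod (\<gamma> x y (g n)) \<le> K" for n
    proof -
      have "cmod (\<gamma> x y (g n)) \<le> norm (g n) * K" using \<gamma>_le K(1) order_trans by blast
      also have "\<dots> \<le> 1 * K" using g K(2) by (intro mult_right_mono) auto
      finally show ?thesis by simp
    qed
    then obtain J' where "J' \<subseteq> J" "infinite J'"
      "\<And>m n. m \<in> J' \<Longrightarrow> n \<in> J' \<Longrightarrow> cmod (\<gamma> x y (g m) - \<gamma> x y (g n)) < \<epsilon>"
      using infinite_bounded_small_oscillation[OF J(1), of "\<lambda>n. \<gamma> x y (g n)" K \<epsilon>] e
      by (auto simp: \<epsilon>_def)
    then show ?case using J(2) by (intro exI[of _ J']) (auto simp: xy \<gamma>_diff subset_iff)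
  qed
  have ex: "\<exists>\<pi>\<in>A. \<forall>\<pi>'\<in>F. R \<pi> \<pi>'" if F: "finite F" for F
  proof (rule ccontr)
    assume contr: "\<not> ?thesis"
    obtain J :: "nat set" where J: "infinite J"
      "\<forall>m\<in>J. \<forall>n\<in>J. \<forall>(x, y)\<in>F. cmod (\<gamma> x y (g m - g n)) < \<epsilon>" using osc[OF F] by blast
    obtain m where m: "m \<in> J" using infinite_imp_nonempty[OF J(1)] by blast
    have "infinite (J - {m})" using J(1) by simp
    then obtain n where n: "n \<in> J" "n \<noteq> m" using infinite_imp_nonempty by blast
    define h where "h = g m - g n"
    have h2: "norm h \<le> 2" using norm_triangle_ineq4[of "g m" "g n"] g[of m] g[of n] by (simp add: h_def)
    have bound: "cmod (lip0_apply (T h) x - lip0_apply (T h) y) \<le> 3 * \<epsilon> * dist x y"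
      if xy: "(x, y) \<in> A" for x y
    proof -
      obtain x' y' where xy': "(x', y') \<in> F" "\<not> R (x, y) (x', y')" using contr xy by force
      then have "cmod (\<gamma> x y h - \<gamma> x' y' h) \<le> \<epsilon> * norm h" by (auto simp: R_def not_less)
      also have "\<dots> \<le> \<epsilon> * 2" using h2 e by (intro mult_left_mono) (auto simp: \<epsilon>_def)
      finally have "cmod (\<gamma> x y h - \<gamma> x' y' h) \<le> 2 * \<epsilon>" by simp
      moreover have "cmod (\<gamma> x' y' h) < \<epsilon>" using J(2) m n(1) xy'(1) unfolding h_def by blast
      ultimately have "cmod (\<gamma> x y h) \<le> 3 * \<epsilon>"
        using norm_triangle_ineq2[of "\<gamma> x y h" "\<gamma> x' y' h"] by linarith
      then show ?thesis using xy by (simp add: \<gamma>_def norm_divide A_def divide_le_eq)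
    qed
    have "norm (T h) \<le> 3 * \<epsilon>"
    proof (rule norm_lip0_le)
      fix x y
      consider "x = y" | "(x, y) \<in> A" | "(y, x) \<in> A" using total[of x y] by (auto simp: A_def)
      then show "cmod (lip0_apply (T h) x - lip0_apply (T h) y) \<le> 3 * \<epsilon> * dist x y"
        using bound[of x y] bound[of y x] by cases (auto simp: dist_commute norm_minus_commute)
    qed (use e in \<open>simp add: \<epsilon>_def\<close>)
    moreover have "e \<le> norm (T h)" using sep[of m n] n(2) by (simp add: h_def dist_norm diff)
    ultimately show False using e by (simp add: \<epsilon>_def)
  qed
  have sym: "R \<pi>' \<pi>" if "R \<pi> \<pi>'" for \<pi> \<pi>'
    using that by (auto simp: R_def norm_minus_commute split: prod.splits)
  have "\<exists>s. (\<forall>n. s n \<in> A) \<and> (\<forall>m n :: nat. m \<noteq> n \<longrightarrow> R (s m) (s n))"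
    by (rule separated_sequence[of A R]) (erule ex, erule sym)
  then obtain s where s: "\<And>n. s n \<in> A" "\<And>m n :: nat. m \<noteq> n \<Longrightarrow> R (s m) (s n)" by blast
  have "fst (s k) \<noteq> snd (s k) \<and> P (fst (s k)) (snd (s k))" for k
    using s(1)[of k] by (auto simp: A_def)
  moreover have "\<exists>h. \<epsilon> * norm h < cmod (\<gamma> (fst (s m)) (snd (s m)) h - \<gamma> (fst (s n)) (snd (s n)) h)"
    if "m \<noteq> n" for m n
    using s(2)[OF that] by (simp add: R_def case_prod_beta)
  moreover have "\<epsilon> > 0" using e by (simp add: \<epsilon>_def)
  ultimately have "\<epsilon> > 0 \<and> (\<forall>k. fst (s k) \<noteq> snd (s k) \<and> P (fst (s k)) (snd (s k))) \<and>
    (\<forall>m n. m \<noteq> n \<longrightarrow> (\<exists>h. \<epsilon> * norm h <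
      cmod (\<gamma> (fst (s m)) (snd (s m)) h - \<gamma> (fst (s n)) (snd (s n)) h)))" by blast
  then show ?thesis
    by (intro exI[of _ \<epsilon>]) (rule conjE, assumption, rule conjI, assumption,
        rule exI[of _ "\<lambda>n. fst (s n)"], rule exI[of _ "\<lambda>n. snd (s n)"])
qed

text \<open>The Lipschitz norm bounds every quotient; where \<open>x k = y k\<close> the quotient is
  0 by division by zero.\<close>

lemma bounded_clinear_difference_quotients:
  fixes x y :: "nat \<Rightarrow> 'm::{metric_space, zero}"
  obtains L :: "'m lip0 \<Rightarrow> linf" where "bounded_clinear L"
    "\<And>h k. apply_bcontfun (L h) k =
      (lip0_apply h (x k) - lip0_apply h (y k)) / of_real (dist (x k) (y k))"
proof -
  define L where "L h = Bcontfun (\<lambda>k. (lip0_apply h (x k) - lip0_apply h (y k)) /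
      of_real (dist (x k) (y k)))" for h :: "'m lip0"
  have le: "cmod ((lip0_apply h (x k) - lip0_apply h (y k)) / of_real (dist (x k) (y k))) \<le> norm h"
    for h :: "'m lip0" and k
    using norm_lip0_bound[of h "x k" "y k"] norm_ge_zero[of h]
    by (cases "x k = y k") (auto simp: norm_divide divide_le_eq)
  have L: "apply_bcontfun (L h) k =
      (lip0_apply h (x k) - lip0_apply h (y k)) / of_real (dist (x k) (y k))" for h k
    unfolding L_def by (subst apply_Bcontfun_nat[OF le]) simp
  have scale: "L (c *\<^sub>C h) = c *\<^sub>C L h" for c h
    by (rule bcontfun_eqI) (simp add: L scaleC_bcontfun_rep_eq scaleC_complex_def right_diff_distrib)
  have "bounded_linear L"
  proof (rule bounded_linear_intro[where K = 1])
    show "L (h + h') = L h + L h'" for h h'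
      by (rule bcontfun_eqI) (simp add: L add_divide_distrib diff_divide_distrib)
    show "L (t *\<^sub>R h) = t *\<^sub>R L h" for t h
      using scale[of "of_real t" h] by (simp add: scaleC_of_real)
    show "norm (L h) \<le> norm h * 1" for h
      using le by (auto intro!: norm_bound simp: L)
  qed
  then show thesis using scale L by (intro that[of L]) (auto simp: bounded_clinear_def)
qed

text \<open>The difference quotients of the image are two-point functionals at
  \<open>f (x k)\<close> and \<open>f (y k)\<close>, with the weights divided by
  \<open>dist (x k) (y k)\<close> as coefficients.\<close>

lemma not_compact_weighted_composition_linf_factors:
  fixes f :: "'m::{metric_space, zero} \<Rightarrow> 'n::{metric_space, zero}"
  assumes wd: "weighted_composition_well_defined w f"
    and T: "bounded_clinear (weighted_composition w f)"
    and "\<not> compact_operator (weighted_composition w f)"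
  shows "linf_factors (weighted_composition w f)"
proof -
  let ?T = "weighted_composition w f"
  interpret bounded_linear ?T by (rule bounded_clinear_imp_bounded_linear[OF T])
  obtain K where K: "\<And>h. norm (?T h) \<le> norm h * K" "K > 0" using pos_bounded by blast
  obtain \<epsilon> x y where \<epsilon>: "\<epsilon> > 0"
    and xy: "\<forall>k :: nat. x k \<noteq> y k \<and> dist (f (y k)) 0 \<le> dist (f (x k)) 0"
    and sep: "\<forall>m n. m \<noteq> n \<longrightarrow> (\<exists>g. \<epsilon> * norm g <
      cmod ((lip0_apply (?T g) (x m) - lip0_apply (?T g) (y m)) / of_real (dist (x m) (y m)) -
        (lip0_apply (?T g) (x n) - lip0_apply (?T g) (y n)) / of_real (dist (x n) (y n))))"
    using not_compact_operator_separated_quotients[OF T assms(3),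
      of "\<lambda>x y. dist (f y) 0 \<le> dist (f x) 0", OF linorder_linear] by blast
  define A where "A k = w (x k) / of_real (dist (x k) (y k))" for k
  define B where "B k = w (y k) / of_real (dist (x k) (y k))" for k
  have eq: "(lip0_apply (?T g) (x k) - lip0_apply (?T g) (y k)) / of_real (dist (x k) (y k)) =
      A k * lip0_apply g (f (x k)) - B k * lip0_apply g (f (y k))" for g k
    by (simp add: lip0_apply_weighted_composition[OF wd] A_def B_def diff_divide_distrib)
  have bound: "cmod (A k * lip0_apply g (f (x k)) - B k * lip0_apply g (f (y k))) \<le> K * norm g" for k g
  proof -
    have "cmod (A k * lip0_apply g (f (x k)) - B k * lip0_apply g (f (y k))) \<le> norm (?T g)"
      unfolding eq[symmetric] using norm_lip0_bound[of "?T g" "x k" "y k"] xy[rule_format, of k]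
      by (simp add: norm_divide divide_le_eq)
    then show ?thesis using K(1)[of g] by (simp add: mult.commute)
  qed
  obtain J where J: "infinite J" "bump_system A B (\<lambda>k. f (x k)) (\<lambda>k. f (y k)) J"
    by (rule separated_two_point_bump_system[OF K(2) \<epsilon>, where A = A and B = B and
          p = "\<lambda>k. f (x k)" and q = "\<lambda>k. f (y k)"])
      (rule bound, erule sep[unfolded eq, rule_format], rule xy[rule_format, THEN conjunct2], rule that)
  obtain \<phi> and S :: "linf \<Rightarrow> 'n lip0" where S: "bounded_clinear S"
    and \<phi>: "\<And>a k. A (\<phi> k) * lip0_apply (S a) (f (x (\<phi> k))) - B (\<phi> k) * lip0_apply (S a) (f (y (\<phi> k))) =
      apply_bcontfun a k"
    by (rule bump_system_linf_section[OF J], rule that)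
  obtain L :: "'m lip0 \<Rightarrow> linf" where L: "bounded_clinear L" "\<And>h k. apply_bcontfun (L h) k =
      (lip0_apply h (x (\<phi> k)) - lip0_apply h (y (\<phi> k))) / of_real (dist (x (\<phi> k)) (y (\<phi> k)))"
    by (rule bounded_clinear_difference_quotients[of "\<lambda>k. x (\<phi> k)" "\<lambda>k. y (\<phi> k)"], rule that)
  have "L (?T (S a)) = a" for a
    by (rule bcontfun_eqI) (simp only: L(2) eq \<phi>)
  then show ?thesis unfolding linf_factors_def using S L(1) by blast
qed

text \<open>Evaluation at a point is bounded by its distance to the base point; this supplies the
  functionals that make the weak topology Hausdorff.\<close>

lemma lip0_point_separating:
  fixes g h :: "'a::{metric_space, zero} lip0"
  assumes "g \<noteq> h"
  shows "\<exists>\<phi> :: 'a lip0 \<Rightarrow> complex. bounded_clinear \<phi> \<and> \<phi> g \<noteq> \<phi> h"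
proof -
  obtain x where x: "lip0_apply g x \<noteq> lip0_apply h x" using assms lip0_eqI by blast
  have "bounded_linear (\<lambda>g :: 'a lip0. lip0_apply g x)"
  proof (rule bounded_linear_intro[where K = "dist x 0"])
    show "lip0_apply (r *\<^sub>R g) x = r *\<^sub>R lip0_apply g x" for r and g :: "'a lip0"
      by (simp add: scaleC_complex_def flip: scaleC_of_real)
    show "norm (lip0_apply g x) \<le> norm g * dist x 0" for g :: "'a lip0"
      using norm_lip0_bound[of g x 0] by simp
  qed simp
  then have "bounded_clinear (\<lambda>g :: 'a lip0. lip0_apply g x)"
    by (simp add: bounded_clinear_def scaleC_complex_def)
  then show ?thesis using x by blast
qed

theorem corollary3p5:
  fixes f :: "'m::{metric_space, zero} \<Rightarrow> 'n::{metric_space, zero}"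
    and \<omega> :: "'m \<Rightarrow> complex"
  assumes "infinite (UNIV :: 'm set)"
    and "infinite (UNIV :: 'n set)"
    and "weighted_composition_well_defined \<omega> f"
    and "bounded_clinear (weighted_composition \<omega> f)"
  shows
    "(compact_operator (weighted_composition \<omega> f) \<longleftrightarrow>
        weakly_compact_operator (weighted_composition \<omega> f)) \<and>
     (compact_operator (weighted_composition \<omega> f) \<longleftrightarrow>
        super_strictly_singular (weighted_composition \<omega> f)) \<and>
     (compact_operator (weighted_composition \<omega> f) \<longleftrightarrow>
        super_strictly_cosingular (weighted_composition \<omega> f)) \<and>
     (compact_operator (weighted_composition \<omega> f) \<longleftrightarrow>
        strictly_singular (weighted_composition \<omega> f)) \<and>
     (compact_operator (weighted_composition \<omega> f) \<longleftrightarrow>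
        strictly_cosingular (weighted_composition \<omega> f)) \<and>
     (compact_operator (weighted_composition \<omega> f) \<longleftrightarrow>
        \<not> fixes_copy_of_linf (weighted_composition \<omega> f)) \<and>
     (compact_operator (weighted_composition \<omega> f) \<longleftrightarrow>
        \<not> fixes_complemented_copy_of_linf (weighted_composition \<omega> f))"
proof -
  let ?T = "weighted_composition \<omega> f"
  note T = assms(4)
  have nc: "linf_factors ?T" if "\<not> compact_operator ?T"
    using not_compact_weighted_composition_linf_factors[OF assms(3) T that] .
  have compl: "fixes_complemented_copy_of_linf ?T \<longleftrightarrow> linf_factors ?T"
    using fixes_complemented_copy_imp_linf_factors linf_factors_imp_fixes_complemented_copy[OF T]
    by blast
  have copy: "fixes_copy_of_linf ?T" if "fixes_complemented_copy_of_linf ?T"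
    using that unfolding fixes_complemented_copy_of_linf_def fixes_copy_of_linf_def by blast
  have "compact_operator ?T \<longleftrightarrow> weakly_compact_operator ?T"
    using compact_imp_weakly_compact[OF lip0_point_separating, of ?T]
      linf_factors_imp_not_weakly_compact[OF T] nc by blast
  moreover have "compact_operator ?T \<longleftrightarrow> super_strictly_cosingular ?T"
    using compact_imp_super_strictly_cosingular linf_factors_imp_not_super_strictly_cosingular[OF T] nc
    by blast
  moreover have "compact_operator ?T \<longleftrightarrow> strictly_cosingular ?T"
    using compact_imp_strictly_cosingular[OF T] linf_factors_imp_not_strictly_cosingular[OF T] nc by blast
  \<comment> \<open>Chained with \<open>copy\<close> and \<open>compl\<close>, these lead from
    compactness through the singular properties to the absence of a factorisation, where
    \<open>nc\<close> closes the circle.\<close>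
  moreover note compact_imp_super_strictly_singular[OF T]
    super_strictly_singular_imp_strictly_singular[of ?T]
    strictly_singular_imp_not_fixes_copy_of_linf[of ?T]
  ultimately show ?thesis using nc compl copy by blast
qed

end
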